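(* For every $\delta\in(0,1)$ there exists a symmetric convex body $K\subseteq\mathbb{R}^2$ such that $$|C_\delta K|_2>|C_\delta B_K|_2 .$$ Moreover, $K$ can be chosen arbitrarily close to the Euclidean ball in the $C^\infty$ topology: for every neighborhood $\mathcal{U}$ of the constant function $1$ in $C^\infty(S^1)$, $K$ can be chosen so that its radial function $\rho_K$ belongs to $\mathcal{U}$.
   Context: A convex body in $\mathbb{R}^2$ is a compact convex set with non-empty interior; it is symmetric if $x_0+K=x_0-K$ for some $x_0$. $|\cdot|_2$ denotes Lebesgue measure in the plane. For a convex body $K$ and $\delta\in(0,1)$, $C_\delta K=\{x\in\mathbb{R}^2 : |K\cap(K+x)|_2\ge \delta |K|_2\}$. $B_K$ is the Euclidean disc centered at the origin with the same area as $K$. For a convex body $K$ containing the origin in its interior, the radial function $\rho_K:S^1\to(0,\infty)$ is defined by $\rho_K(v)=\max\{r\ge0: rv\in K\}$; the unit disc has radial function $1$. *)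

theory Defs
  imports "HOL-Analysis.Analysis"
begin

abbreviation area :: "(real^2) set \<Rightarrow> real" where
  "area \<equiv> measure lebesgue"

definition convex_body :: "(real^2) set \<Rightarrow> bool" where
  "convex_body K \<longleftrightarrow> compact K \<and> convex K \<and> interior K \<noteq> {}"

text \<open>Read literally, the equation says \<open>K = - K\<close> whatever \<open>x0\<close> is. This is the strong reading:
  such a set is also symmetric about a point in the sense \<open>K - x0 = x0 - K\<close>, with \<open>x0 = 0\<close>.\<close>

definition symmetric_body :: "(real^2) set \<Rightarrow> bool" where
  "symmetric_body K \<longleftrightarrow> (\<exists>x0. (\<lambda>y. x0 + y) ` K = (\<lambda>y. x0 - y) ` K)"

definition conv_body :: "real \<Rightarrow> (real^2) set \<Rightarrow> (real^2) set" where
  "conv_body \<delta> K = {x. area (K \<inter> (\<lambda>y. y + x) ` K) \<ge> \<delta> * area K}"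

definition equal_area_disc :: "(real^2) set \<Rightarrow> (real^2) set" where
  "equal_area_disc K = (THE B. area B = area K \<and> (\<exists>r\<ge>0. B = cball 0 r))"

abbreviation unit_circle :: "(real^2) set" where
  "unit_circle \<equiv> sphere 0 1"

text \<open>Functions on the circle are represented by functions on the plane that are \<open>undefined\<close>
  off the circle, so that equality of such functions is equality on the circle.\<close>

definition radial_function :: "(real^2) set \<Rightarrow> real^2 \<Rightarrow> real" where
  "radial_function K = (\<lambda>v\<in>unit_circle. GREATEST r. 0 \<le> r \<and> r *\<^sub>R v \<in> K)"

text \<open>The derivative of order \<open>k\<close> with respect to the angle. The lift of the function to the
  universal cover \<open>t \<mapsto> (cos t, sin t)\<close> of the circle is smooth iff the function is.\<close>

definition circle_deriv :: "nat \<Rightarrow> (real^2 \<Rightarrow> real) \<Rightarrow> real \<Rightarrow> real" where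
  "circle_deriv k f = (deriv ^^ k) (\<lambda>t. f (vector [cos t, sin t]))"

definition smooth_circle_functions :: "(real^2 \<Rightarrow> real) set" where
  "smooth_circle_functions =
     {f \<in> extensional unit_circle. \<forall>k t. circle_deriv k f field_differentiable (at t)}"

definition Cinf_seminorm :: "nat \<Rightarrow> (real^2 \<Rightarrow> real) \<Rightarrow> real" where
  "Cinf_seminorm k f = (SUP t. \<bar>circle_deriv k f t\<bar>)"

definition Cinf_topology :: "(real^2 \<Rightarrow> real) topology" where
  "Cinf_topology = topology_generated_by
     {{g \<in> smooth_circle_functions. Cinf_seminorm k (\<lambda>v. g v - f v) < e} | f k e.
        f \<in> smooth_circle_functions \<and> e > 0}"

definition circle_one :: "real^2 \<Rightarrow> real" where
  "circle_one = (\<lambda>v\<in>unit_circle. 1)"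

definition Cinf_neighborhood :: "(real^2 \<Rightarrow> real) \<Rightarrow> (real^2 \<Rightarrow> real) set \<Rightarrow> bool" where
  "Cinf_neighborhood f U \<longleftrightarrow>
     U \<subseteq> topspace Cinf_topology \<and> (\<exists>V. openin Cinf_topology V \<and> f \<in> V \<and> V \<subseteq> U)"

end

theory Submission
  imports Defs "HOL-Analysis.Kronecker_Approximation_Theorem"
begin

text \<open>The body is a perturbed disc \<open>K\<close> with radial function \<open>1 + e * cos (m * t)\<close>, for a
  suitable even frequency \<open>m\<close> that depends on \<open>\<delta>\<close> only and all sufficiently small \<open>e > 0\<close>.
  Its area is at most \<open>pi * (1 + e\<^sup>2 / 2)\<close>, it is convex for small \<open>e\<close>, and every seminorm of its
  radial function minus \<open>1\<close> is \<open>O(e)\<close>.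

  For a convex body \<open>K = - K\<close> and linearly independent boundary points \<open>p\<close> and \<open>q\<close>, the intersection
  of \<open>K\<close> with \<open>K + (p + q)\<close> contains the cap of \<open>K\<close> beyond the chord \<open>p q\<close> and the reflection of this
  cap in the midpoint of the chord (\<open>reflect_cap\<close>). Hence \<open>p + q\<close> belongs to \<open>conv_body \<delta> K\<close> as
  soon as twice the area of the cap is at least \<open>\<delta> * area K\<close>. As \<open>conv_body \<delta> K\<close> is star-shaped
  about \<open>0\<close>, it contains the region enclosed by any closed curve of such sums \<open>p + q\<close>. For the unit
  disc, chords of half angle \<open>a\<close> with \<open>2 * a - sin (2 * a) = \<delta> * pi\<close> give the disc of radius
  \<open>2 * cos a\<close>, and a disc \<open>B\<close> of any radius satisfies
  \<open>area (conv_body \<delta> B) \<le> 4 * (cos a)\<^sup>2 * area B\<close> (\<open>area_conv_body_equal_area_disc_le\<close>).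

  In the perturbed disc the chord joins the boundary points at the angles \<open>t - \<alpha> t\<close> and \<open>t + \<alpha> t\<close>,
  where \<open>\<alpha> t = a + e * \<kappa> * cos (m * t) + e\<^sup>2 * (\<mu> + \<nu> * (cos (m * t))\<^sup>2)\<close>. The coefficients are
  chosen so that twice the area of every cap exceeds \<open>\<delta> * pi * (1 + e\<^sup>2 / 2)\<close> by
  \<open>2 * \<eta> * e\<^sup>2 + O(e\<^sup>3)\<close>, uniformly in \<open>t\<close>. The area enclosed by the curve of sums is then
  \<open>4 * pi * (cos a)\<^sup>2 * (1 + e\<^sup>2 / 2) + 2 * pi * e\<^sup>2 * (P / (sin a)\<^sup>2 - 2 * \<eta> * cos a / sin a) + O(e\<^sup>3)\<close>
  with \<open>P = w\<^sup>2 + (cos (m * a) - w * cos a / sin a)\<^sup>2 - (sin a)\<^sup>2\<close> and \<open>w = sin (m * a) / m\<close>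
  (\<open>gain_eq\<close>, \<open>eventually_expansion\<close>). By Dirichlet's approximation theorem \<open>m * a\<close> can be made close
  to a multiple of \<open>pi\<close>; then \<open>w\<close> is close to \<open>0\<close>, the cosine is close to \<open>1\<close> or \<open>-1\<close>, and
  \<open>P > 0\<close> because \<open>sin a < 1\<close>. A small \<open>\<eta> > 0\<close> then leaves a positive gain.\<close>

section \<open>Polar coordinates and polar bodies\<close>

text \<open>The unit vector of angle \<open>t\<close>.\<close>

definition dir :: "real \<Rightarrow> real^2" where
  "dir t = vector [cos t, sin t]"

lemma dir_nth [simp]: "dir t $ 1 = cos t" "dir t $ 2 = sin t"
  by (simp_all add: dir_def)

lemma inner_2: "(x :: real^2) \<bullet> y = x $ 1 * y $ 1 + x $ 2 * y $ 2"
  by (simp add: inner_vec_def sum_2)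

lemma inner_dir: "dir s \<bullet> dir t = cos (s - t)"
  by (simp add: inner_2 cos_diff)

lemma norm_dir [simp]: "norm (dir t) = 1"
  by (simp add: norm_eq_1 inner_dir)

lemma dir_nonzero [simp]: "dir t \<noteq> 0"
  using norm_dir[of t] by force

lemma dir_periodic: "dir (t + 2 * pi) = dir t"
  by (simp add: dir_def)

lemma dir_add_pi: "dir (t + pi) = - dir t"
  by (simp add: vec_eq_iff forall_2)

lemma dir_periodic_int: "dir (t + 2 * pi * of_int k) = dir t"
  using sin.plus_of_int[of t k] cos.plus_of_int[of t k] by (simp add: dir_def algebra_simps)

lemma dir_eq_iff: "dir s = dir t \<longleftrightarrow> (\<exists>k::int. s = t + 2 * pi * k)"
  using sin_cos_eq_iff[of s t] by (auto simp: vec_eq_iff forall_2 algebra_simps)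

lemma polar_form: obtains t where "0 \<le> t" "t < 2 * pi" "z = norm z *\<^sub>R dir t"
proof (cases "z = 0")
  case True
  then show ?thesis using that[of 0] by simp
next
  case False
  have "(z$1 / norm z)\<^sup>2 + (z$2 / norm z)\<^sup>2 = (z \<bullet> z) / (norm z)\<^sup>2"
    by (simp add: inner_2 power_divide add_divide_distrib power2_eq_square)
  also have "\<dots> = 1" using False by (simp add: power2_norm_eq_inner)
  finally obtain t where t: "0 \<le> t" "t < 2 * pi" "z$1 / norm z = cos t" "z$2 / norm z = sin t"
    using sincos_total_2pi by metis
  have "z = norm z *\<^sub>R dir t"
    using False by (simp add: vec_eq_iff forall_2 flip: t(3,4))
  then show ?thesis using t that by blast
qed

text \<open>Every angle has a representative within \<open>pi\<close> of a given one.\<close>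

lemma shift_to_window:
  fixes t \<phi> :: real
  obtains k :: int where "\<bar>t + 2 * pi * k - \<phi>\<bar> \<le> pi"
proof -
  define k :: int where "k = - \<lfloor>(t - \<phi> + pi) / (2 * pi)\<rfloor>"
  have "of_int (-k) \<le> (t - \<phi> + pi) / (2 * pi)" "(t - \<phi> + pi) / (2 * pi) < of_int (-k) + 1"
    unfolding k_def by linarith+
  then have "of_int (-k) * (2 * pi) \<le> t - \<phi> + pi" "t - \<phi> + pi < (of_int (-k) + 1) * (2 * pi)"
    by (simp_all add: field_simps)
  then have "\<bar>t + 2 * pi * k - \<phi>\<bar> \<le> pi" by (simp add: abs_le_iff algebra_simps)
  then show ?thesis by (rule that)
qed

text \<open>The star-shaped set whose radial function at angle \<open>t\<close> is \<open>\<rho> t\<close>. The function \<open>\<rho>\<close> is meant to be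
  nonnegative and \<open>2 * pi\<close>-periodic; otherwise larger values of \<open>\<rho>\<close> at equivalent angles win.\<close>

definition polar_body :: "(real \<Rightarrow> real) \<Rightarrow> (real^2) set" where
  "polar_body \<rho> = {r *\<^sub>R dir t | r t. 0 \<le> r \<and> r \<le> \<rho> t}"

lemma polar_body_mono:
  assumes "\<And>t. \<rho> t \<le> \<sigma> t"
  shows "polar_body \<rho> \<subseteq> polar_body \<sigma>"
  using assms order_trans unfolding polar_body_def by blast

lemma polar_body_const: "polar_body (\<lambda>t. R) = cball 0 R"
proof
  show "polar_body (\<lambda>t. R) \<subseteq> cball 0 R" by (auto simp: polar_body_def)
  show "cball 0 R \<subseteq> polar_body (\<lambda>t. R)"
  proof
    fix z :: "real^2" assume "z \<in> cball 0 R"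
    moreover obtain t where "z = norm z *\<^sub>R dir t" by (rule polar_form)
    ultimately show "z \<in> polar_body (\<lambda>t. R)" unfolding polar_body_def by force
  qed
qed

lemma smult_dir_mem_polar_body:
  assumes per: "\<And>t. \<rho> (t + 2 * pi) = \<rho> t" and pos: "\<And>t. 0 \<le> \<rho> t" and "0 \<le> r"
  shows "r *\<^sub>R dir t \<in> polar_body \<rho> \<longleftrightarrow> r \<le> \<rho> t"
proof
  assume "r *\<^sub>R dir t \<in> polar_body \<rho>"
  then obtain r' t' where e: "r *\<^sub>R dir t = r' *\<^sub>R dir t'" "0 \<le> r'" "r' \<le> \<rho> t'"
    unfolding polar_body_def by auto
  then have "norm (r *\<^sub>R dir t) = norm (r' *\<^sub>R dir t')" by simp
  then have r: "r = r'" using e(2) assms(3) by simp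
  interpret \<rho>: periodic_fun_simple \<rho> "2 * pi" by unfold_locales (rule per)
  show "r \<le> \<rho> t"
  proof (cases "r = 0")
    case False
    then have "dir t = dir t'" using e r by simp
    then obtain k :: int where "t = t' + 2 * pi * k" using dir_eq_iff by auto
    then have "\<rho> t = \<rho> t'" using \<rho>.plus_of_int[of t' k] by (simp add: algebra_simps)
    then show ?thesis using e r by simp
  qed (simp add: pos)
qed (use assms in \<open>auto simp: polar_body_def\<close>)

text \<open>Sturm comparison with the solutions \<open>cos\<close> and \<open>sin\<close> of \<open>y'' + y = 0\<close>.\<close>

lemma sturm_comparison:
  fixes \<psi> \<psi>' \<psi>'' :: "real \<Rightarrow> real"
  assumes d1: "\<And>t. (\<psi> has_real_derivative \<psi>' t) (at t)"
    and d2: "\<And>t. (\<psi>' has_real_derivative \<psi>'' t) (at t)"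
    and conv: "\<And>t. \<psi>'' t + \<psi> t \<ge> 0"
    and near: "\<bar>\<theta> - \<phi>\<bar> \<le> pi"
  shows "\<psi> \<phi> * cos (\<theta> - \<phi>) + \<psi>' \<phi> * sin (\<theta> - \<phi>) \<le> \<psi> \<theta>"
proof -
  \<comment> \<open>\<open>W\<close> is the Wronskian of \<open>\<psi>\<close> with the solution \<open>sin (\<theta> - \<tau>)\<close> of the homogeneous equation.\<close>
  define W where "W \<tau> = \<psi>' \<tau> * sin (\<theta> - \<tau>) + \<psi> \<tau> * cos (\<theta> - \<tau>)" for \<tau>
  have dW: "(W has_real_derivative (\<psi>'' \<tau> + \<psi> \<tau>) * sin (\<theta> - \<tau>)) (at \<tau>)" for \<tau>
    unfolding W_def by (auto intro!: derivative_eq_intros d1 d2 simp: algebra_simps)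
  have "W \<phi> \<le> W \<theta>"
  proof (cases "\<phi> \<le> \<theta>")
    case True
    show ?thesis
    proof (rule DERIV_nonneg_imp_nondecreasing[OF True])
      fix \<tau> assume "\<phi> \<le> \<tau>" "\<tau> \<le> \<theta>"
      then have "0 \<le> sin (\<theta> - \<tau>)" using near by (intro sin_ge_zero) auto
      then show "\<exists>y. (W has_real_derivative y) (at \<tau>) \<and> 0 \<le> y" using dW conv by fastforce
    qed
  next
    case False
    show ?thesis
    proof (rule DERIV_nonpos_imp_nonincreasing[where a = \<theta> and b = \<phi>])
      fix \<tau> assume "\<theta> \<le> \<tau>" "\<tau> \<le> \<phi>"
      then have "0 \<le> sin (\<tau> - \<theta>)" using near by (intro sin_ge_zero) auto
      then have "sin (\<theta> - \<tau>) \<le> 0" using sin_minus[of "\<tau> - \<theta>"] by simp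
      then show "\<exists>y. (W has_real_derivative y) (at \<tau>) \<and> y \<le> 0"
        using dW conv mult_nonneg_nonpos by blast
    qed (use False in simp)
  qed
  then show ?thesis by (simp add: W_def algebra_simps)
qed

text \<open>The tangent line of \<open>polar_body \<rho>\<close> at the boundary point of angle \<open>\<phi>\<close> is
  \<open>{z. z \<bullet> N \<phi> = 1}\<close>.\<close>

lemma polar_body_halfspaces:
  fixes \<rho> \<psi>' \<psi>'' :: "real \<Rightarrow> real"
  assumes per: "\<And>t. \<rho> (t + 2 * pi) = \<rho> t" and pos: "\<And>t. 0 < \<rho> t"
    and d1: "\<And>t. ((\<lambda>t. 1 / \<rho> t) has_real_derivative \<psi>' t) (at t)"
    and d2: "\<And>t. (\<psi>' has_real_derivative \<psi>'' t) (at t)"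
    and conv: "\<And>t. \<psi>'' t + 1 / \<rho> t \<ge> 0"
  defines "N \<equiv> \<lambda>\<phi>. (1 / \<rho> \<phi>) *\<^sub>R dir \<phi> + \<psi>' \<phi> *\<^sub>R dir (\<phi> + pi / 2)"
  shows "polar_body \<rho> = (\<Inter>\<phi>. {z. N \<phi> \<bullet> z \<le> 1})"
proof -
  have N: "N \<phi> \<bullet> (r *\<^sub>R dir t) = r * (1 / \<rho> \<phi> * cos (t - \<phi>) + \<psi>' \<phi> * sin (t - \<phi>))" for \<phi> r t
  proof -
    have "cos (\<phi> + pi / 2 - t) = sin (t - \<phi>)" "cos (\<phi> - t) = cos (t - \<phi>)"
      by (simp_all add: cos_add cos_diff sin_diff sin_add)
    then show ?thesis by (simp add: N_def inner_add_left inner_dir)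
  qed
  show ?thesis
  proof (intro equalityI subsetI INT_I CollectI)
    fix z \<phi> assume "z \<in> polar_body \<rho>"
    then obtain r t where z: "z = r *\<^sub>R dir t" "0 \<le> r" "r \<le> \<rho> t" unfolding polar_body_def by auto
    obtain k :: int where k: "\<bar>t + 2 * pi * k - \<phi>\<bar> \<le> pi" by (rule shift_to_window)
    define t' where "t' = t + 2 * pi * k"
    interpret \<rho>: periodic_fun_simple \<rho> "2 * pi" by unfold_locales (rule per)
    have t': "\<rho> t' = \<rho> t" "dir t' = dir t"
      using \<rho>.plus_of_int[of t k] dir_periodic_int by (simp_all add: t'_def algebra_simps)
    have "N \<phi> \<bullet> z = r * (1 / \<rho> \<phi> * cos (t' - \<phi>) + \<psi>' \<phi> * sin (t' - \<phi>))"
      using N[of \<phi> r t'] t' z by simp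
    also have "\<dots> \<le> r * (1 / \<rho> t')"
      using sturm_comparison[OF d1 d2 conv, of t' \<phi>] k z(2)
      by (intro mult_left_mono) (simp_all add: t'_def)
    also have "\<dots> \<le> 1" using z(3) t' pos[of t] by (simp add: field_simps)
    finally show "N \<phi> \<bullet> z \<le> 1" .
  next
    fix z assume *: "z \<in> (\<Inter>\<phi>. {z. N \<phi> \<bullet> z \<le> 1})"
    obtain t where t: "z = norm z *\<^sub>R dir t" by (rule polar_form)
    have "norm z * (1 / \<rho> t) = N t \<bullet> (norm z *\<^sub>R dir t)" using N[of t "norm z" t] by simp
    also have "\<dots> \<le> 1" using * t by auto
    finally have "norm z \<le> \<rho> t" using pos[of t] by (simp add: field_simps)
    then show "z \<in> polar_body \<rho>"
      unfolding polar_body_def using t by (intro CollectI exI[of _ "norm z"] exI[of _ t]) simp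
  qed
qed

text \<open>The radial function of the perturbed disc, and the perturbed disc itself.\<close>

definition wavy_radius :: "nat \<Rightarrow> real \<Rightarrow> real \<Rightarrow> real" where
  "wavy_radius m e t = 1 + e * cos (m * t)"

definition wavy_disc :: "nat \<Rightarrow> real \<Rightarrow> (real^2) set" where
  "wavy_disc m e = polar_body (wavy_radius m e)"

lemma wavy_radius_periodic: "wavy_radius m e (t + 2 * pi) = wavy_radius m e t"
  using cos.plus_of_nat[of "m * t" m] by (simp add: wavy_radius_def algebra_simps)

lemma wavy_radius_add_pi:
  assumes "even m"
  shows "wavy_radius m e (t + pi) = wavy_radius m e t"
proof -
  obtain k where "m = 2 * k" using assms by blast
  then show ?thesis
    using cos.plus_of_nat[of "m * t" k] by (simp add: wavy_radius_def algebra_simps)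
qed

text \<open>The frequency is even, which makes the body symmetric about \<open>0\<close>; the bound on \<open>e\<close> makes the
  function \<open>1 / \<rho>\<close> satisfy \<open>\<psi>'' + \<psi> \<ge> 0\<close>, which makes the body convex.\<close>

locale wavy =
  fixes m :: nat and e :: real
  assumes m_pos: "0 < m" and m_even: "even m" and e_nonneg: "0 \<le> e" and e_small: "e * (1 + (real m)\<^sup>2) < 1"
begin

abbreviation "\<rho> \<equiv> wavy_radius m e"
abbreviation "K \<equiv> wavy_disc m e"

lemma e_less_1: "e < 1"
proof -
  have "e * 1 \<le> e * (1 + (real m)\<^sup>2)" using e_nonneg by (intro mult_left_mono) auto
  then show ?thesis using e_small by simp
qed

lemma wavy_radius_ge: "1 - e \<le> \<rho> t"
proof -
  have "e * (-1) \<le> e * cos (m * t)" using e_nonneg by (intro mult_left_mono) auto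
  then show ?thesis by (simp add: wavy_radius_def)
qed

lemma wavy_radius_le: "\<rho> t \<le> 1 + e"
proof -
  have "e * cos (m * t) \<le> e * 1" using e_nonneg by (intro mult_left_mono) auto
  then show ?thesis by (simp add: wavy_radius_def)
qed

lemma wavy_radius_pos: "0 < \<rho> t"
  using wavy_radius_ge[of t] e_less_1 by linarith

lemma wavy_disc_halfspaces: "\<exists>N :: real \<Rightarrow> real^2. K = (\<Inter>\<phi>. {z. N \<phi> \<bullet> z \<le> 1})"
proof -
  define \<rho>1 where "\<rho>1 t = - (e * m * sin (m * t))" for t :: real
  define \<rho>2 where "\<rho>2 t = - (e * m * m * cos (m * t))" for t :: real
  have d1: "(\<rho> has_real_derivative \<rho>1 t) (at t)" for t
    unfolding wavy_radius_def \<rho>1_def by (auto intro!: derivative_eq_intros)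
  have d2: "(\<rho>1 has_real_derivative \<rho>2 t) (at t)" for t
    unfolding \<rho>1_def \<rho>2_def by (auto intro!: derivative_eq_intros)
  have nz: "\<rho> t \<noteq> 0" for t using wavy_radius_pos[of t] by simp
  define \<psi>' where "\<psi>' t = - \<rho>1 t / (\<rho> t)\<^sup>2" for t
  define \<psi>'' where "\<psi>'' t = (2 * (\<rho>1 t)\<^sup>2 - \<rho> t * \<rho>2 t) / (\<rho> t) ^ 3" for t
  have e1: "((\<lambda>t. 1 / \<rho> t) has_real_derivative \<psi>' t) (at t)" for t
    unfolding \<psi>'_def using nz[of t]
    by (auto intro!: derivative_eq_intros d1 simp: power2_eq_square)
  have e2: "(\<psi>' has_real_derivative \<psi>'' t) (at t)" for t
    unfolding \<psi>'_def[abs_def] \<psi>''_def using nz[of t]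
    by (auto intro!: derivative_eq_intros d1 d2 simp: power2_eq_square power3_eq_cube field_simps)
  have "\<psi>'' t + 1 / \<rho> t \<ge> 0" for t
  proof -
    have "e * cos (m * t) * (1 + m * m) \<ge> - 1"
    proof -
      have "e * (1 + m * m) * (-1) \<le> e * (1 + m * m) * cos (m * t)"
        using e_nonneg by (intro mult_left_mono) auto
      then show ?thesis using e_small by (simp add: algebra_simps power2_eq_square)
    qed
    then have "\<rho> t - \<rho>2 t \<ge> 0" by (simp add: wavy_radius_def \<rho>2_def algebra_simps)
    then have "0 \<le> 2 * (\<rho>1 t)\<^sup>2 + \<rho> t * (\<rho> t - \<rho>2 t)" using wavy_radius_pos[of t] by simp
    moreover have "\<psi>'' t + 1 / \<rho> t = (2 * (\<rho>1 t)\<^sup>2 + \<rho> t * (\<rho> t - \<rho>2 t)) / (\<rho> t) ^ 3"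
      using nz[of t] by (simp add: \<psi>''_def field_simps power2_eq_square power3_eq_cube)
    ultimately show ?thesis using wavy_radius_pos[of t] by simp
  qed
  then have "polar_body \<rho> = (\<Inter>\<phi>. {z. ((1 / \<rho> \<phi>) *\<^sub>R dir \<phi> + \<psi>' \<phi> *\<^sub>R dir (\<phi> + pi / 2)) \<bullet> z \<le> 1})"
    by (rule polar_body_halfspaces[OF wavy_radius_periodic wavy_radius_pos e1 e2])
  then show ?thesis
    unfolding wavy_disc_def by (rule exI[of _ "\<lambda>\<phi>. (1 / \<rho> \<phi>) *\<^sub>R dir \<phi> + \<psi>' \<phi> *\<^sub>R dir (\<phi> + pi / 2)"])
qed

lemma mem_wavy_disc: "0 \<le> r \<Longrightarrow> r *\<^sub>R dir t \<in> K \<longleftrightarrow> r \<le> \<rho> t"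
  unfolding wavy_disc_def
  using smult_dir_mem_polar_body[of \<rho>] wavy_radius_periodic wavy_radius_pos less_imp_le by metis

lemma convex_wavy_disc: "convex K"
  using wavy_disc_halfspaces by (metis convex_INT convex_halfspace_le)

lemma compact_wavy_disc: "compact K"
proof -
  have "K \<subseteq> cball 0 (1 + e)"
    using polar_body_mono[OF wavy_radius_le] by (simp add: wavy_disc_def polar_body_const)
  then have "bounded K" using bounded_cball bounded_subset by blast
  moreover have "closed K"
    using wavy_disc_halfspaces by (metis closed_INT closed_halfspace_le)
  ultimately show ?thesis using compact_eq_bounded_closed by blast
qed

lemma zero_interior_wavy_disc: "0 \<in> interior K"
proof -
  have "cball 0 (1 - e) \<subseteq> K"
    using polar_body_mono[OF wavy_radius_ge] by (simp add: wavy_disc_def polar_body_const)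
  then have "ball 0 (1 - e) \<subseteq> K" using ball_subset_cball by blast
  then show ?thesis using e_less_1 mem_interior[of 0 K] by (metis diff_gt_0_iff_gt)
qed

lemma uminus_wavy_disc: "z \<in> K \<Longrightarrow> - z \<in> K"
proof -
  assume "z \<in> K"
  then obtain r t where z: "z = r *\<^sub>R dir t" "0 \<le> r" "r \<le> \<rho> t"
    unfolding wavy_disc_def polar_body_def by auto
  have "- z = r *\<^sub>R dir (t + pi)" using z by (simp add: dir_add_pi)
  then show "- z \<in> K" using mem_wavy_disc z wavy_radius_add_pi[OF m_even] by simp
qed

lemma convex_body_wavy_disc: "convex_body K"
  using convex_wavy_disc compact_wavy_disc zero_interior_wavy_disc unfolding convex_body_def by blast

lemma symmetric_body_wavy_disc: "symmetric_body K"
proof -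
  have "(\<lambda>y. 0 - y) ` K = K"
  proof (intro equalityI subsetI)
    fix z assume "z \<in> (\<lambda>y. 0 - y) ` K"
    then obtain y where "y \<in> K" "z = 0 - y" by blast
    then show "z \<in> K" using uminus_wavy_disc[of y] by simp
  next
    fix z assume "z \<in> K"
    then show "z \<in> (\<lambda>y. 0 - y) ` K" using uminus_wavy_disc[of z] by (intro image_eqI[of _ _ "- z"]) simp_all
  qed
  then have "(\<lambda>y. 0 + y) ` K = (\<lambda>y. 0 - y) ` K" by simp
  then show ?thesis unfolding symmetric_body_def by blast
qed

lemma radial_function_wavy_disc: "radial_function K (dir t) = \<rho> t"
proof -
  have "(GREATEST r. 0 \<le> r \<and> r *\<^sub>R dir t \<in> K) = \<rho> t"
  proof (rule Greatest_equality)
    show "0 \<le> \<rho> t \<and> \<rho> t *\<^sub>R dir t \<in> K"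
      using mem_wavy_disc[of "\<rho> t" t] wavy_radius_pos[of t] by simp
  qed (use mem_wavy_disc in blast)
  then show ?thesis by (simp add: radial_function_def)
qed

lemma radially_maximal_wavy_disc:
  assumes "c *\<^sub>R \<rho> t *\<^sub>R dir t \<in> K"
  shows "c \<le> 1"
proof (cases "c \<ge> 0")
  case True
  then have "c * \<rho> t \<le> \<rho> t"
    using assms mem_wavy_disc[of "c * \<rho> t" t] wavy_radius_pos[of t] by simp
  then show ?thesis using wavy_radius_pos[of t] by simp
qed simp

end

section \<open>Area swept by a moving segment\<close>

lemma Basis_plane: "Basis = {axis 1 1, axis 2 (1::real) :: real^2}"
  unfolding Basis_vec_def by (auto simp: UNIV_2)

lemma vec2_eq_iff: "(x :: real^2) = y \<longleftrightarrow> x $ 1 = y $ 1 \<and> x $ 2 = y $ 2"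
  by (simp add: vec_eq_iff forall_2)

lemma measurable_vector_2 [measurable]:
  assumes [measurable]: "f \<in> borel_measurable M" "g \<in> borel_measurable M"
  shows "(\<lambda>x. vector [f x, g x] :: real^2) \<in> borel_measurable M"
proof -
  have "(\<lambda>x. vector [f x, g x] :: real^2) = (\<lambda>x. f x *\<^sub>R axis 1 1 + g x *\<^sub>R axis 2 1)"
    by (simp add: fun_eq_iff vec2_eq_iff axis_def)
  then show ?thesis by simp
qed

text \<open>Lebesgue measure on \<open>real^2\<close> is a product measure, which gives access to Fubini's theorem.\<close>

lemma lborel_plane:
  "lborel = distr (lborel \<Otimes>\<^sub>M lborel) borel (\<lambda>p::real \<times> real. vector [fst p, snd p] :: real^2)"
proof (rule lborel_eqI)
  fix l u :: "real^2"
  assume le: "\<And>b. b \<in> Basis \<Longrightarrow> l \<bullet> b \<le> u \<bullet> b"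
  then have le': "l $ 1 \<le> u $ 1" "l $ 2 \<le> u $ 2"
    using le[of "axis 1 1"] le[of "axis 2 1"] by (simp_all add: Basis_plane inner_axis)
  have "(\<lambda>p. vector [fst p, snd p]) -` box l u = {l$1<..<u$1} \<times> {l$2<..<u$2}"
    by (auto simp: mem_box_cart forall_2)
  then have "emeasure (distr (lborel \<Otimes>\<^sub>M lborel) borel (\<lambda>p::real \<times> real. vector [fst p, snd p])) (box l u)
      = emeasure (lborel \<Otimes>\<^sub>M lborel) ({l$1<..<u$1} \<times> {l$2<..<u$2})"
    by (subst emeasure_distr) (auto simp: space_pair_measure)
  also have "\<dots> = ennreal (u$1 - l$1) * ennreal (u$2 - l$2)"
    using le' by (simp add: lborel.emeasure_pair_measure_Times)
  also have "\<dots> = (\<Prod>b\<in>Basis. (u - l) \<bullet> b)"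
    using le' by (simp add: Basis_plane inner_axis axis_eq_axis ennreal_mult)
  finally show "emeasure (distr (lborel \<Otimes>\<^sub>M lborel) borel (\<lambda>p::real \<times> real. vector [fst p, snd p])) (box l u)
      = (\<Prod>b\<in>Basis. (u - l) \<bullet> b)" .
qed simp

text \<open>Integral of a function of product form over the rectangle with sides \<open>{0..1}\<close> and
  \<open>{t0..t1}\<close>; the factor \<open>1 / 2\<close> is the integral of the first coordinate.\<close>

lemma has_integral_strip:
  fixes J :: "real \<Rightarrow> real"
  assumes cont: "continuous_on {t0..t1} J" and nonneg: "\<And>t. t \<in> {t0..t1} \<Longrightarrow> 0 \<le> J t"
  shows "((\<lambda>v::real^2. v $ 1 * J (v $ 2)) has_integral (integral {t0..t1} J / 2))
    (cbox (vector [0, t0]) (vector [1, t1]))"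
proof -
  define g where "g b = indicator {t0..t1} b * J b" for b
  define h :: "real \<Rightarrow> real" where "h a = indicator {0..1} a * a" for a
  have g_meas [measurable]: "g \<in> borel_measurable borel"
    unfolding g_def
    using borel_measurable_continuous_on_indicator[OF _ cont] by simp
  have h_meas [measurable]: "h \<in> borel_measurable borel" unfolding h_def by measurable
  have g0: "0 \<le> g b" for b using nonneg by (auto simp: g_def indicator_def)
  have h0: "0 \<le> h a" for a by (auto simp: h_def indicator_def)
  have "(J has_integral integral {t0..t1} J) {t0..t1}"
    by (intro integrable_integral integrable_continuous_real cont)
  moreover have "g = (\<lambda>t. if t \<in> {t0..t1} then J t else 0)" by (auto simp: g_def fun_eq_iff)
  ultimately have "(g has_integral integral {t0..t1} J) UNIV"
    by (simp only: has_integral_restrict_UNIV)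
  then have gi: "(\<integral>\<^sup>+b. g b \<partial>lborel) = ennreal (integral {t0..t1} J)"
    by (intro nn_integral_has_integral_lborel) (simp_all add: g0)
  have "((\<lambda>a::real. a) has_integral (1\<^sup>2 / 2 - 0\<^sup>2 / 2)) {0..1}"
    by (intro fundamental_theorem_of_calculus)
       (auto intro!: derivative_eq_intros simp flip: has_real_derivative_iff_has_vector_derivative)
  then have "((\<lambda>a::real. a) has_integral (1 / 2)) {0..1}" by simp
  moreover have "h = (\<lambda>a. if a \<in> {0..1} then a else 0)" by (auto simp: h_def fun_eq_iff)
  ultimately have "(h has_integral (1 / 2)) UNIV"
    by (simp only: has_integral_restrict_UNIV)
  then have hi: "(\<integral>\<^sup>+a. h a \<partial>lborel) = ennreal (1 / 2)"
    by (intro nn_integral_has_integral_lborel) (simp_all add: h0)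
  have I0: "0 \<le> integral {t0..t1} J"
    by (rule integral_nonneg[OF integrable_continuous_real[OF cont] nonneg])
  have "(\<integral>\<^sup>+v. ennreal (h (v $ 1) * g (v $ 2)) \<partial>(lborel :: (real^2) measure))
      = (\<integral>\<^sup>+p. ennreal (h (fst p) * g (snd p)) \<partial>(lborel \<Otimes>\<^sub>M lborel))"
    by (subst lborel_plane, subst nn_integral_distr) simp_all
  also have "\<dots> = (\<integral>\<^sup>+a. \<integral>\<^sup>+b. ennreal (h a) * ennreal (g b) \<partial>lborel \<partial>lborel)"
    by (subst lborel.nn_integral_fst[symmetric]) (simp_all add: ennreal_mult h0 g0)
  also have "\<dots> = ennreal (1 / 2) * ennreal (integral {t0..t1} J)"
    by (simp add: nn_integral_cmult nn_integral_multc gi hi)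
  also have "\<dots> = ennreal (1 / 2 * integral {t0..t1} J)"
    by (rule ennreal_mult[symmetric]) (use I0 in auto)
  finally have I: "(\<integral>\<^sup>+v. ennreal (h (v $ 1) * g (v $ 2)) \<partial>(lborel :: (real^2) measure))
    = ennreal (1 / 2 * integral {t0..t1} J)" .
  have "((\<lambda>v::real^2. h (v $ 1) * g (v $ 2)) has_integral (1 / 2 * integral {t0..t1} J)) UNIV"
  proof (rule nn_integral_has_integral[OF _ _ I])
    show "(\<lambda>v::real^2. h (v $ 1) * g (v $ 2)) \<in> borel_measurable borel" by measurable
  qed (use I0 h0 g0 in auto)
  moreover have eq: "(\<lambda>v::real^2. h (v $ 1) * g (v $ 2)) =
      (\<lambda>v. if v \<in> cbox (vector [0, t0]) (vector [1, t1]) then v $ 1 * J (v $ 2) else 0)"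
    unfolding h_def g_def mem_box_cart forall_2 by (rule ext) (auto simp: indicator_def)
  ultimately have "((\<lambda>v::real^2. if v \<in> cbox (vector [0, t0]) (vector [1, t1]) then v $ 1 * J (v $ 2) else 0)
    has_integral (1 / 2 * integral {t0..t1} J)) UNIV"
    by (rule subst[rotated])
  then have "((\<lambda>v::real^2. v $ 1 * J (v $ 2)) has_integral (1 / 2 * integral {t0..t1} J))
    (cbox (vector [0, t0]) (vector [1, t1]))"
    by (rule has_integral_restrict_UNIV[THEN iffD1])
  then show ?thesis by (simp only: mult_1_left times_divide_eq_left)
qed

lemma det_matrix_2:
  "det (matrix (f :: real^2 \<Rightarrow> real^2))
    = f (axis 1 1) $ 1 * f (axis 2 1) $ 2 - f (axis 2 1) $ 1 * f (axis 1 1) $ 2"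
  by (simp add: det_2 matrix_def)

text \<open>The segment from \<open>0\<close> to a moving point \<open>x t\<close>, turning counterclockwise. The function \<open>J\<close> is
  twice the areal velocity of the moving point.\<close>

locale swept =
  fixes x x' :: "real \<Rightarrow> real^2" and J :: "real \<Rightarrow> real"
  assumes der: "\<And>t. (x has_vector_derivative x' t) (at t)"
    and J_eq: "\<And>t. J t = x t $ 1 * x' t $ 2 - x t $ 2 * x' t $ 1"
    and J_cont: "continuous_on UNIV J"
    and J_nonneg: "\<And>t. 0 \<le> J t"
begin

text \<open>Parametrization of the swept region, and its derivative.\<close>

definition sweep :: "real^2 \<Rightarrow> real^2" where "sweep v = v $ 1 *\<^sub>R x (v $ 2)"
definition sweep' :: "real^2 \<Rightarrow> real^2 \<Rightarrow> real^2" where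
  "sweep' v h = h $ 1 *\<^sub>R x (v $ 2) + (v $ 1 * h $ 2) *\<^sub>R x' (v $ 2)"

lemma sweep_derivative: "(sweep has_derivative sweep' v) (at v within S)"
proof -
  have c: "((\<lambda>v::real^2. v $ i) has_derivative (\<lambda>h. h $ i)) (at v within S)" for i
    by (rule bounded_linear_imp_has_derivative) (rule bounded_linear_vec_nth)
  have "((\<lambda>v. x (v $ 2)) has_derivative (\<lambda>h. h $ 2 *\<^sub>R x' (v $ 2))) (at v within S)"
    using has_derivative_compose[OF c[of 2], of x "\<lambda>h. h *\<^sub>R x' (v $ 2)"] der
    by (simp add: has_vector_derivative_def)
  from has_derivative_scaleR[OF c[of 1] this]
  show ?thesis by (simp add: sweep_def[abs_def] sweep'_def[abs_def] add.commute)
qed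

lemma det_sweep:
  assumes "v $ 1 \<ge> 0"
  shows "\<bar>det (matrix (sweep' v))\<bar> = v $ 1 * J (v $ 2)"
proof -
  have "det (matrix (sweep' v)) = v $ 1 * J (v $ 2)"
    by (simp add: det_matrix_2 sweep'_def axis_def J_eq right_diff_distrib)
  then show ?thesis using J_nonneg[of "v $ 2"] assms by simp
qed

lemma det_sweep_integral:
  "((\<lambda>v. \<bar>det (matrix (sweep' v))\<bar>) has_integral (integral {t0..t1} J / 2))
    (cbox (vector [0, t0]) (vector [1, t1]))"
proof (rule has_integral_eq)
  show "((\<lambda>v::real^2. v $ 1 * J (v $ 2)) has_integral (integral {t0..t1} J / 2))
    (cbox (vector [0, t0]) (vector [1, t1]))"
    using J_nonneg by (intro has_integral_strip continuous_on_subset[OF J_cont]) auto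
  fix v :: "real^2" assume "v \<in> cbox (vector [0, t0]) (vector [1, t1])"
  then have "0 \<le> v $ 1" by (simp add: mem_box_cart forall_2)
  then show "v $ 1 * J (v $ 2) = \<bar>det (matrix (sweep' v))\<bar>" by (rule det_sweep[symmetric])
qed

text \<open>Without injectivity the areal velocity still bounds the area from above.\<close>

lemma swept_area_le:
  fixes t0 t1 :: real
  defines "S \<equiv> {s *\<^sub>R x t | s t. 0 \<le> s \<and> s \<le> 1 \<and> t0 \<le> t \<and> t \<le> t1}"
  shows "S \<in> lmeasurable" "area S \<le> integral {t0..t1} J / 2"
proof -
  let ?C = "cbox (vector [0, t0]) (vector [1, t1]) :: (real^2) set"
  have "S = sweep ` ?C"
  proof (intro equalityI subsetI)
    fix z assume "z \<in> S"
    then obtain s t where "z = s *\<^sub>R x t" "0 \<le> s" "s \<le> 1" "t0 \<le> t" "t \<le> t1" unfolding S_def by blast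
    then show "z \<in> sweep ` ?C"
      by (intro image_eqI[of _ _ "vector [s, t]"]) (auto simp: sweep_def mem_box_cart forall_2)
  next
    fix z assume "z \<in> sweep ` ?C"
    then obtain v :: "real^2" where "z = v $ 1 *\<^sub>R x (v $ 2)" "v \<in> ?C"
      unfolding sweep_def by blast
    then show "z \<in> S" unfolding S_def mem_box_cart forall_2
      by (intro CollectI exI[of _ "v $ 1"] exI[of _ "v $ 2"]) simp
  qed
  note S = this
  have cb: "?C \<in> sets lebesgue" by simp
  note di = has_integral_integrable[OF det_sweep_integral[of t0 t1]]
  show "S \<in> lmeasurable"
    unfolding S by (rule measurable_differentiable_image[OF cb sweep_derivative di])
  have "area S \<le> integral (?C) (\<lambda>v. \<bar>det (matrix (sweep' v))\<bar>)"
    unfolding S by (rule measure_differentiable_image[OF cb sweep_derivative di])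
  then show "area S \<le> integral {t0..t1} J / 2"
    using integral_unique[OF det_sweep_integral[of t0 t1]] by simp
qed

text \<open>If the argument \<open>\<phi>\<close> of the moving point increases strictly and by at most a full
  turn, the sweep is injective on the open rectangle.\<close>

lemma swept_area_eq:
  fixes \<phi> R :: "real \<Rightarrow> real" and t0 t1 :: real
  assumes polar: "\<And>t. t \<in> {t0..t1} \<Longrightarrow> x t = R t *\<^sub>R dir (\<phi> t)" and R: "\<And>t. t \<in> {t0..t1} \<Longrightarrow> 0 < R t"
    and mono: "\<And>s t. t0 \<le> s \<Longrightarrow> s < t \<Longrightarrow> t \<le> t1 \<Longrightarrow> \<phi> s < \<phi> t"
    and turn: "\<phi> t1 - \<phi> t0 \<le> 2 * pi"
  defines "S \<equiv> {s *\<^sub>R x t | s t. 0 < s \<and> s < 1 \<and> t0 < t \<and> t < t1}"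
  shows "S \<in> lmeasurable" "area S = integral {t0..t1} J / 2"
proof -
  let ?B = "box (vector [0, t0]) (vector [1, t1]) :: (real^2) set"
  have "S = sweep ` ?B"
  proof (intro equalityI subsetI)
    fix z assume "z \<in> S"
    then obtain s t where "z = s *\<^sub>R x t" "0 < s" "s < 1" "t0 < t" "t < t1" unfolding S_def by blast
    then show "z \<in> sweep ` ?B"
      by (intro image_eqI[of _ _ "vector [s, t]"]) (auto simp: sweep_def mem_box_cart forall_2)
  next
    fix z assume "z \<in> sweep ` ?B"
    then obtain v :: "real^2" where "z = v $ 1 *\<^sub>R x (v $ 2)" "v \<in> ?B"
      unfolding sweep_def by blast
    then show "z \<in> S" unfolding S_def mem_box_cart forall_2
      by (intro CollectI exI[of _ "v $ 1"] exI[of _ "v $ 2"]) simp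
  qed
  note S = this
  have le: "t = t'" if *: "t \<in> {t0<..<t1}" "t' \<in> {t0<..<t1}" "dir (\<phi> t) = dir (\<phi> t')" "t \<le> t'" for t t'
  proof (rule ccontr)
    assume "t \<noteq> t'"
    then have "\<phi> t < \<phi> t'" "\<phi> t0 < \<phi> t" "\<phi> t' < \<phi> t1" using * mono[of t t'] mono[of t0 t] mono[of t' t1] by simp_all
    moreover obtain k :: int where k: "\<phi> t' = \<phi> t + 2 * pi * k" using *(3) by (metis dir_eq_iff)
    ultimately have "0 < 2 * pi * k" "2 * pi * k < 2 * pi * 1" using turn by linarith+
    then have "0 < k" "k < 1" by (simp_all add: zero_less_mult_iff)
    then show False by simp
  qed
  have inj: "inj_on sweep ?B"
  proof (rule inj_onI)
    fix v w assume v: "v \<in> ?B" and w: "w \<in> ?B" and e: "sweep v = sweep w"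
    have v': "0 < v $ 1" "v $ 2 \<in> {t0<..<t1}" and w': "0 < w $ 1" "w $ 2 \<in> {t0<..<t1}"
      using v w by (auto simp: mem_box_cart forall_2)
    have e': "(v $ 1 * R (v $ 2)) *\<^sub>R dir (\<phi> (v $ 2)) = (w $ 1 * R (w $ 2)) *\<^sub>R dir (\<phi> (w $ 2))"
      using e polar v' w' by (simp add: sweep_def)
    have p: "0 < v $ 1 * R (v $ 2)" "0 < w $ 1 * R (w $ 2)" using v' w' R by simp_all
    have "v $ 1 * R (v $ 2) = w $ 1 * R (w $ 2)"
      using arg_cong[OF e', of norm] p by simp
    then have "dir (\<phi> (v $ 2)) = dir (\<phi> (w $ 2))" and n: "v $ 1 * R (v $ 2) = w $ 1 * R (w $ 2)"
      using e' p by auto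
    then have "v $ 2 = w $ 2" using le[of "v $ 2" "w $ 2"] le[of "w $ 2" "v $ 2"] v' w' by argo
    moreover from this have "v $ 1 = w $ 1" using n R[of "w $ 2"] w' by simp
    ultimately show "v = w" by (simp add: vec2_eq_iff)
  qed
  have di: "((\<lambda>v. \<bar>det (matrix (sweep' v))\<bar>) has_integral (integral {t0..t1} J / 2)) ?B"
    using det_sweep_integral[of t0 t1] has_integral_open_interval by blast
  have "sweep ` ?B \<in> lmeasurable \<and> area (sweep ` ?B) = integral {t0..t1} J / 2"
    by (subst has_measure_differentiable_image[OF _ sweep_derivative inj]) (use di in auto)
  then show "S \<in> lmeasurable" "area S = integral {t0..t1} J / 2" unfolding S by auto
qed

end

section \<open>The covariogram and chords of symmetric convex bodies\<close>

text \<open>The area of the intersection of a set with its translate by \<open>x\<close>.\<close>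

definition covariogram :: "(real^2) set \<Rightarrow> real^2 \<Rightarrow> real" where
  "covariogram K x = area (K \<inter> (\<lambda>y. y + x) ` K)"

lemma conv_body_covariogram: "conv_body \<delta> K = {x. covariogram K x \<ge> \<delta> * area K}"
  by (simp add: conv_body_def covariogram_def)

lemma inter_translate: "K \<inter> (\<lambda>y. y + x) ` K = {y. y \<in> K \<and> y - x \<in> (K :: (real^2) set)}"
  by (auto intro: image_eqI[of _ _ "_ - x"])

lemma inter_translate_lmeasurable:
  "compact K \<Longrightarrow> K \<inter> (\<lambda>y. y + x) ` K \<in> lmeasurable" for x :: "real^2"
  by (intro lmeasurable_compact compact_Int compact_continuous_image continuous_intros)

lemma area_point_reflection:
  fixes S :: "(real^2) set"
  assumes "S \<in> lmeasurable"
  shows "(\<lambda>z. x - z) ` S \<in> lmeasurable" "area ((\<lambda>z. x - z) ` S) = area S"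
proof -
  have lin: "linear (uminus :: real^2 \<Rightarrow> real^2)" by (simp add: linear_iff)
  have "det (matrix (uminus :: real^2 \<Rightarrow> real^2)) = 1" by (simp add: det_matrix_2 axis_def)
  then have m: "uminus ` S \<in> lmeasurable" "area (uminus ` S) = area S"
    using measurable_linear_image[OF lin assms] measure_linear_image[OF lin assms] by auto
  have e: "(\<lambda>z. x - z) ` S = (+) x ` uminus ` S" by (auto simp: image_image)
  show "(\<lambda>z. x - z) ` S \<in> lmeasurable" "area ((\<lambda>z. x - z) ` S) = area S"
    unfolding e using m measurable_translation measure_translation by metis+
qed

text \<open>By convexity the intersection of \<open>K\<close> and \<open>K + x\<close>, translated by \<open>(s - 1) / 2\<close> times \<open>x\<close>,
  lies in the intersection of \<open>K\<close> and \<open>K + s *\<^sub>R x\<close>. Consequently \<open>conv_body \<delta> K\<close> is star-shaped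
  about \<open>0\<close>.\<close>

lemma covariogram_ray_mono:
  assumes K: "compact K" "convex K" and s: "0 \<le> s" "s \<le> 1"
  shows "covariogram K x \<le> covariogram K (s *\<^sub>R x)"
proof -
  define v where "v = (- (1 - s) / 2) *\<^sub>R x"
  have "(+) v ` (K \<inter> (\<lambda>y. y + x) ` K) \<subseteq> K \<inter> (\<lambda>y. y + s *\<^sub>R x) ` K"
    unfolding inter_translate
  proof (clarsimp, intro conjI)
    fix z assume z: "z \<in> K" "z - x \<in> K"
    have seg: "(1 - u) *\<^sub>R z + u *\<^sub>R (z - x) \<in> K" if "0 \<le> u" "u \<le> 1" for u
      using convexD_alt[OF K(2) z that] .
    have "v + z = (1 - (1 - s) / 2) *\<^sub>R z + ((1 - s) / 2) *\<^sub>R (z - x)"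
      by (simp add: v_def vec2_eq_iff field_simps)
    then show "v + z \<in> K" using seg[of "(1 - s) / 2"] s by simp
    have "v + z - s *\<^sub>R x = (1 - (1 + s) / 2) *\<^sub>R z + ((1 + s) / 2) *\<^sub>R (z - x)"
      by (simp add: v_def vec2_eq_iff field_simps)
    then show "v + z - s *\<^sub>R x \<in> K" using seg[of "(1 + s) / 2"] s by simp
  qed
  moreover have "(+) v ` (K \<inter> (\<lambda>y. y + x) ` K) \<in> lmeasurable"
    using inter_translate_lmeasurable[OF K(1)] measurable_translation by blast
  ultimately have "area ((+) v ` (K \<inter> (\<lambda>y. y + x) ` K)) \<le> area (K \<inter> (\<lambda>y. y + s *\<^sub>R x) ` K)"
    using inter_translate_lmeasurable[OF K(1)] by (intro measure_mono_fmeasurable) auto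
  then show ?thesis unfolding covariogram_def by (simp only: measure_translation)
qed

lemma covariogram_borel:
  assumes K: "compact K"
  shows "covariogram K \<in> borel_measurable borel"
proof -
  have [measurable]: "K \<in> sets borel" using K by (simp add: compact_imp_closed)
  have e: "covariogram K x = enn2real (\<integral>\<^sup>+y. indicator K y * indicator K (y - x) \<partial>lborel)" for x
  proof -
    have "{y. y \<in> K \<and> y - x \<in> K} \<in> sets borel" by measurable
    then have "area (K \<inter> (\<lambda>y. y + x) ` K) = enn2real (emeasure lborel {y. y \<in> K \<and> y - x \<in> K})"
      unfolding inter_translate by (simp add: measure_def)
    also have "emeasure lborel {y. y \<in> K \<and> y - x \<in> K}
        = (\<integral>\<^sup>+y. indicator {y. y \<in> K \<and> y - x \<in> K} y \<partial>lborel)"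
      using \<open>{y. y \<in> K \<and> y - x \<in> K} \<in> sets borel\<close> by simp
    also have "\<dots> = (\<integral>\<^sup>+y. indicator K y * indicator K (y - x) \<partial>lborel)"
      by (intro nn_integral_cong) (simp add: indicator_def)
    finally show ?thesis by (simp add: covariogram_def)
  qed
  have "(\<lambda>x. \<integral>\<^sup>+y. indicator K y * indicator K (y - x) \<partial>lborel :: ennreal) \<in> borel_measurable borel"
    by measurable
  then show ?thesis unfolding e[abs_def] by simp
qed

text \<open>Measurability matters, because \<open>area\<close> is \<open>0\<close> on nonmeasurable sets. Positivity of the
  threshold makes the set bounded.\<close>

lemma conv_body_lmeasurable:
  assumes K: "compact K" and pos: "\<delta> * area K > 0"
  shows "conv_body \<delta> K \<in> lmeasurable"
proof (rule bounded_set_imp_lmeasurable)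
  obtain B where B: "\<And>y. y \<in> K \<Longrightarrow> norm y \<le> B" using K compact_imp_bounded bounded_iff by metis
  have "norm x \<le> 2 * B" if "x \<in> conv_body \<delta> K" for x
  proof -
    have "covariogram K x > 0" using that pos by (auto simp: conv_body_covariogram)
    then have "K \<inter> (\<lambda>y. y + x) ` K \<noteq> {}" unfolding covariogram_def by force
    then obtain y where "y \<in> K" "y - x \<in> K" unfolding inter_translate by blast
    then have "norm y \<le> B" "norm (y - x) \<le> B" using B by auto
    then show ?thesis using norm_triangle_ineq4[of y "y - x"] by simp
  qed
  then show "bounded (conv_body \<delta> K)" unfolding bounded_iff by blast
  have "conv_body \<delta> K \<in> sets borel"
    using covariogram_borel[OF K] unfolding conv_body_covariogram by measurable
  then show "conv_body \<delta> K \<in> sets lebesgue" by simp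
qed

text \<open>Signed area of the parallelogram spanned by two vectors.\<close>

definition cross2 :: "real^2 \<Rightarrow> real^2 \<Rightarrow> real" where
  "cross2 p q = p $ 1 * q $ 2 - p $ 2 * q $ 1"

lemma cross2_dir: "cross2 (dir s) (dir t) = sin (t - s)"
  by (simp add: cross2_def sin_diff)

lemma cross2_scaleR: "cross2 (c *\<^sub>R p) q = c * cross2 p q" "cross2 p (c *\<^sub>R q) = c * cross2 p q"
  by (simp_all add: cross2_def algebra_simps)

lemma cross2_coordinates:
  assumes "cross2 p q \<noteq> 0"
  shows "z = (cross2 z q / cross2 p q) *\<^sub>R p + (cross2 p z / cross2 p q) *\<^sub>R q"
proof -
  have "cross2 p q *\<^sub>R z = cross2 z q *\<^sub>R p + cross2 p z *\<^sub>R q"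
    by (simp add: vec2_eq_iff cross2_def algebra_simps)
  then have "(1 / cross2 p q) *\<^sub>R (cross2 p q *\<^sub>R z) = (1 / cross2 p q) *\<^sub>R (cross2 z q *\<^sub>R p + cross2 p z *\<^sub>R q)"
    by simp
  then show ?thesis using assms by (simp add: scaleR_add_right)
qed

text \<open>The part of a centrally symmetric body beyond a chord \<open>p q\<close>, reflected in the midpoint
  of the chord, stays in the body.\<close>

lemma reflect_cap:
  fixes K :: "(real^2) set"
  assumes conv: "convex K" and sym: "\<And>z. z \<in> K \<Longrightarrow> - z \<in> K"
    and pq: "p \<in> K" "q \<in> K"
    and pmax: "\<And>c. c *\<^sub>R p \<in> K \<Longrightarrow> c \<le> 1" and qmax: "\<And>c. c *\<^sub>R q \<in> K \<Longrightarrow> c \<le> 1"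
    and z: "a *\<^sub>R p + b *\<^sub>R q \<in> K" and beyond: "1 < a + b"
  shows "(1 - a) *\<^sub>R p + (1 - b) *\<^sub>R q \<in> K"
proof -
  have zero: "0 \<in> K"
    using convexD_alt[OF conv pq(1) sym[OF pq(1)], of "1/2"] by simp
  have comb: "u *\<^sub>R x + v *\<^sub>R y \<in> K" if "x \<in> K" "y \<in> K" "0 \<le> u" "0 \<le> v" "u + v \<le> 1" for x y u v
  proof -
    show ?thesis
    proof (cases "u + v = 0")
      case True
      then show ?thesis using that zero by (simp add: add_nonneg_eq_0_iff)
    next
      case False
      then have w: "(u / (u + v)) *\<^sub>R x + (v / (u + v)) *\<^sub>R y \<in> K"
        using that False by (intro convexD[OF conv that(1,2)]) (simp_all flip: add_divide_distrib)
      then have "(u + v) *\<^sub>R ((u / (u + v)) *\<^sub>R x + (v / (u + v)) *\<^sub>R y) + (1 - (u + v)) *\<^sub>R 0 \<in> K"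
        using that by (intro convexD[OF conv w zero]) auto
      then show ?thesis using False by (simp add: scaleR_add_right)
    qed
  qed
  have ab: "0 \<le> a"
  proof (rule ccontr)
    assume "\<not> 0 \<le> a"
    then have a: "a < 0" "b > 1 - a" using beyond by auto
    have "(1 / (1 - a)) *\<^sub>R (a *\<^sub>R p + b *\<^sub>R q) + (- a / (1 - a)) *\<^sub>R p \<in> K"
      using a by (intro comb z pq) (auto simp: field_simps)
    also have "(1 / (1 - a)) *\<^sub>R (a *\<^sub>R p + b *\<^sub>R q) + (- a / (1 - a)) *\<^sub>R p = (b / (1 - a)) *\<^sub>R q"
      by (simp add: vec2_eq_iff algebra_simps)
    finally have "b / (1 - a) \<le> 1" by (rule qmax)
    then show False using a by (simp add: field_simps)
  qed
  have bb: "0 \<le> b"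
  proof (rule ccontr)
    assume "\<not> 0 \<le> b"
    then have b: "b < 0" "a > 1 - b" using beyond by auto
    have "(1 / (1 - b)) *\<^sub>R (a *\<^sub>R p + b *\<^sub>R q) + (- b / (1 - b)) *\<^sub>R q \<in> K"
      using b by (intro comb z pq) (auto simp: field_simps)
    also have "(1 / (1 - b)) *\<^sub>R (a *\<^sub>R p + b *\<^sub>R q) + (- b / (1 - b)) *\<^sub>R q = (a / (1 - b)) *\<^sub>R p"
      by (simp add: vec2_eq_iff algebra_simps)
    finally have "a / (1 - b) \<le> 1" by (rule pmax)
    then show False using b by (simp add: field_simps)
  qed
  have a_le: "a \<le> 1 + b"
  proof -
    have "(1 / (1 + b)) *\<^sub>R (a *\<^sub>R p + b *\<^sub>R q) + (b / (1 + b)) *\<^sub>R (- q) \<in> K"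
      using bb by (intro comb z sym pq) (auto simp: field_simps)
    also have "(1 / (1 + b)) *\<^sub>R (a *\<^sub>R p + b *\<^sub>R q) + (b / (1 + b)) *\<^sub>R (- q) = (a / (1 + b)) *\<^sub>R p"
      by (simp add: vec2_eq_iff algebra_simps)
    finally have "a / (1 + b) \<le> 1" by (rule pmax)
    then show ?thesis using bb by (simp add: field_simps)
  qed
  have b_le: "b \<le> 1 + a"
  proof -
    have "(1 / (1 + a)) *\<^sub>R (a *\<^sub>R p + b *\<^sub>R q) + (a / (1 + a)) *\<^sub>R (- p) \<in> K"
      using ab by (intro comb z sym pq) (auto simp: field_simps)
    also have "(1 / (1 + a)) *\<^sub>R (a *\<^sub>R p + b *\<^sub>R q) + (a / (1 + a)) *\<^sub>R (- p) = (b / (1 + a)) *\<^sub>R q"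
      by (simp add: vec2_eq_iff algebra_simps)
    finally have "b / (1 + a) \<le> 1" by (rule qmax)
    then show ?thesis using ab by (simp add: field_simps)
  qed
  have *: "t *\<^sub>R (- (a *\<^sub>R p + b *\<^sub>R q)) + u *\<^sub>R w \<in> K"
    if "w \<in> K" "0 \<le> t" "0 \<le> u" "t + u \<le> 1" for t u w
    using comb[OF sym[OF z] that(1)] that by simp
  \<comment> \<open>The reflected point has coordinates \<open>1 - a\<close> and \<open>1 - b\<close>. If both are negative it is a
    combination of \<open>- z\<close> and the negative of one of the end points.\<close>
  consider "a \<le> 1" "b \<le> 1" | "a \<le> 1" "1 < b" | "1 < a" "b \<le> 1" | "1 < a" "1 < b" "b \<le> a"
    | "1 < a" "1 < b" "a < b" by linarith
  then show ?thesis
  proof cases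
    case 1
    then show ?thesis using beyond by (intro comb pq) auto
  next
    case 2
    have "(1 - a) *\<^sub>R p + (b - 1) *\<^sub>R (- q) \<in> K" using 2 b_le by (intro comb pq sym) auto
    then show ?thesis by (simp add: algebra_simps)
  next
    case 3
    have "(a - 1) *\<^sub>R (- p) + (1 - b) *\<^sub>R q \<in> K" using 3 a_le by (intro comb pq sym) auto
    then show ?thesis by (simp add: algebra_simps)
  next
    case 4
    have "b * a \<le> b * (1 + b)" using 4 a_le by (intro mult_left_mono) auto
    then have "((b - 1) / b) *\<^sub>R (- (a *\<^sub>R p + b *\<^sub>R q)) + (a / b - 1) *\<^sub>R (- p) \<in> K"
      using 4 a_le by (intro * pq sym) (auto simp: field_simps)
    also have "((b - 1) / b) *\<^sub>R (- (a *\<^sub>R p + b *\<^sub>R q)) + (a / b - 1) *\<^sub>R (- p)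
        = (1 - a) *\<^sub>R p + (1 - b) *\<^sub>R q"
      using 4 by (simp add: vec2_eq_iff field_simps)
    finally show ?thesis .
  next
    case 5
    have "a * b \<le> a * (1 + a)" using 5 b_le by (intro mult_left_mono) auto
    then have "((a - 1) / a) *\<^sub>R (- (a *\<^sub>R p + b *\<^sub>R q)) + (b / a - 1) *\<^sub>R (- q) \<in> K"
      using 5 b_le by (intro * pq sym) (auto simp: field_simps)
    also have "((a - 1) / a) *\<^sub>R (- (a *\<^sub>R p + b *\<^sub>R q)) + (b / a - 1) *\<^sub>R (- q)
        = (1 - a) *\<^sub>R p + (1 - b) *\<^sub>R q"
      using 5 by (simp add: vec2_eq_iff field_simps)
    finally show ?thesis .
  qed
qed

text \<open>The part of \<open>K\<close> strictly beyond the line through \<open>p\<close> and \<open>q\<close>, as seen from \<open>0\<close>, provided that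
  \<open>cross2 p q\<close> is positive: the inequality says that the coordinates of \<open>z\<close> with respect to the basis
  \<open>p\<close>, \<open>q\<close> have a sum greater than \<open>1\<close>.\<close>

definition cap :: "(real^2) set \<Rightarrow> real^2 \<Rightarrow> real^2 \<Rightarrow> (real^2) set" where
  "cap K p q = {z \<in> K. cross2 p q < cross2 z q + cross2 p z}"

lemma cap_lmeasurable:
  assumes "compact K"
  shows "cap K p q \<in> lmeasurable"
proof (rule bounded_set_imp_lmeasurable)
  show "bounded (cap K p q)"
    using assms compact_imp_bounded bounded_subset by (metis (no_types, lifting) cap_def mem_Collect_eq subsetI)
  have "open {z. cross2 p q < cross2 z q + cross2 p z}"
    unfolding cross2_def by (intro open_Collect_less continuous_intros)
  moreover have "cap K p q = K \<inter> {z. cross2 p q < cross2 z q + cross2 p z}" by (auto simp: cap_def)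
  ultimately have "cap K p q \<in> sets borel" using borel_closed[OF compact_imp_closed[OF assms]] by auto
  then show "cap K p q \<in> sets lebesgue" by simp
qed

text \<open>Both \<open>cap K p q\<close> and its reflection in the midpoint of the chord lie in the intersection of
  \<open>K\<close> and \<open>K + (p + q)\<close>, and they are disjoint. The two maximality assumptions say that \<open>p\<close> and \<open>q\<close>
  are radial boundary points of \<open>K\<close>.\<close>

lemma covariogram_ge_cap:
  fixes K :: "(real^2) set"
  assumes K: "compact K" "convex K" and sym: "\<And>z. z \<in> K \<Longrightarrow> - z \<in> K"
    and pq: "p \<in> K" "q \<in> K" "0 < cross2 p q"
    and pmax: "\<And>c. c *\<^sub>R p \<in> K \<Longrightarrow> c \<le> 1" and qmax: "\<And>c. c *\<^sub>R q \<in> K \<Longrightarrow> c \<le> 1"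
  shows "2 * area (cap K p q) \<le> covariogram K (p + q)"
proof -
  let ?T = "cap K p q" and ?T' = "(\<lambda>z. p + q - z) ` cap K p q"
  have refl: "p + q - z \<in> K" if "z \<in> ?T" for z
  proof -
    define a b where "a = cross2 z q / cross2 p q" and "b = cross2 p z / cross2 p q"
    have z: "z = a *\<^sub>R p + b *\<^sub>R q"
      unfolding a_def b_def using cross2_coordinates[of p q z] pq(3) by simp
    have "z \<in> K" "1 < a + b"
      using that pq(3) by (auto simp: cap_def a_def b_def field_simps simp flip: add_divide_distrib)
    then have "(1 - a) *\<^sub>R p + (1 - b) *\<^sub>R q \<in> K"
      using reflect_cap[OF K(2) sym pq(1,2) pmax qmax] z by blast
    moreover have "p + q - z = (1 - a) *\<^sub>R p + (1 - b) *\<^sub>R q" by (simp add: z algebra_simps)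
    ultimately show ?thesis by simp
  qed
  have sub: "?T \<union> ?T' \<subseteq> K \<inter> (\<lambda>y. y + (p + q)) ` K"
    unfolding inter_translate
  proof (intro subsetI CollectI)
    fix y assume "y \<in> ?T \<union> ?T'"
    then obtain z where z: "z \<in> ?T" "y = z \<or> y = p + q - z" by blast
    then have "z \<in> K" "p + q - z \<in> K" using refl by (auto simp: cap_def)
    then show "y \<in> K \<and> y - (p + q) \<in> K" using z(2) sym[of "p + q - z"] sym[of z] by auto
  qed
  have disj: "?T \<inter> ?T' = {}"
  proof (rule ccontr)
    assume "?T \<inter> ?T' \<noteq> {}"
    then obtain z where "z \<in> ?T" "p + q - z \<in> ?T" by force
    then have "cross2 p q < cross2 z q + cross2 p z"
      "cross2 p q < cross2 (p + q - z) q + cross2 p (p + q - z)" by (auto simp: cap_def)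
    moreover have "cross2 (p + q - z) q + cross2 p (p + q - z) = 2 * cross2 p q - (cross2 z q + cross2 p z)"
      by (simp add: cross2_def algebra_simps)
    ultimately show False by linarith
  qed
  note m = cap_lmeasurable[OF K(1), of p q]
  note m' = area_point_reflection[OF m, of "p + q"]
  have "2 * area ?T = area (?T \<union> ?T')"
    using measure_Un3[OF m m'(1)] disj m'(2) by simp
  also have "\<dots> \<le> covariogram K (p + q)"
    unfolding covariogram_def
    by (intro measure_mono_fmeasurable sub inter_translate_lmeasurable K) (use m m' in auto)
  finally show ?thesis .
qed

lemma area_triangle_origin: "area (convex hull {0, p, q}) = \<bar>cross2 p q\<bar> / 2"
proof -
  have "compact (convex hull {0, p, q})" by (intro compact_convex_hull finite_imp_compact) auto
  then have "area (convex hull {0, p, q}) = measure lborel (convex hull {0, p, q})"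
    by (simp add: compact_imp_closed)
  also have "\<dots> = \<bar>cross2 p q\<bar> / 2"
    by (simp add: content_triangle cross2_def abs_minus_commute mult.commute)
  finally show ?thesis .
qed

section \<open>Caps of the perturbed disc\<close>

lemma dir_derivative: "(dir has_vector_derivative dir (t + pi / 2)) (at t)"
proof -
  have e: "dir = (\<lambda>t. cos t *\<^sub>R axis 1 1 + sin t *\<^sub>R axis 2 1)"
    by (simp add: fun_eq_iff vec2_eq_iff axis_def)
  have e': "dir (t + pi / 2) = (- sin t) *\<^sub>R axis 1 1 + cos t *\<^sub>R axis 2 1"
    by (simp add: vec2_eq_iff axis_def cos_add sin_add)
  show ?thesis unfolding e' unfolding e
    by (auto intro!: derivative_eq_intros simp: has_real_derivative_iff_has_vector_derivative[symmetric])
qed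

lemma dir_quarter_turn [simp]: "dir (t + pi / 2) $ 1 = - sin t" "dir (t + pi / 2) $ 2 = cos t"
  by (simp_all add: cos_add sin_add)

text \<open>In polar coordinates twice the areal velocity is the square of the radius.\<close>

lemma swept_polar:
  assumes d: "\<And>t. (\<rho> has_real_derivative \<rho>' t) (at t)"
  shows "swept (\<lambda>t. \<rho> t *\<^sub>R dir t) (\<lambda>t. \<rho> t *\<^sub>R dir (t + pi / 2) + \<rho>' t *\<^sub>R dir t) (\<lambda>t. (\<rho> t)\<^sup>2)"
proof
  fix t
  show "((\<lambda>t. \<rho> t *\<^sub>R dir t) has_vector_derivative \<rho> t *\<^sub>R dir (t + pi / 2) + \<rho>' t *\<^sub>R dir t) (at t)"
    by (rule has_vector_derivative_scaleR[OF d dir_derivative])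
  have "(\<rho> t)\<^sup>2 = (\<rho> t)\<^sup>2 * ((cos t)\<^sup>2 + (sin t)\<^sup>2)" by simp
  also have "\<dots> = (\<rho> t *\<^sub>R dir t) $ 1 * (\<rho> t *\<^sub>R dir (t + pi / 2) + \<rho>' t *\<^sub>R dir t) $ 2 -
      (\<rho> t *\<^sub>R dir t) $ 2 * (\<rho> t *\<^sub>R dir (t + pi / 2) + \<rho>' t *\<^sub>R dir t) $ 1"
    by (simp add: algebra_simps power2_eq_square cos_add sin_add del: sin_cos_squared_add sin_cos_squared_add2 sin_cos_squared_add3)
  finally show "(\<rho> t)\<^sup>2 = (\<rho> t *\<^sub>R dir t) $ 1 * (\<rho> t *\<^sub>R dir (t + pi / 2) + \<rho>' t *\<^sub>R dir t) $ 2 -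
      (\<rho> t *\<^sub>R dir t) $ 2 * (\<rho> t *\<^sub>R dir (t + pi / 2) + \<rho>' t *\<^sub>R dir t) $ 1" .
  have "continuous_on UNIV \<rho>"
    by (intro continuous_at_imp_continuous_on ballI DERIV_isCont[OF d])
  then show "continuous_on UNIV (\<lambda>t. (\<rho> t)\<^sup>2)" by (intro continuous_intros)
qed simp

context wavy begin

text \<open>A primitive of the squared radius.\<close>

definition sq_primitive :: "real \<Rightarrow> real" where
  "sq_primitive t = t + 2 * e / real m * sin (real m * t) + e\<^sup>2 * (t / 2 + sin (2 * real m * t) / (4 * real m))"

lemma integral_wavy_radius_sq:
  assumes "t0 \<le> t1"
  shows "integral {t0..t1} (\<lambda>t. (\<rho> t)\<^sup>2) = sq_primitive t1 - sq_primitive t0"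
proof (rule integral_unique, rule fundamental_theorem_of_calculus[OF assms])
  fix t :: real
  have m: "real m \<noteq> 0" using m_pos by simp
  have c: "(cos (m * t))\<^sup>2 = (1 + cos (2 * m * t)) / 2"
    using cos_double_cos[of "m * t"] by (simp add: algebra_simps)
  have "(sq_primitive has_real_derivative 1 + 2 * e * cos (m * t) + e\<^sup>2 * (1 / 2 + cos (2 * m * t) / 2)) (at t)"
    unfolding sq_primitive_def using m by (auto intro!: derivative_eq_intros simp: field_simps)
  also have "1 + 2 * e * cos (m * t) + e\<^sup>2 * (1 / 2 + cos (2 * m * t) / 2) = (\<rho> t)\<^sup>2"
    unfolding wavy_radius_def power2_sum power_mult_distrib c by (simp add: field_simps)
  finally show "(sq_primitive has_vector_derivative (\<rho> t)\<^sup>2) (at t within {t0..t1})"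
    by (simp add: has_real_derivative_iff_has_vector_derivative has_vector_derivative_at_within)
qed

lemma wavy_radius_derivative: "(\<rho> has_real_derivative - (e * m * sin (m * t))) (at t)" for t :: real
  unfolding wavy_radius_def by (auto intro!: derivative_eq_intros)

lemma swept_wavy:
  "swept (\<lambda>t. \<rho> t *\<^sub>R dir t) (\<lambda>t::real. \<rho> t *\<^sub>R dir (t + pi / 2) + (- (e * m * sin (m * t))) *\<^sub>R dir t)
    (\<lambda>t. (\<rho> t)\<^sup>2)"
  by (rule swept_polar[OF wavy_radius_derivative])

lemma area_wavy_disc_le: "area K \<le> pi * (1 + e\<^sup>2 / 2)"
proof -
  let ?S = "{s *\<^sub>R \<rho> t *\<^sub>R dir t | s t. 0 \<le> s \<and> s \<le> 1 \<and> 0 \<le> t \<and> t \<le> 2 * pi}"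
  have "K \<subseteq> ?S"
  proof
    fix z assume z: "z \<in> K"
    obtain t where t: "0 \<le> t" "t < 2 * pi" "z = norm z *\<^sub>R dir t" by (rule polar_form)
    have "norm z \<le> \<rho> t" using mem_wavy_disc[of "norm z" t] z t(3) by simp
    moreover have "z = (norm z / \<rho> t) *\<^sub>R \<rho> t *\<^sub>R dir t" using t(3) wavy_radius_pos[of t] by simp
    ultimately show "z \<in> ?S" using t(1,2) wavy_radius_pos[of t]
      by (intro CollectI exI[of _ "norm z / \<rho> t"] exI[of _ t]) auto
  qed
  then have "area K \<le> area ?S"
    using swept.swept_area_le(1)[OF swept_wavy] compact_wavy_disc
    by (intro measure_mono_fmeasurable) (auto intro: lmeasurable_compact fmeasurableD)
  also have "\<dots> \<le> integral {0..2 * pi} (\<lambda>t. (\<rho> t)\<^sup>2) / 2"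
    by (rule swept.swept_area_le(2)[OF swept_wavy])
  also have "\<dots> = (sq_primitive (2 * pi) - sq_primitive 0) / 2"
    by (subst integral_wavy_radius_sq) simp_all
  also have "sin (m * (2 * pi)) = 0" "sin (2 * m * (2 * pi)) = 0"
    using sin_npi[of "2 * m"] sin_npi[of "4 * m"] by (simp_all add: algebra_simps)
  then have "(sq_primitive (2 * pi) - sq_primitive 0) / 2 = pi * (1 + e\<^sup>2 / 2)"
    by (simp add: sq_primitive_def algebra_simps)
  finally show ?thesis .
qed

lemma area_wavy_disc_pos: "0 < area K"
proof -
  have "0 < area (cball 0 (1 - e) :: (real^2) set)"
    using e_less_1 by (simp add: content_cball_pos)
  also have "\<dots> \<le> area K"
  proof (intro measure_mono_fmeasurable)
    show "cball 0 (1 - e) \<subseteq> K"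
      using polar_body_mono[OF wavy_radius_ge] by (simp add: wavy_disc_def polar_body_const)
  qed (use compact_wavy_disc in \<open>auto intro: lmeasurable_compact\<close>)
  finally show ?thesis .
qed

text \<open>The cap beyond a chord contains the sector over the chord minus the triangle spanned by the
  chord and \<open>0\<close>.\<close>

lemma area_cap_wavy_ge:
  fixes t \<alpha> :: real
  assumes \<alpha>: "0 < \<alpha>" "\<alpha> < pi / 2"
  defines "p \<equiv> \<rho> (t - \<alpha>) *\<^sub>R dir (t - \<alpha>)" and "q \<equiv> \<rho> (t + \<alpha>) *\<^sub>R dir (t + \<alpha>)"
  shows "(sq_primitive (t + \<alpha>) - sq_primitive (t - \<alpha>) - \<rho> (t - \<alpha>) * \<rho> (t + \<alpha>) * sin (2 * \<alpha>)) / 2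
    \<le> area (cap K p q)"
proof -
  let ?S = "{s *\<^sub>R \<rho> \<tau> *\<^sub>R dir \<tau> | s \<tau>. 0 < s \<and> s < 1 \<and> t - \<alpha> < \<tau> \<and> \<tau> < t + \<alpha>}"
  have pq: "cross2 p q = \<rho> (t - \<alpha>) * \<rho> (t + \<alpha>) * sin (2 * \<alpha>)"
    by (simp add: p_def q_def cross2_scaleR cross2_dir)
  have s2: "0 < sin (2 * \<alpha>)" using \<alpha> by (intro sin_gt_zero) auto
  have pq0: "0 < cross2 p q" unfolding pq using s2 wavy_radius_pos by simp
  have S: "?S \<in> lmeasurable" "area ?S = integral {t - \<alpha>..t + \<alpha>} (\<lambda>t. (\<rho> t)\<^sup>2) / 2"
    by (rule swept.swept_area_eq[OF swept_wavy, where \<phi> = "\<lambda>t. t" and R = \<rho>];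
        use \<alpha> wavy_radius_pos in simp)+
  have sub: "?S \<subseteq> cap K p q \<union> convex hull {0, p, q}"
  proof
    fix z assume "z \<in> ?S"
    then obtain s \<tau> where z: "z = s *\<^sub>R \<rho> \<tau> *\<^sub>R dir \<tau>" "0 < s" "s < 1" "t - \<alpha> < \<tau>" "\<tau> < t + \<alpha>" by blast
    have "s * \<rho> \<tau> \<le> 1 * \<rho> \<tau>" using z wavy_radius_pos[of \<tau>] by (intro mult_right_mono) auto
    then have "z \<in> K" using z mem_wavy_disc[of "s * \<rho> \<tau>" \<tau>] wavy_radius_pos[of \<tau>] by simp
    define a b where "a = cross2 z q / cross2 p q" and "b = cross2 p z / cross2 p q"
    have zab: "z = a *\<^sub>R p + b *\<^sub>R q"
      unfolding a_def b_def using cross2_coordinates[of p q z] pq0 by simp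
    have "0 < sin (t + \<alpha> - \<tau>)" "0 < sin (\<tau> - (t - \<alpha>))"
      using z \<alpha> by (intro sin_gt_zero; simp)+
    then have "0 < cross2 z q" "0 < cross2 p z"
      using z wavy_radius_pos by (simp_all add: p_def q_def cross2_scaleR cross2_dir)
    then have ab: "0 < a" "0 < b"
      unfolding a_def b_def using pq0 by simp_all
    show "z \<in> cap K p q \<union> convex hull {0, p, q}"
    proof (cases "1 < a + b")
      case True
      then have "cross2 p q < cross2 z q + cross2 p z"
        using pq0 by (simp add: a_def b_def field_simps flip: add_divide_distrib)
      then show ?thesis using \<open>z \<in> K\<close> by (simp add: cap_def)
    next
      case False
      then have "z \<in> convex hull {0, p, q}"
        unfolding convex_hull_3 using ab zab
        by (intro CollectI exI[of _ "1 - a - b"] exI[of _ a] exI[of _ b]) simp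
      then show ?thesis by simp
    qed
  qed
  have tri: "convex hull {0, p, q} \<in> lmeasurable"
    by (intro lmeasurable_compact compact_convex_hull finite_imp_compact) simp
  have c: "cap K p q \<in> lmeasurable" by (rule cap_lmeasurable[OF compact_wavy_disc])
  have "area ?S \<le> area (cap K p q \<union> convex hull {0, p, q})"
    by (intro measure_mono_fmeasurable sub fmeasurable.Un tri c) (use S in blast)
  also have "\<dots> \<le> area (cap K p q) + area (convex hull {0, p, q})"
    by (intro measure_Un_le fmeasurableD tri c)
  finally have "area ?S \<le> area (cap K p q) + cross2 p q / 2"
    using pq0 by (simp add: area_triangle_origin)
  moreover have "area ?S = (sq_primitive (t + \<alpha>) - sq_primitive (t - \<alpha>)) / 2"
    unfolding S(2) using \<alpha> by (subst integral_wavy_radius_sq) auto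
  ultimately show ?thesis unfolding pq by (simp add: diff_divide_distrib)
qed

lemma chord_sum_in_conv_body:
  assumes \<alpha>: "0 < \<alpha>" "\<alpha> < pi / 2"
    and F: "\<delta> * area K \<le>
      sq_primitive (t + \<alpha>) - sq_primitive (t - \<alpha>) - \<rho> (t - \<alpha>) * \<rho> (t + \<alpha>) * sin (2 * \<alpha>)"
    and s: "0 \<le> s" "s \<le> 1"
  shows "s *\<^sub>R (\<rho> (t - \<alpha>) *\<^sub>R dir (t - \<alpha>) + \<rho> (t + \<alpha>) *\<^sub>R dir (t + \<alpha>)) \<in> conv_body \<delta> K"
proof -
  let ?p = "\<rho> (t - \<alpha>) *\<^sub>R dir (t - \<alpha>)" and ?q = "\<rho> (t + \<alpha>) *\<^sub>R dir (t + \<alpha>)"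
  have "0 < sin (2 * \<alpha>)" using \<alpha> by (intro sin_gt_zero) auto
  then have c: "0 < cross2 ?p ?q"
    using wavy_radius_pos by (simp add: cross2_scaleR cross2_dir)
  have mem: "\<rho> \<tau> *\<^sub>R dir \<tau> \<in> K" for \<tau>
    using mem_wavy_disc[of "\<rho> \<tau>" \<tau>] wavy_radius_pos[of \<tau>] by simp
  have "\<delta> * area K \<le> 2 * area (cap K ?p ?q)"
    using F area_cap_wavy_ge[OF \<alpha>, of t] by simp
  also have "\<dots> \<le> covariogram K (?p + ?q)"
    by (rule covariogram_ge_cap[OF compact_wavy_disc convex_wavy_disc])
      (rule mem c | erule uminus_wavy_disc radially_maximal_wavy_disc)+
  also have "\<dots> \<le> covariogram K (s *\<^sub>R (?p + ?q))"
    by (rule covariogram_ray_mono[OF compact_wavy_disc convex_wavy_disc s])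
  finally show ?thesis by (simp add: conv_body_covariogram)
qed

end

section \<open>The disc, and area in a rotating frame\<close>

text \<open>Membership of a sector of a disc, expressed by a cone condition.\<close>

lemma mem_disc_sector:
  assumes \<alpha>: "0 \<le> \<alpha>" "\<alpha> \<le> pi" and z: "norm z \<le> R" "0 < R" and cone: "norm z * cos \<alpha> \<le> z \<bullet> dir \<phi>"
  shows "z \<in> {s *\<^sub>R R *\<^sub>R dir t | s t. 0 \<le> s \<and> s \<le> 1 \<and> \<phi> - \<alpha> \<le> t \<and> t \<le> \<phi> + \<alpha>}"
proof (cases "z = 0")
  case True
  then show ?thesis using \<alpha> by (intro CollectI exI[of _ 0] exI[of _ \<phi>]) auto
next
  case False
  obtain t0 where t0: "z = norm z *\<^sub>R dir t0" by (rule polar_form)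
  obtain k :: int where k: "\<bar>t0 + 2 * pi * k - \<phi>\<bar> \<le> pi" by (rule shift_to_window)
  define t where "t = t0 + 2 * pi * k"
  have zt: "z = norm z *\<^sub>R dir t" using t0 by (simp add: t_def dir_periodic_int)
  have "norm z * cos \<alpha> \<le> norm z * cos (t - \<phi>)"
    using cone arg_cong[OF zt, of "\<lambda>z. z \<bullet> dir \<phi>"] by (simp add: inner_dir)
  then have "cos \<alpha> \<le> cos \<bar>t - \<phi>\<bar>" using False by simp
  then have "\<bar>t - \<phi>\<bar> \<le> \<alpha>" using cos_mono_le_eq[of \<alpha> "\<bar>t - \<phi>\<bar>"] \<alpha> k by (simp add: t_def)
  then show ?thesis using z zt
    by (intro CollectI exI[of _ "norm z / R"] exI[of _ t]) (auto simp: abs_le_iff)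
qed

text \<open>A cap of a disc and the triangle below its chord lie in a common sector and overlap in a null
  set.\<close>

lemma area_disc_cap_le:
  fixes \<alpha> \<phi> R :: real
  assumes \<alpha>: "0 < \<alpha>" "\<alpha> < pi / 2" and R: "0 < R"
  defines "C \<equiv> {z \<in> cball 0 R. R * cos \<alpha> \<le> z \<bullet> dir \<phi>}"
  shows "C \<in> lmeasurable" "area C \<le> R\<^sup>2 * (\<alpha> - sin (2 * \<alpha>) / 2)"
proof -
  have comp: "compact C"
  proof -
    have "C = cball 0 R \<inter> {z. R * cos \<alpha> \<le> z \<bullet> dir \<phi>}" by (auto simp: C_def)
    moreover have "closed {z. R * cos \<alpha> \<le> z \<bullet> dir \<phi>}" by (intro closed_Collect_le continuous_intros)
    ultimately show ?thesis by (simp add: compact_Int_closed)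
  qed
  then show C: "C \<in> lmeasurable" by (rule lmeasurable_compact)
  define p q where "p = R *\<^sub>R dir (\<phi> - \<alpha>)" and "q = R *\<^sub>R dir (\<phi> + \<alpha>)"
  let ?T = "convex hull {0, p, q}"
  have T: "?T \<in> lmeasurable"
    by (intro lmeasurable_compact compact_convex_hull finite_imp_compact) simp
  have sin2: "0 < sin (2 * \<alpha>)" using \<alpha> by (intro sin_gt_zero) auto
  have aT: "area ?T = R\<^sup>2 * sin (2 * \<alpha>) / 2"
    unfolding area_triangle_origin p_def q_def cross2_scaleR cross2_dir
    using sin2 R by (simp add: power2_eq_square abs_mult)
  have cos0: "0 < cos \<alpha>" using \<alpha> by (intro cos_gt_zero) auto
  have T_props: "norm z \<le> R \<and> norm z * cos \<alpha> \<le> z \<bullet> dir \<phi> \<and> z \<bullet> dir \<phi> \<le> R * cos \<alpha>" if zT: "z \<in> ?T" for z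
  proof -
    obtain u b c where u: "0 \<le> u" "0 \<le> b" "0 \<le> c" "u + b + c = 1" and "z = u *\<^sub>R 0 + b *\<^sub>R p + c *\<^sub>R q"
      using zT unfolding convex_hull_3 by blast
    then have z: "z = b *\<^sub>R p + c *\<^sub>R q" by simp
    have zi: "z \<bullet> dir \<phi> = (b + c) * (R * cos \<alpha>)"
      by (simp add: z p_def q_def inner_add_left inner_dir algebra_simps)
    have "norm z \<le> norm (b *\<^sub>R p) + norm (c *\<^sub>R q)" unfolding z by (rule norm_triangle_ineq)
    then have nz: "norm z \<le> (b + c) * R" using u R by (simp add: p_def q_def algebra_simps)
    have "norm z \<le> 1 * R" using nz u R mult_right_mono[of "b + c" 1 R] by linarith
    moreover have "norm z * cos \<alpha> \<le> ((b + c) * R) * cos \<alpha>" using nz cos0 by (intro mult_right_mono) auto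
    moreover have "(b + c) * (R * cos \<alpha>) \<le> 1 * (R * cos \<alpha>)" using u R cos0 by (intro mult_right_mono) auto
    ultimately show ?thesis unfolding zi by (simp add: mult.assoc)
  qed
  have neg: "negligible (C \<inter> ?T)"
  proof (rule negligible_subset)
    show "negligible {z. dir \<phi> \<bullet> z = R * cos \<alpha>}" by (rule negligible_hyperplane) simp
    show "C \<inter> ?T \<subseteq> {z. dir \<phi> \<bullet> z = R * cos \<alpha>}"
      using T_props by (fastforce simp: C_def inner_commute)
  qed
  interpret sw: swept "\<lambda>t. R *\<^sub>R dir t" "\<lambda>t. R *\<^sub>R dir (t + pi / 2) + 0 *\<^sub>R dir t" "\<lambda>t. R\<^sup>2"
    by (rule swept_polar) simp
  let ?S = "{s *\<^sub>R R *\<^sub>R dir t | s t. 0 \<le> s \<and> s \<le> 1 \<and> \<phi> - \<alpha> \<le> t \<and> t \<le> \<phi> + \<alpha>}"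
  have sub: "C \<union> ?T \<subseteq> ?S"
  proof
    fix z assume "z \<in> C \<union> ?T"
    then consider "norm z \<le> R" "R * cos \<alpha> \<le> z \<bullet> dir \<phi>" | "z \<in> ?T" by (auto simp: C_def)
    then have "norm z \<le> R \<and> norm z * cos \<alpha> \<le> z \<bullet> dir \<phi>"
    proof cases
      case 1
      then show ?thesis using order_trans[OF mult_right_mono[OF 1(1)] 1(2)] cos0 by simp
    qed (use T_props in blast)
    then show "z \<in> ?S" by (intro mem_disc_sector) (use \<alpha> R in auto)
  qed
  have "area C + area ?T = area (C \<union> ?T)"
    using measure_Un3[OF C T] negligible_imp_measure0[OF neg] by simp
  also have "\<dots> \<le> area ?S"
    by (intro measure_mono_fmeasurable sub fmeasurableD fmeasurable.Un C T sw.swept_area_le(1))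
  also have "\<dots> \<le> integral {\<phi> - \<alpha>..\<phi> + \<alpha>} (\<lambda>t. R\<^sup>2) / 2" by (rule sw.swept_area_le(2))
  also have "\<dots> = R\<^sup>2 * \<alpha>" using \<alpha> by simp
  finally show "area C \<le> R\<^sup>2 * (\<alpha> - sin (2 * \<alpha>) / 2)" unfolding aT by (simp add: algebra_simps)
qed

text \<open>The area of a circular segment is strictly increasing in its half angle.\<close>

lemma segment_area_strict_mono:
  fixes x y :: real
  assumes "0 \<le> x" "x < y" "y \<le> pi / 2"
  shows "2 * x - sin (2 * x) < 2 * y - sin (2 * y)"
proof (rule DERIV_pos_imp_increasing_open[OF assms(2)])
  fix t assume "x < t" "t < y"
  then have "cos (2 * t) < cos 0" using assms by (intro cos_monotone_0_pi) auto
  moreover have "((\<lambda>x. 2 * x - sin (2 * x)) has_real_derivative 2 - 2 * cos (2 * t)) (at t)"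
    by (auto intro!: derivative_eq_intros)
  ultimately show "\<exists>D. ((\<lambda>x. 2 * x - sin (2 * x)) has_real_derivative D) (at t) \<and> 0 < D"
    by (intro exI[of _ "2 - 2 * cos (2 * t)"]) simp
qed (intro continuous_intros)

lemma area_disc: "0 \<le> r \<Longrightarrow> area (cball 0 r :: (real^2) set) = pi * r\<^sup>2"
  by (simp add: content_cball unit_ball_vol_2)

text \<open>A vector \<open>x\<close> longer than \<open>2 * R * cos a\<close> is too long to belong to \<open>conv_body \<delta>\<close> of the disc:
  the intersection of the disc with its translate splits into two caps of half angle less than \<open>a\<close>.\<close>

lemma area_conv_body_disc_le:
  assumes a: "0 < a" "a < pi / 2" and \<delta>: "\<delta> * pi = 2 * a - sin (2 * a)" and R: "0 < R"
  shows "area (conv_body \<delta> (cball 0 R)) \<le> pi * (2 * R * cos a)\<^sup>2"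
proof -
  have cos_a: "0 < cos a" "cos a < 1"
    using a cos_gt_zero[of a] cos_monotone_0_pi[of 0 a] by auto
  have "conv_body \<delta> (cball 0 R) \<subseteq> cball 0 (2 * R * cos a)"
  proof (rule subsetI, rule ccontr)
    fix x :: "real^2"
    assume x: "x \<in> conv_body \<delta> (cball 0 R)" and "x \<notin> cball 0 (2 * R * cos a)"
    then have big: "2 * R * cos a < norm x" by simp
    obtain \<phi> where \<phi>: "x = norm x *\<^sub>R dir \<phi>" by (rule polar_form)
    \<comment> \<open>\<open>x\<close> is shortened to \<open>y\<close> of length \<open>2 * d\<close> with \<open>R * cos a < d < R\<close>, so that the intersection
      is not degenerate and the half angle \<open>arccos (d / R)\<close> is positive.\<close>
    define d where "d = min (norm x / 2) (R * (1 + cos a) / 2)"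
    have d: "R * cos a < d" "d < R" "d \<le> norm x / 2"
      using big R cos_a mult_strict_left_mono[of "cos a" 1 R] by (auto simp: d_def field_simps min_def)
    have d0: "0 < d" using d(1) R cos_a(1) mult_pos_pos[of R "cos a"] by linarith
    define \<alpha> where "\<alpha> = arccos (d / R)"
    have dR: "0 < d / R" "d / R < 1" "cos a < d / R" using d d0 R by (auto simp: field_simps)
    have cos_\<alpha>: "cos \<alpha> = d / R" unfolding \<alpha>_def using dR by (intro cos_arccos) auto
    have "0 \<le> \<alpha>" "\<alpha> \<le> pi" unfolding \<alpha>_def using dR by (intro arccos_lbound arccos_ubound; simp)+
    have "\<alpha> \<noteq> 0" using cos_\<alpha> dR by auto
    then have "0 < \<alpha>" using \<open>0 \<le> \<alpha>\<close> by simp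
    have "\<alpha> < a"
    proof (rule ccontr)
      assume "\<not> \<alpha> < a"
      then have "cos \<alpha> \<le> cos a" using a \<open>\<alpha> \<le> pi\<close> by (intro cos_monotone_0_pi_le) auto
      then show False using cos_\<alpha> dR by simp
    qed
    define y where "y = (2 * d) *\<^sub>R dir \<phi>"
    define s where "s = 2 * d / norm x"
    have nx: "0 < norm x" using d0 d by linarith
    have s: "0 \<le> s" "s \<le> 1" "y = s *\<^sub>R x"
      using d d0 nx by (auto simp: s_def y_def) (subst (2) \<phi>, use nx in simp)
    let ?C = "{z \<in> cball 0 R. R * cos \<alpha> \<le> z \<bullet> dir \<phi>}"
    have C: "?C \<in> lmeasurable" "area ?C \<le> R\<^sup>2 * (\<alpha> - sin (2 * \<alpha>) / 2)"
      using \<open>0 < \<alpha>\<close> \<open>\<alpha> < a\<close> a R by (intro area_disc_cap_le; simp)+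
    note C' = area_point_reflection[OF C(1), of y]
    have sub: "cball 0 R \<inter> (\<lambda>z. z + y) ` cball 0 R \<subseteq> ?C \<union> (\<lambda>z. y - z) ` ?C"
      unfolding inter_translate
    proof (intro subsetI)
      fix z assume z: "z \<in> {w. w \<in> cball 0 R \<and> w - y \<in> cball 0 R}"
      have Rc: "R * cos \<alpha> = d" using cos_\<alpha> R by simp
      show "z \<in> ?C \<union> (\<lambda>z. y - z) ` ?C"
      proof (cases "d \<le> z \<bullet> dir \<phi>")
        case True
        then show ?thesis using z Rc by simp
      next
        case False
        then have "y - z \<in> ?C" using z Rc
          by (simp add: y_def inner_diff_left inner_dir norm_minus_commute)
        then have "y - (y - z) \<in> (\<lambda>z. y - z) ` ?C" by (rule imageI)
        then show ?thesis by simp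
      qed
    qed
    have "covariogram (cball 0 R) x \<le> covariogram (cball 0 R) y"
      unfolding s(3) by (rule covariogram_ray_mono) (use s in auto)
    also have "\<dots> \<le> area (?C \<union> (\<lambda>z. y - z) ` ?C)"
      unfolding covariogram_def
      by (intro measure_mono_fmeasurable sub fmeasurable.Un C C' fmeasurableD inter_translate_lmeasurable) auto
    also have "\<dots> \<le> area ?C + area ((\<lambda>z. y - z) ` ?C)"
      by (intro measure_Un_le fmeasurableD C C')
    also have "\<dots> \<le> R\<^sup>2 * (2 * \<alpha> - sin (2 * \<alpha>))" using C C' by (simp add: algebra_simps)
    also have "\<dots> < R\<^sup>2 * (2 * a - sin (2 * a))"
      using segment_area_strict_mono[of \<alpha> a] \<open>0 < \<alpha>\<close> \<open>\<alpha> < a\<close> a R by (intro mult_strict_left_mono) auto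
    also have "\<dots> = \<delta> * area (cball 0 R :: (real^2) set)"
      using R area_disc[of R] by (simp flip: \<delta>)
    finally show False using x by (simp add: conv_body_covariogram)
  qed
  \<comment> \<open>A nonmeasurable set has measure \<open>0\<close>, so the estimate holds in any case.\<close>
  then have "area (conv_body \<delta> (cball 0 R)) \<le> area (cball 0 (2 * R * cos a) :: (real^2) set)"
  proof (cases "conv_body \<delta> (cball 0 R :: (real^2) set) \<in> sets lebesgue")
    case True
    then show ?thesis
      using \<open>conv_body \<delta> (cball 0 R) \<subseteq> cball 0 (2 * R * cos a)\<close> by (intro measure_mono_fmeasurable) auto
  qed (simp add: measure_notin_sets)
  then show ?thesis using R cos_a area_disc[of "2 * R * cos a"] by simp
qed

lemma equal_area_disc_eq:
  assumes "0 < area K"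
  shows "equal_area_disc K = cball 0 (sqrt (area K / pi))"
  unfolding equal_area_disc_def
proof (rule the_equality)
  show "area (cball 0 (sqrt (area K / pi)) :: (real^2) set) = area K \<and>
      (\<exists>r\<ge>0. cball 0 (sqrt (area K / pi)) = (cball 0 r :: (real^2) set))"
    using assms area_disc[of "sqrt (area K / pi)"]
    by (intro conjI exI[of _ "sqrt (area K / pi)"]) auto
next
  fix B :: "(real^2) set" assume "area B = area K \<and> (\<exists>r\<ge>0. B = cball 0 r)"
  then obtain r where r: "0 \<le> r" "B = cball 0 r" "area B = area K" by blast
  then have "pi * r\<^sup>2 = area K" using area_disc[OF r(1)] by simp
  with r(1,2) have r: "0 \<le> r" "B = cball 0 r" "pi * r\<^sup>2 = area K" by simp_all
  then have "r = sqrt (area K / pi)" by (simp flip: r(3))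
  then show "B = cball 0 (sqrt (area K / pi))" using r by simp
qed

lemma area_conv_body_equal_area_disc_le:
  assumes a: "0 < a" "a < pi / 2" and \<delta>: "\<delta> * pi = 2 * a - sin (2 * a)" and K: "0 < area K"
  shows "area (conv_body \<delta> (equal_area_disc K)) \<le> 4 * (cos a)\<^sup>2 * area K"
proof -
  have "area (conv_body \<delta> (equal_area_disc K)) \<le> pi * (2 * sqrt (area K / pi) * cos a)\<^sup>2"
    unfolding equal_area_disc_eq[OF K] by (rule area_conv_body_disc_le[OF a \<delta>]) (use K in simp)
  also have "\<dots> = 4 * (cos a)\<^sup>2 * area K" using K by (simp add: power_mult_distrib)
  finally show ?thesis .
qed

text \<open>Area enclosed by a closed curve given in the rotating frame \<open>dir t\<close>, \<open>dir (t + pi / 2)\<close>.\<close>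

lemma area_rotating_frame:
  fixes X Y X' Y' :: "real \<Rightarrow> real"
  assumes dX: "\<And>t. (X has_real_derivative X' t) (at t)" and dY: "\<And>t. (Y has_real_derivative Y' t) (at t)"
    and cX: "continuous_on UNIV X'" and cY: "continuous_on UNIV Y'"
    and Xpos: "\<And>t. 0 < X t" and Jpos: "\<And>t. 0 < (X t)\<^sup>2 + (Y t)\<^sup>2 + X t * Y' t - Y t * X' t"
    and closed: "X (2 * pi) = X 0" "Y (2 * pi) = Y 0"
  defines "S \<equiv> {s *\<^sub>R (X t *\<^sub>R dir t + Y t *\<^sub>R dir (t + pi / 2)) | s t. 0 < s \<and> s < 1 \<and> 0 < t \<and> t < 2 * pi}"
  shows "S \<in> lmeasurable"
    "area S = integral {0..2 * pi} (\<lambda>t. (X t)\<^sup>2 + (Y t)\<^sup>2 - 2 * Y t * X' t) / 2"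
proof -
  define x where "x t = X t *\<^sub>R dir t + Y t *\<^sub>R dir (t + pi / 2)" for t
  define x' where "x' t = X' t *\<^sub>R dir t + X t *\<^sub>R dir (t + pi / 2) + (Y' t *\<^sub>R dir (t + pi / 2) - Y t *\<^sub>R dir t)" for t
  define J where "J t = (X t)\<^sup>2 + (Y t)\<^sup>2 + X t * Y' t - Y t * X' t" for t
  have cX0: "continuous_on UNIV X" and cY0: "continuous_on UNIV Y"
    by (intro continuous_at_imp_continuous_on ballI DERIV_isCont[OF dX] DERIV_isCont[OF dY])+
  have dir': "((\<lambda>t. dir (t + pi / 2)) has_vector_derivative - dir t) (at t)" for t
  proof -
    have "((\<lambda>t. t + pi / 2) has_vector_derivative 1) (at t)"
      by (auto intro!: derivative_eq_intros)
    from vector_diff_chain_at[OF this dir_derivative]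
    have "((\<lambda>t. dir (t + pi / 2)) has_vector_derivative dir (t + pi / 2 + pi / 2)) (at t)"
      by (simp add: o_def)
    then show ?thesis using dir_add_pi[of t] by (simp add: add.assoc)
  qed
  interpret sw: swept x x' J
  proof
    fix t
    show "(x has_vector_derivative x' t) (at t)"
      unfolding x_def[abs_def] x'_def
      using has_vector_derivative_add[OF has_vector_derivative_scaleR[OF dX dir_derivative]
          has_vector_derivative_scaleR[OF dY dir'], of t]
      by (simp add: algebra_simps)
    have "J t = ((X t)\<^sup>2 + (Y t)\<^sup>2 + X t * Y' t - Y t * X' t) * ((cos t)\<^sup>2 + (sin t)\<^sup>2)"
      by (simp add: J_def)
    also have "\<dots> = x t $ 1 * x' t $ 2 - x t $ 2 * x' t $ 1"
      by (simp add: x_def x'_def cos_add sin_add algebra_simps power2_eq_square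
          del: sin_cos_squared_add sin_cos_squared_add2 sin_cos_squared_add3)
    finally show "J t = x t $ 1 * x' t $ 2 - x t $ 2 * x' t $ 1" .
    show "continuous_on UNIV J" unfolding J_def by (intro continuous_intros cX cY cX0 cY0)
    show "0 \<le> J t" using Jpos[of t] by (simp add: J_def)
  qed
  \<comment> \<open>The argument of the moving point; its derivative is the positive \<open>J t / (R t)\<^sup>2\<close>.\<close>
  define \<phi> where "\<phi> t = t + arctan (Y t / X t)" for t
  define R where "R t = sqrt ((X t)\<^sup>2 + (Y t)\<^sup>2)" for t
  have Rpos: "0 < R t" for t using Xpos[of t] by (simp add: R_def sum_power2_gt_zero_iff)
  have polar: "x t = R t *\<^sub>R dir (\<phi> t)" for t
  proof -
    have "sqrt (1 + (Y t / X t)\<^sup>2) = R t / X t"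
      unfolding R_def using Xpos[of t] real_sqrt_divide[of "(X t)\<^sup>2 + (Y t)\<^sup>2" "(X t)\<^sup>2"]
      by (simp add: power_divide add_divide_distrib)
    then have "R t * cos (arctan (Y t / X t)) = X t" "R t * sin (arctan (Y t / X t)) = Y t"
      using Xpos[of t] Rpos[of t] by (simp_all add: cos_arctan sin_arctan)
    then have "x t = (R t * cos (arctan (Y t / X t))) *\<^sub>R dir t + (R t * sin (arctan (Y t / X t))) *\<^sub>R dir (t + pi / 2)"
      by (simp add: x_def)
    also have "\<dots> = R t *\<^sub>R dir (\<phi> t)"
      by (simp add: vec2_eq_iff \<phi>_def cos_add sin_add algebra_simps)
    finally show ?thesis .
  qed
  have d\<phi>: "(\<phi> has_real_derivative J t / (R t)\<^sup>2) (at t)" for t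
  proof -
    have nz: "X t \<noteq> 0" using Xpos[of t] by simp
    have "(\<phi> has_real_derivative 1 + inverse (1 + (Y t / X t)\<^sup>2) * ((Y' t * X t - Y t * X' t) / (X t * X t))) (at t)"
      unfolding \<phi>_def[abs_def] using nz
      by (auto intro!: derivative_eq_intros dX dY)
    moreover have "1 + inverse (1 + (Y t / X t)\<^sup>2) * ((Y' t * X t - Y t * X' t) / (X t * X t)) = J t / (R t)\<^sup>2"
    proof -
      have q: "1 + (Y t / X t)\<^sup>2 = ((X t)\<^sup>2 + (Y t)\<^sup>2) / (X t)\<^sup>2" using nz by (simp add: field_simps)
      have p: "0 < (X t)\<^sup>2 + (Y t)\<^sup>2" using nz by (simp add: sum_power2_gt_zero_iff)
      have R2: "(R t)\<^sup>2 = (X t)\<^sup>2 + (Y t)\<^sup>2" by (simp add: R_def)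
      show ?thesis unfolding q R2 J_def using nz p
        by (simp add: divide_simps) (simp add: power2_eq_square algebra_simps)
    qed
    ultimately show ?thesis by simp
  qed
  have mono: "\<phi> s < \<phi> t" if "s < t" for s t
  proof (rule DERIV_pos_imp_increasing[OF that])
    fix u
    have "0 < J u / (R u)\<^sup>2" using Jpos[of u] Rpos[of u] by (simp add: J_def)
    then show "\<exists>D. (\<phi> has_real_derivative D) (at u) \<and> 0 < D" using d\<phi> by blast
  qed
  have "\<phi> (2 * pi) - \<phi> 0 \<le> 2 * pi" by (simp add: \<phi>_def closed)
  note swept = sw.swept_area_eq[of 0 "2 * pi" R \<phi>, OF polar Rpos mono this]
  have S: "S = {s *\<^sub>R x t | s t. 0 < s \<and> s < 1 \<and> 0 < t \<and> t < 2 * pi}" by (simp add: S_def x_def)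
  show "S \<in> lmeasurable" unfolding S by (rule swept) auto
  \<comment> \<open>Integration by parts removes the derivative of \<open>Y\<close> from the area formula.\<close>
  have parts: "((\<lambda>t. X' t * Y t + X t * Y' t) has_integral 0) {0..2 * pi}"
  proof -
    have "((\<lambda>t. X' t * Y t + X t * Y' t) has_integral X (2 * pi) * Y (2 * pi) - X 0 * Y 0) {0..2 * pi}"
      by (rule fundamental_theorem_of_calculus)
        (auto intro!: derivative_eq_intros dX[THEN DERIV_subset] dY[THEN DERIV_subset]
          simp flip: has_real_derivative_iff_has_vector_derivative)
    then show ?thesis by (simp add: closed)
  qed
  have "J = (\<lambda>t. ((X t)\<^sup>2 + (Y t)\<^sup>2 - 2 * Y t * X' t) + (X' t * Y t + X t * Y' t))"
    by (simp add: J_def fun_eq_iff)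
  then have "integral {0..2 * pi} J = integral {0..2 * pi} (\<lambda>t. (X t)\<^sup>2 + (Y t)\<^sup>2 - 2 * Y t * X' t)
      + integral {0..2 * pi} (\<lambda>t. X' t * Y t + X t * Y' t)"
    by (simp only:) (intro integral_add integrable_continuous_real continuous_intros
        continuous_on_subset[OF cX] continuous_on_subset[OF cY] continuous_on_subset[OF cX0]
        continuous_on_subset[OF cY0] subset_UNIV)
  then have "integral {0..2 * pi} J = integral {0..2 * pi} (\<lambda>t. (X t)\<^sup>2 + (Y t)\<^sup>2 - 2 * Y t * X' t)"
    using integral_unique[OF parts] by simp
  moreover have "area S = integral {0..2 * pi} J / 2" unfolding S by (rule swept) auto
  ultimately show "area S = integral {0..2 * pi} (\<lambda>t. (X t)\<^sup>2 + (Y t)\<^sup>2 - 2 * Y t * X' t) / 2" by simp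
qed

section \<open>Perturbed discs are close to the disc in the smooth topology\<close>

lemma circle_deriv_dir: "circle_deriv k f = (deriv ^^ k) (\<lambda>t. f (dir t))"
  by (simp add: circle_deriv_def dir_def)

lemma deriv_funpow_cos:
  fixes c e w :: real
  shows "(deriv ^^ k) (\<lambda>t. c + e * cos (w * t)) =
    (\<lambda>t. (if k = 0 then c else 0) + e * w ^ k * cos (w * t + k * (pi / 2)))"
proof (induction k)
  case (Suc k)
  have "deriv (\<lambda>t. (if k = 0 then c else 0) + e * w ^ k * cos (w * t + k * (pi / 2))) t
      = e * w ^ Suc k * cos (w * t + Suc k * (pi / 2))" for t
  proof (rule DERIV_imp_deriv)
    have "w * t + Suc k * (pi / 2) = (w * t + k * (pi / 2)) + pi / 2" by (simp add: algebra_simps)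
    then have "cos (w * t + Suc k * (pi / 2)) = - sin (w * t + k * (pi / 2))"
      by (simp only: cos_add) simp
    then show "((\<lambda>t. (if k = 0 then c else 0) + e * w ^ k * cos (w * t + k * (pi / 2)))
        has_field_derivative e * w ^ Suc k * cos (w * t + Suc k * (pi / 2))) (at t)"
      by (auto intro!: derivative_eq_intros simp del: of_nat_Suc)
  qed
  then show ?case by (simp only: funpow.simps o_apply Suc.IH) auto
qed simp

lemma deriv_funpow_diff:
  fixes F G :: "real \<Rightarrow> real"
  assumes "\<And>k t. (deriv ^^ k) F field_differentiable (at t)"
    and "\<And>k t. (deriv ^^ k) G field_differentiable (at t)"
  shows "(deriv ^^ k) (\<lambda>t. F t - G t) = (\<lambda>t. (deriv ^^ k) F t - (deriv ^^ k) G t)"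
proof (induction k)
  case (Suc k)
  then show ?case
    by (simp only: funpow.simps o_apply) (intro ext deriv_diff assms)
qed simp

lemma deriv_funpow_periodic:
  fixes F :: "real \<Rightarrow> real"
  assumes "\<And>t. F (t + p) = F t"
  shows "(deriv ^^ k) F (t + p) = (deriv ^^ k) F t"
proof (induction k arbitrary: t)
  case (Suc k)
  then show ?case by (simp add: deriv_def DERIV_shift)
qed (use assms in simp)

text \<open>Boundedness matters for the seminorms, which are suprema of real sets.\<close>

lemma bounded_range_periodic:
  fixes F :: "real \<Rightarrow> real"
  assumes per: "\<And>t. F (t + 2 * pi) = F t" and cont: "continuous_on UNIV F"
  shows "bounded (range F)"
proof -
  have "range F \<subseteq> F ` {- pi..pi}"
  proof
    fix y assume "y \<in> range F"
    then obtain t where t: "y = F t" by auto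
    obtain k :: int where "\<bar>t + 2 * pi * k - 0\<bar> \<le> pi" by (rule shift_to_window)
    moreover interpret F: periodic_fun_simple F "2 * pi" by unfold_locales (rule per)
    have "F (t + 2 * pi * k) = F t" using F.plus_of_int[of t k] by (simp add: algebra_simps)
    ultimately show "y \<in> F ` {- pi..pi}" unfolding t by (intro image_eqI[of _ _ "t + 2 * pi * k"]) auto
  qed
  moreover have "bounded (F ` {- pi..pi})"
    by (intro compact_imp_bounded compact_continuous_image continuous_on_subset[OF cont]) auto
  ultimately show ?thesis by (rule bounded_subset[rotated])
qed

lemma circle_one_smooth: "circle_one \<in> smooth_circle_functions"
  and circle_deriv_circle_one: "circle_deriv k circle_one = (\<lambda>t. if k = 0 then 1 else 0)"
proof -
  have *: "circle_deriv k circle_one = (\<lambda>t. if k = 0 then 1 else 0)" for k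
    using deriv_funpow_cos[of k 1 0 0] by (simp add: circle_deriv_dir circle_one_def)
  then show "circle_deriv k circle_one = (\<lambda>t. if k = 0 then 1 else 0)" .
  show "circle_one \<in> smooth_circle_functions"
    unfolding smooth_circle_functions_def by (simp add: *) (simp add: circle_one_def)
qed

lemma circle_one_in_topspace: "circle_one \<in> topspace Cinf_topology"
proof -
  have "Cinf_seminorm 0 (\<lambda>v. circle_one v - circle_one v) < 1"
    by (simp add: Cinf_seminorm_def circle_deriv_def)
  then show ?thesis
    unfolding Cinf_topology_def topology_generated_by_topspace using circle_one_smooth
    by (intro UnionI[of "{g \<in> smooth_circle_functions. Cinf_seminorm 0 (\<lambda>v. g v - circle_one v) < 1}"])
      (auto intro!: exI[of _ circle_one] exI[of _ 0] exI[of _ "1::real"])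
qed

lemma (in wavy) circle_deriv_wavy:
  "circle_deriv k (radial_function K) =
    (\<lambda>t::real. (if k = 0 then 1 else 0) + e * real m ^ k * cos (m * t + k * (pi / 2)))"
  using deriv_funpow_cos[of k 1 e "real m"]
  by (simp add: circle_deriv_dir radial_function_wavy_disc wavy_radius_def)

lemma (in wavy) radial_function_wavy_smooth: "radial_function K \<in> smooth_circle_functions"
proof -
  have "circle_deriv k (radial_function K) field_differentiable (at t)" for k t
    unfolding field_differentiable_def
    by (simp only: circle_deriv_wavy) (rule exI, (rule derivative_eq_intros refl)+)
  moreover have "radial_function K \<in> extensional unit_circle" by (simp add: radial_function_def)
  ultimately show ?thesis unfolding smooth_circle_functions_def by blast
qed

text \<open>The perturbation increases every seminorm of the distance to a smooth function by at most a
  multiple of \<open>e\<close>.\<close>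

lemma (in wavy) seminorm_wavy:
  assumes f: "f \<in> smooth_circle_functions"
  shows "Cinf_seminorm k (\<lambda>v. radial_function K v - f v)
    \<le> Cinf_seminorm k (\<lambda>v. circle_one v - f v) + e * real m ^ k"
proof -
  have sm: "(deriv ^^ k) (\<lambda>t. g (dir t)) field_differentiable (at t)"
    if "g \<in> smooth_circle_functions" for g k t
    using that unfolding smooth_circle_functions_def circle_deriv_dir by blast
  have diff: "circle_deriv k (\<lambda>v. g v - f v) = (\<lambda>t. circle_deriv k g t - circle_deriv k f t)"
    if "g \<in> smooth_circle_functions" for g
    unfolding circle_deriv_dir by (rule deriv_funpow_diff[OF sm[OF that] sm[OF f]])
  define F where "F = circle_deriv k (\<lambda>v. circle_one v - f v)"
  have F: "F = (\<lambda>t. circle_deriv k circle_one t - circle_deriv k f t)"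
    unfolding F_def by (rule diff[OF circle_one_smooth])
  have "F (t + 2 * pi) = F t" for t
    unfolding F_def circle_deriv_dir by (rule deriv_funpow_periodic) (simp add: dir_periodic)
  moreover have "continuous_on UNIV F"
    unfolding F using f circle_one_smooth unfolding smooth_circle_functions_def
    by (intro continuous_intros)
       (blast intro!: continuous_at_imp_continuous_on field_differentiable_imp_continuous_at)+
  ultimately have "bounded (range F)" by (rule bounded_range_periodic)
  then obtain B where "\<And>t. \<bar>F t\<bar> \<le> B" unfolding bounded_iff by auto
  then have bdd: "bdd_above (range (\<lambda>t. \<bar>F t\<bar>))" by (intro bdd_aboveI[of _ B]) auto
  show ?thesis unfolding Cinf_seminorm_def F_def[symmetric]
  proof (rule cSUP_least)
    fix t :: real
    have "circle_deriv k (\<lambda>v. radial_function K v - f v) t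
        = F t + e * real m ^ k * cos (m * t + k * (pi / 2))"
      unfolding F diff[OF radial_function_wavy_smooth] by (simp add: circle_deriv_wavy circle_deriv_circle_one)
    moreover have "\<bar>e * real m ^ k * cos (m * t + k * (pi / 2))\<bar> \<le> e * real m ^ k * 1"
      unfolding abs_mult using e_nonneg by (intro mult_mono) auto
    moreover have "\<bar>F t\<bar> \<le> (SUP t. \<bar>F t\<bar>)" by (rule cSUP_upper[OF _ bdd]) simp
    ultimately show "\<bar>circle_deriv k (\<lambda>v. radial_function K v - f v) t\<bar>
        \<le> (SUP t. \<bar>F t\<bar>) + e * real m ^ k" by linarith
  qed simp
qed

text \<open>Induction over the generation of the topology. For a basic open set, the strict inequality
  satisfied by the constant function \<open>1\<close> leaves room for a perturbation of size \<open>O(e)\<close>.\<close>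

lemma wavy_near_circle_one:
  assumes "openin Cinf_topology V" "circle_one \<in> V"
  shows "\<exists>e0>0. \<forall>e<e0. wavy m e \<longrightarrow> radial_function (wavy_disc m e) \<in> V"
proof -
  have "generate_topology_on {{g \<in> smooth_circle_functions. Cinf_seminorm k (\<lambda>v. g v - f v) < r} | f k r.
        f \<in> smooth_circle_functions \<and> r > 0} V"
    using assms(1) by (simp add: Cinf_topology_def openin_topology_generated_by_iff)
  then show ?thesis using assms(2)
  proof (induction rule: generate_topology_on.induct)
    case (Int A B)
    then obtain a b where "a > 0" "b > 0"
      "\<forall>e<a. wavy m e \<longrightarrow> radial_function (wavy_disc m e) \<in> A"
      "\<forall>e<b. wavy m e \<longrightarrow> radial_function (wavy_disc m e) \<in> B" by auto
    then show ?case by (intro exI[of _ "min a b"]) auto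
  next
    case (UN \<A>)
    then obtain A where A: "A \<in> \<A>" "circle_one \<in> A" by auto
    then obtain e0 where "e0 > 0" "\<forall>e<e0. wavy m e \<longrightarrow> radial_function (wavy_disc m e) \<in> A"
      using UN.IH[OF A] by blast
    then show ?case using A(1) by blast
  next
    case (Basis A)
    then obtain f k r where A: "A = {g \<in> smooth_circle_functions. Cinf_seminorm k (\<lambda>v. g v - f v) < r}"
      and f: "f \<in> smooth_circle_functions" by auto
    define d where "d = r - Cinf_seminorm k (\<lambda>v. circle_one v - f v)"
    have "d > 0" using Basis A by (simp add: d_def)
    have "radial_function (wavy_disc m e) \<in> A" if "e < d / (real m ^ k + 1)" "wavy m e" for e
    proof -
      interpret wavy m e by fact
      have "e * real m ^ k \<le> e * (real m ^ k + 1)" using e_nonneg by (intro mult_left_mono) auto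
      also have "\<dots> < d"
        using that(1) by (simp add: pos_less_divide_eq add_pos_nonneg add_nonneg_pos)
      finally have "Cinf_seminorm k (\<lambda>v. radial_function K v - f v) < r"
        using seminorm_wavy[OF f, of k] by (simp add: d_def)
      then show ?thesis using A radial_function_wavy_smooth by simp
    qed
    moreover have "d / (real m ^ k + 1) > 0" using \<open>d > 0\<close> by (simp add: add_nonneg_pos)
    ultimately show ?case by blast
  qed auto
qed

section \<open>Uniform second order expansions\<close>

text \<open>Boundedness of a function, and boundedness of a family of functions uniformly for
  parameters \<open>0 < e \<le> 1\<close>.\<close>

definition bdd_fun :: "(real \<Rightarrow> real) \<Rightarrow> bool" where
  "bdd_fun g \<longleftrightarrow> (\<exists>B. \<forall>t. \<bar>g t\<bar> \<le> B)"

definition ubdd :: "(real \<Rightarrow> real \<Rightarrow> real) \<Rightarrow> bool" where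
  "ubdd h \<longleftrightarrow> (\<exists>B. \<forall>e t. 0 < e \<and> e \<le> 1 \<longrightarrow> \<bar>h e t\<bar> \<le> B)"

lemma ubddI: "(\<And>e t. 0 < e \<Longrightarrow> e \<le> 1 \<Longrightarrow> \<bar>h e t\<bar> \<le> B) \<Longrightarrow> ubdd h"
  unfolding ubdd_def by blast

lemma ubddE:
  assumes "ubdd h"
  obtains B where "0 \<le> B" "\<And>e t. 0 < e \<Longrightarrow> e \<le> 1 \<Longrightarrow> \<bar>h e t\<bar> \<le> B"
proof -
  obtain B where "\<forall>e t. 0 < e \<and> e \<le> 1 \<longrightarrow> \<bar>h e t\<bar> \<le> B" using assms unfolding ubdd_def by blast
  then have "\<bar>h e t\<bar> \<le> max B 0" if "0 < e" "e \<le> 1" for e t using that by (simp add: le_max_iff_disj)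
  then show ?thesis using that[of "max B 0"] by simp
qed

lemma ubdd_coeff: "bdd_fun g \<Longrightarrow> ubdd (\<lambda>e. g)"
  unfolding bdd_fun_def ubdd_def by blast

lemma ubdd_small: "ubdd (\<lambda>e t. e)"
  by (rule ubddI[of _ 1]) simp

lemma ubdd_add: "ubdd g \<Longrightarrow> ubdd h \<Longrightarrow> ubdd (\<lambda>e t. g e t + h e t)"
proof (elim ubddE)
  fix B B' assume "\<And>e t. 0 < e \<Longrightarrow> e \<le> 1 \<Longrightarrow> \<bar>g e t\<bar> \<le> B" "\<And>e t. 0 < e \<Longrightarrow> e \<le> 1 \<Longrightarrow> \<bar>h e t\<bar> \<le> B'"
  then show ?thesis by (intro ubddI[of _ "B + B'"] order_trans[OF abs_triangle_ineq] add_mono)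
qed

lemma ubdd_mult: "ubdd g \<Longrightarrow> ubdd h \<Longrightarrow> ubdd (\<lambda>e t. g e t * h e t)"
proof (elim ubddE)
  fix B B' :: real assume "0 \<le> B" "\<And>e t. 0 < e \<Longrightarrow> e \<le> 1 \<Longrightarrow> \<bar>g e t\<bar> \<le> B"
    "\<And>e t. 0 < e \<Longrightarrow> e \<le> 1 \<Longrightarrow> \<bar>h e t\<bar> \<le> B'"
  then show ?thesis unfolding ubdd_def by (intro exI[of _ "B * B'"]) (auto simp: abs_mult intro!: mult_mono)
qed

lemma bdd_fun_ubdd: "bdd_fun g \<longleftrightarrow> ubdd (\<lambda>e. g)"
  unfolding bdd_fun_def ubdd_def by (meson le_numeral_extra(4) zero_less_one)

lemma bdd_fun_const: "bdd_fun (\<lambda>t. c)" unfolding bdd_fun_def by blast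
lemma bdd_fun_cos: "bdd_fun (\<lambda>t. cos (f t))" unfolding bdd_fun_def by (intro exI[of _ 1]) simp
lemma bdd_fun_sin: "bdd_fun (\<lambda>t. sin (f t))" unfolding bdd_fun_def by (intro exI[of _ 1]) simp
lemma bdd_fun_add: "bdd_fun f \<Longrightarrow> bdd_fun g \<Longrightarrow> bdd_fun (\<lambda>t. f t + g t)"
  unfolding bdd_fun_ubdd by (rule ubdd_add)
lemma bdd_fun_mult: "bdd_fun f \<Longrightarrow> bdd_fun g \<Longrightarrow> bdd_fun (\<lambda>t. f t * g t)"
  unfolding bdd_fun_ubdd by (rule ubdd_mult)

lemmas bdd_intros = bdd_fun_const bdd_fun_cos bdd_fun_sin bdd_fun_add bdd_fun_mult
  ubdd_coeff ubdd_small ubdd_add ubdd_mult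

text \<open>Second order expansion \<open>f0 + e * f1 + e\<^sup>2 * f2 + O(e\<^sup>3)\<close> in the small parameter \<open>e\<close>, uniform
  in the variable \<open>t\<close>, with bounded coefficients. Such expansions can be added, multiplied and, if
  \<open>f0\<close> is constant, composed with sine and cosine.\<close>

definition jet :: "(real \<Rightarrow> real \<Rightarrow> real) \<Rightarrow> (real \<Rightarrow> real) \<Rightarrow> (real \<Rightarrow> real) \<Rightarrow> (real \<Rightarrow> real) \<Rightarrow> bool" where
  "jet f f0 f1 f2 \<longleftrightarrow> bdd_fun f0 \<and> bdd_fun f1 \<and> bdd_fun f2 \<and>
    (\<exists>r. ubdd r \<and> (\<forall>e t. 0 < e \<and> e \<le> 1 \<longrightarrow> f e t = f0 t + e * f1 t + e\<^sup>2 * f2 t + e ^ 3 * r e t))"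

lemma jetI:
  assumes "bdd_fun f0" "bdd_fun f1" "bdd_fun f2" "ubdd r"
    "\<And>e t. 0 < e \<Longrightarrow> e \<le> 1 \<Longrightarrow> f e t = f0 t + e * f1 t + e\<^sup>2 * f2 t + e ^ 3 * r e t"
  shows "jet f f0 f1 f2"
  using assms unfolding jet_def by blast

lemma jetE:
  assumes "jet f f0 f1 f2"
  obtains r where "bdd_fun f0" "bdd_fun f1" "bdd_fun f2" "ubdd r"
    "\<And>e t. 0 < e \<Longrightarrow> e \<le> 1 \<Longrightarrow> f e t = f0 t + e * f1 t + e\<^sup>2 * f2 t + e ^ 3 * r e t"
  using assms unfolding jet_def by blast

lemma jet_cong:
  assumes "jet f f0 f1 f2" "\<And>e t. g e t = f e t" "\<And>t. g0 t = f0 t" "\<And>t. g1 t = f1 t" "\<And>t. g2 t = f2 t"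
  shows "jet g g0 g1 g2"
proof -
  have "g = f" "g0 = f0" "g1 = f1" "g2 = f2" using assms by auto
  then show ?thesis using assms(1) by simp
qed

lemma jet_coeff: "bdd_fun g \<Longrightarrow> jet (\<lambda>e. g) g (\<lambda>t. 0) (\<lambda>t. 0)"
  by (rule jetI[where r = "\<lambda>e t. 0"]) (auto intro: bdd_intros)

lemma jet_small: "jet (\<lambda>e t. e) (\<lambda>t. 0) (\<lambda>t. 1) (\<lambda>t. 0)"
  by (rule jetI[where r = "\<lambda>e t. 0"]) (auto intro: bdd_intros)

lemma jet_add:
  assumes "jet f f0 f1 f2" "jet g g0 g1 g2"
  shows "jet (\<lambda>e t. f e t + g e t) (\<lambda>t. f0 t + g0 t) (\<lambda>t. f1 t + g1 t) (\<lambda>t. f2 t + g2 t)"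
proof -
  obtain r where f: "bdd_fun f0" "bdd_fun f1" "bdd_fun f2" and r: "ubdd r"
    "\<And>e t. 0 < e \<Longrightarrow> e \<le> 1 \<Longrightarrow> f e t = f0 t + e * f1 t + e\<^sup>2 * f2 t + e ^ 3 * r e t" by (rule jetE[OF assms(1)]) blast
  obtain s where g: "bdd_fun g0" "bdd_fun g1" "bdd_fun g2" and s: "ubdd s"
    "\<And>e t. 0 < e \<Longrightarrow> e \<le> 1 \<Longrightarrow> g e t = g0 t + e * g1 t + e\<^sup>2 * g2 t + e ^ 3 * s e t" by (rule jetE[OF assms(2)]) blast
  show ?thesis
    by (rule jetI[OF bdd_fun_add[OF f(1) g(1)] bdd_fun_add[OF f(2) g(2)] bdd_fun_add[OF f(3) g(3)]
        ubdd_add[OF r(1) s(1)]]) (simp add: r(2) s(2) algebra_simps)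
qed

lemma jet_mult:
  assumes "jet f f0 f1 f2" "jet g g0 g1 g2"
  shows "jet (\<lambda>e t. f e t * g e t) (\<lambda>t. f0 t * g0 t) (\<lambda>t. f0 t * g1 t + f1 t * g0 t)
    (\<lambda>t. f0 t * g2 t + f1 t * g1 t + f2 t * g0 t)"
proof -
  obtain r where f: "bdd_fun f0" "bdd_fun f1" "bdd_fun f2" and r: "ubdd r"
    "\<And>e t. 0 < e \<Longrightarrow> e \<le> 1 \<Longrightarrow> f e t = f0 t + e * f1 t + e\<^sup>2 * f2 t + e ^ 3 * r e t" by (rule jetE[OF assms(1)]) blast
  obtain s where g: "bdd_fun g0" "bdd_fun g1" "bdd_fun g2" and s: "ubdd s"
    "\<And>e t. 0 < e \<Longrightarrow> e \<le> 1 \<Longrightarrow> g e t = g0 t + e * g1 t + e\<^sup>2 * g2 t + e ^ 3 * s e t" by (rule jetE[OF assms(2)]) blast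
  define q where "q e t = (f0 t * s e t + f1 t * g2 t + f2 t * g1 t + r e t * g0 t)
    + e * (f1 t * s e t + f2 t * g2 t + r e t * g1 t) + e * e * (f2 t * s e t + r e t * g2 t)
    + e * e * e * (r e t * s e t)" for e t
  have "ubdd q" unfolding q_def[abs_def] by (intro bdd_intros f g r(1) s(1))
  then show ?thesis
  proof (rule jetI[rotated 3])
    fix e t :: real assume e: "0 < e" "e \<le> 1"
    show "f e t * g e t = f0 t * g0 t + e * (f0 t * g1 t + f1 t * g0 t) +
      e\<^sup>2 * (f0 t * g2 t + f1 t * g1 t + f2 t * g0 t) + e ^ 3 * q e t"
      unfolding r(2)[OF e] s(2)[OF e] q_def by (simp add: algebra_simps power2_eq_square power3_eq_cube)
  qed (intro bdd_intros f g)+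
qed

lemma jet_cmult:
  assumes "jet f f0 f1 f2"
  shows "jet (\<lambda>e t. c * f e t) (\<lambda>t. c * f0 t) (\<lambda>t. c * f1 t) (\<lambda>t. c * f2 t)"
  by (rule jet_cong[OF jet_mult[OF jet_coeff[OF bdd_fun_const[of c]] assms]]) auto

lemma jet_diff:
  assumes "jet f f0 f1 f2" "jet g g0 g1 g2"
  shows "jet (\<lambda>e t. f e t - g e t) (\<lambda>t. f0 t - g0 t) (\<lambda>t. f1 t - g1 t) (\<lambda>t. f2 t - g2 t)"
  by (rule jet_cong[OF jet_add[OF assms(1) jet_cmult[OF assms(2), of "-1"]]]) auto

lemma jet_small_mult:
  assumes "jet f f0 f1 f2"
  shows "jet (\<lambda>e t. e * f e t) (\<lambda>t. 0) f0 f1"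
  by (rule jet_cong[OF jet_mult[OF jet_small assms]]) auto

lemma abs_sin_minus_id: "\<bar>sin h - h\<bar> \<le> \<bar>h\<bar> ^ 3" for h :: real
proof -
  have "\<bar>sin h - (\<Sum>k<3. sin_coeff k * h ^ k)\<bar> \<le> inverse (fact 3) * \<bar>h\<bar> ^ 3"
    by (rule Maclaurin_sin_bound)
  also have "(\<Sum>k<3. sin_coeff k * h ^ k) = h" by (simp add: numeral_3_eq_3 sin_coeff_def)
  also have "inverse (fact 3) * \<bar>h\<bar> ^ 3 \<le> 1 * \<bar>h\<bar> ^ 3"
    by (intro mult_right_mono) (simp_all add: fact_numeral)
  finally show ?thesis by simp
qed

lemma abs_cos_minus_quadratic: "\<bar>cos h - (1 - h\<^sup>2 / 2)\<bar> \<le> \<bar>h\<bar> ^ 4" for h :: real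
proof -
  have "cos h = 1 - 2 * (sin (h / 2))\<^sup>2" using cos_double_sin[of "h / 2"] by simp
  then have "cos h - (1 - h\<^sup>2 / 2) = 2 * ((h / 2 - sin (h / 2)) * (h / 2 + sin (h / 2)))"
    by (simp add: power2_eq_square algebra_simps)
  then have "\<bar>cos h - (1 - h\<^sup>2 / 2)\<bar> = 2 * (\<bar>sin (h / 2) - h / 2\<bar> * \<bar>h / 2 + sin (h / 2)\<bar>)"
    by (simp add: abs_mult abs_minus_commute)
  also have "\<dots> \<le> 2 * (\<bar>h / 2\<bar> ^ 3 * (\<bar>h / 2\<bar> + \<bar>h / 2\<bar>))"
    using abs_sin_minus_id[of "h / 2"] abs_triangle_ineq[of "h / 2" "sin (h / 2)"] abs_sin_x_le_abs_x[of "h / 2"]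
    by (intro mult_left_mono mult_mono) auto
  also have "\<dots> = \<bar>h\<bar> ^ 4 / 4" by (simp add: power_divide power_eq_if)
  also have "\<dots> \<le> \<bar>h\<bar> ^ 4" by simp
  finally show ?thesis .
qed

lemma jet_sin_cos_small:
  assumes "jet h (\<lambda>t. 0) h1 h2"
  shows "jet (\<lambda>e t. sin (h e t)) (\<lambda>t. 0) h1 h2"
    and "jet (\<lambda>e t. cos (h e t)) (\<lambda>t. 1) (\<lambda>t. 0) (\<lambda>t. - (h1 t)\<^sup>2 / 2)"
proof -
  obtain r where bd: "bdd_fun h1" "bdd_fun h2" "ubdd r" and
    h: "\<And>e t. 0 < e \<Longrightarrow> e \<le> 1 \<Longrightarrow> h e t = 0 + e * h1 t + e\<^sup>2 * h2 t + e ^ 3 * r e t"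
    by (rule jetE[OF assms]) blast
  \<comment> \<open>\<open>h = e * k\<close> with \<open>k\<close> bounded, so that \<open>h\<^sup>3\<close> and \<open>h\<^sup>4\<close> are \<open>O(e\<^sup>3)\<close>.\<close>
  define k where "k e t = h1 t + e * h2 t + e * e * r e t" for e t
  have "ubdd k" unfolding k_def[abs_def] by (intro bdd_intros bd)
  then obtain B where B: "0 \<le> B" "\<And>e t. 0 < e \<Longrightarrow> e \<le> 1 \<Longrightarrow> \<bar>k e t\<bar> \<le> B" by (rule ubddE) blast
  have hk: "h e t = e * k e t" if "0 < e" "e \<le> 1" for e t
    using h[OF that] by (simp add: k_def algebra_simps power2_eq_square power3_eq_cube)
  have "jet (\<lambda>e t. sin (h e t) - h e t) (\<lambda>t. 0) (\<lambda>t. 0) (\<lambda>t. 0)"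
  proof (rule jetI[OF bdd_fun_const bdd_fun_const bdd_fun_const, where r = "\<lambda>e t. (sin (h e t) - h e t) / e ^ 3"])
    show "ubdd (\<lambda>e t. (sin (h e t) - h e t) / e ^ 3)"
    proof (rule ubddI)
      fix e t :: real assume e: "0 < e" "e \<le> 1"
      have "\<bar>(sin (h e t) - h e t) / e ^ 3\<bar> \<le> \<bar>h e t\<bar> ^ 3 / e ^ 3"
        using abs_sin_minus_id[of "h e t"] e by (simp add: abs_divide divide_right_mono)
      also have "\<dots> = \<bar>k e t\<bar> ^ 3" using e by (simp add: hk abs_mult power_mult_distrib)
      also have "\<dots> \<le> B ^ 3" using B(2)[OF e] by (intro power_mono) auto
      finally show "\<bar>(sin (h e t) - h e t) / e ^ 3\<bar> \<le> B ^ 3" .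
    qed
  qed simp
  from jet_add[OF this assms] show "jet (\<lambda>e t. sin (h e t)) (\<lambda>t. 0) h1 h2"
    by (rule jet_cong) auto
  have "jet (\<lambda>e t. cos (h e t) - (1 - (h e t)\<^sup>2 / 2)) (\<lambda>t. 0) (\<lambda>t. 0) (\<lambda>t. 0)"
  proof (rule jetI[OF bdd_fun_const bdd_fun_const bdd_fun_const,
        where r = "\<lambda>e t. (cos (h e t) - (1 - (h e t)\<^sup>2 / 2)) / e ^ 3"])
    show "ubdd (\<lambda>e t. (cos (h e t) - (1 - (h e t)\<^sup>2 / 2)) / e ^ 3)"
    proof (rule ubddI)
      fix e t :: real assume e: "0 < e" "e \<le> 1"
      have "\<bar>(cos (h e t) - (1 - (h e t)\<^sup>2 / 2)) / e ^ 3\<bar> \<le> \<bar>h e t\<bar> ^ 4 / e ^ 3"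
        using abs_cos_minus_quadratic[of "h e t"] e by (simp add: abs_divide divide_right_mono)
      also have "\<dots> = e * \<bar>k e t\<bar> ^ 4" using e by (simp add: hk abs_mult power_mult_distrib power_eq_if)
      also have "\<dots> \<le> 1 * B ^ 4" using B(2)[OF e] e by (intro mult_mono power_mono) auto
      finally show "\<bar>(cos (h e t) - (1 - (h e t)\<^sup>2 / 2)) / e ^ 3\<bar> \<le> 1 * B ^ 4" .
    qed
  qed simp
  from jet_add[OF this jet_diff[OF jet_coeff[OF bdd_fun_const[of 1]] jet_cmult[OF jet_mult[OF assms assms], of "1/2"]]]
  show "jet (\<lambda>e t. cos (h e t)) (\<lambda>t. 1) (\<lambda>t. 0) (\<lambda>t. - (h1 t)\<^sup>2 / 2)"
    by (rule jet_cong) (auto simp: power2_eq_square)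
qed

lemma jet_sin_cos:
  assumes "jet f (\<lambda>t. b) f1 f2"
  shows jet_sin: "jet (\<lambda>e t. sin (f e t)) (\<lambda>t. sin b) (\<lambda>t. cos b * f1 t) (\<lambda>t. cos b * f2 t - sin b * (f1 t)\<^sup>2 / 2)"
    and jet_cos: "jet (\<lambda>e t. cos (f e t)) (\<lambda>t. cos b) (\<lambda>t. - sin b * f1 t) (\<lambda>t. - sin b * f2 t - cos b * (f1 t)\<^sup>2 / 2)"
proof -
  have h: "jet (\<lambda>e t. f e t - b) (\<lambda>t. 0) f1 f2"
    by (rule jet_cong[OF jet_diff[OF assms jet_coeff[OF bdd_fun_const[of b]]]]) auto
  note sc = jet_sin_cos_small[OF h]
  have *: "f e t = b + (f e t - b)" for e t by simp
  show "jet (\<lambda>e t. sin (f e t)) (\<lambda>t. sin b) (\<lambda>t. cos b * f1 t) (\<lambda>t. cos b * f2 t - sin b * (f1 t)\<^sup>2 / 2)"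
    by (rule jet_cong[OF jet_add[OF jet_cmult[OF sc(2), of "sin b"] jet_cmult[OF sc(1), of "cos b"]]])
      (subst *, simp only: sin_add, auto)
  show "jet (\<lambda>e t. cos (f e t)) (\<lambda>t. cos b) (\<lambda>t. - sin b * f1 t) (\<lambda>t. - sin b * f2 t - cos b * (f1 t)\<^sup>2 / 2)"
    by (rule jet_cong[OF jet_diff[OF jet_cmult[OF sc(2), of "cos b"] jet_cmult[OF sc(1), of "sin b"]]])
      (subst *, simp only: cos_add, auto)
qed

text \<open>The next lemmas turn an expansion into statements for all sufficiently small \<open>e\<close>,
  uniformly in \<open>t\<close>.\<close>

lemma jet_eventually_close:
  assumes "jet f f0 f1 f2" "\<eta> > 0"
  shows "eventually (\<lambda>e. \<forall>t. \<bar>f e t - (f0 t + e * f1 t + e\<^sup>2 * f2 t)\<bar> \<le> \<eta> * e\<^sup>2) (at_right 0)"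
proof -
  obtain r where r: "ubdd r"
    "\<And>e t. 0 < e \<Longrightarrow> e \<le> 1 \<Longrightarrow> f e t = f0 t + e * f1 t + e\<^sup>2 * f2 t + e ^ 3 * r e t"
    by (rule jetE[OF assms(1)]) blast
  obtain B where B: "0 \<le> B" "\<And>e t. 0 < e \<Longrightarrow> e \<le> 1 \<Longrightarrow> \<bar>r e t\<bar> \<le> B" by (rule ubddE[OF r(1)]) blast
  have "\<bar>f e t - (f0 t + e * f1 t + e\<^sup>2 * f2 t)\<bar> \<le> \<eta> * e\<^sup>2" if e: "0 < e" "e < min 1 (\<eta> / (B + 1))" for e t
  proof -
    have "e * \<bar>r e t\<bar> \<le> e * (B + 1)" using B(2)[of e t] e by (intro mult_left_mono) auto
    also have "\<dots> \<le> \<eta>" using e B(1) by (simp add: field_simps)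
    finally have "e\<^sup>2 * (e * \<bar>r e t\<bar>) \<le> e\<^sup>2 * \<eta>" by (intro mult_left_mono) auto
    then show ?thesis using e r(2)[of e t] by (simp add: abs_mult power3_eq_cube power2_eq_square mult_ac)
  qed
  moreover have "0 < min 1 (\<eta> / (B + 1))" using assms(2) B(1) by simp
  ultimately show ?thesis unfolding eventually_at_right_field by blast
qed

lemma jet_eventually_pos:
  assumes "jet f (\<lambda>t. c) f1 f2" "0 < c"
  shows "eventually (\<lambda>e. \<forall>t. 0 < f e t) (at_right 0)"
proof -
  obtain B where B: "0 \<le> B" "\<And>e t. 0 < e \<Longrightarrow> e \<le> 1 \<Longrightarrow> \<bar>f1 t + e * f2 t\<bar> \<le> B"
  proof (rule ubddE)
    have "bdd_fun f1" "bdd_fun f2" using assms(1) unfolding jet_def by auto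
    then show "ubdd (\<lambda>e t. f1 t + e * f2 t)" by (intro bdd_intros)
  qed blast
  have close: "eventually (\<lambda>e. \<forall>t. \<bar>f e t - (c + e * f1 t + e\<^sup>2 * f2 t)\<bar> \<le> 1 * e\<^sup>2) (at_right 0)"
    by (rule jet_eventually_close[OF assms(1)]) simp
  have "eventually (\<lambda>e::real. 0 < e \<and> e < min 1 (c / (B + 1))) (at_right 0)"
    unfolding eventually_at_right_field using assms(2) B(1) by (intro exI[of _ "min 1 (c / (B + 1))"]) auto
  with close show ?thesis
  proof eventually_elim
    case (elim e)
    show ?case
    proof
      fix t
      have e: "0 < e" "e \<le> 1" "e * (B + 1) < c" using elim B(1) by (auto simp: field_simps)
      have "e * (- B) \<le> e * (f1 t + e * f2 t)"
        using B(2)[OF e(1,2), of t] e by (intro mult_left_mono) auto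
      moreover have "e\<^sup>2 \<le> e * 1" using e unfolding power2_eq_square by (intro mult_left_mono) auto
      moreover have "f e t \<ge> c + e * f1 t + e\<^sup>2 * f2 t - e\<^sup>2" using spec[OF elim(1), of t] by linarith
      moreover have "e * (f1 t + e * f2 t) = e * f1 t + e\<^sup>2 * f2 t" by (simp add: algebra_simps power2_eq_square)
      ultimately show "0 < f e t" using e(3)
        unfolding distrib_left mult_minus_right mult_1_right by linarith
    qed
  qed
qed

lemma jet_eventually_nonneg:
  assumes "jet f (\<lambda>t. 0) (\<lambda>t. 0) (\<lambda>t. c)" "0 < c"
  shows "eventually (\<lambda>e. \<forall>t. 0 \<le> f e t) (at_right 0)"
  using jet_eventually_close[OF assms]
proof eventually_elim
  case (elim e)
  then have "\<bar>f e t - c * e\<^sup>2\<bar> \<le> c * e\<^sup>2" for t by (simp add: mult.commute)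
  then show ?case by (auto simp: abs_le_iff)
qed

lemma jet_eventually_integral:
  assumes j: "jet f f0 f1 f2" and p: "0 < p"
    and I: "(f0 has_integral I0) {0..p}" "(f1 has_integral I1) {0..p}" "(f2 has_integral I2) {0..p}"
    and cont: "\<And>e. 0 < e \<Longrightarrow> f e integrable_on {0..p}" and c: "c < I2"
  shows "eventually (\<lambda>e. I0 + e * I1 + e\<^sup>2 * c < integral {0..p} (f e)) (at_right 0)"
proof -
  define \<eta> where "\<eta> = (I2 - c) / (2 * p)"
  have \<eta>: "0 < \<eta>" using p c by (simp add: \<eta>_def)
  have "eventually (\<lambda>e::real. 0 < e) (at_right 0)" by (simp add: eventually_at_right_less)
  with jet_eventually_close[OF j \<eta>] show ?thesis
  proof eventually_elim
    case (elim e)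
    have g: "((\<lambda>t. f0 t + e * f1 t + e\<^sup>2 * f2 t - \<eta> * e\<^sup>2) has_integral
        (I0 + e * I1 + e\<^sup>2 * I2 - \<eta> * e\<^sup>2 * p)) {0..p}"
      using has_integral_diff[OF has_integral_add[OF has_integral_add[OF I(1) has_integral_mult_right[OF I(2), of e]]
          has_integral_mult_right[OF I(3), of "e\<^sup>2"]] has_integral_const_real[of "\<eta> * e\<^sup>2" 0 p]] p
      by (simp add: mult.commute)
    have "I0 + e * I1 + e\<^sup>2 * I2 - \<eta> * e\<^sup>2 * p \<le> integral {0..p} (f e)"
    proof (rule has_integral_le[OF g integrable_integral[OF cont]])
      fix t
      show "f0 t + e * f1 t + e\<^sup>2 * f2 t - \<eta> * e\<^sup>2 \<le> f e t"
        using spec[OF elim(1), of t] by linarith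
    qed (use elim in simp)
    moreover have "e\<^sup>2 * c < e\<^sup>2 * (I2 - \<eta> * p)"
      using elim c p by (intro mult_strict_left_mono) (auto simp: \<eta>_def field_simps)
    ultimately show ?case by (simp add: algebra_simps)
  qed
qed

section \<open>Expansion along the curve of chord sums\<close>

text \<open>The half angle \<open>a\<close> of the chords of the unit disc, the frequency, and a small margin \<open>\<eta>\<close> for
  the areas of the caps of the perturbed disc.\<close>

locale chord_expansion =
  fixes a :: real and m :: nat and \<eta> :: real
  assumes a_pos: "0 < a" and a_less: "a < pi / 2" and m_pos: "0 < m"
begin

definition "sm = sin (real m * a)"
definition "cm = cos (real m * a)"
definition "w = sm / real m"

text \<open>The coefficients of the half angle of the chords. The value of \<open>\<kappa>\<close> cancels the first order
  term of the area of the cap, and \<open>\<mu>\<close> and \<open>\<nu>\<close> make twice the area of the cap exceed its required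
  value by \<open>2 * \<eta> * e\<^sup>2\<close> at second order.\<close>

definition "\<kappa> = (cm * cos a * sin a - w) / (sin a)\<^sup>2"
definition "\<nu> = - (8 * cm * \<kappa> * (sin a)\<^sup>2 + 4 * sin a * cos a * \<kappa>\<^sup>2 + 4 * sm * real m * \<kappa> * sin a * cos a
  + 2 * w * cm - 2 * sin a * cos a) / (4 * (sin a)\<^sup>2)"
definition "\<mu> = (2 * \<eta> + w * cm - sin a * cos a - 2 * sm\<^sup>2 * sin a * cos a) / (4 * (sin a)\<^sup>2)"

text \<open>The half angle of the chord whose end points have the angles \<open>t - al e t\<close> and \<open>t + al e t\<close>,
  and its derivative.\<close>

definition "al e t = a + e * (\<kappa> * cos (real m * t)) + e\<^sup>2 * (\<mu> + \<nu> * (cos (real m * t))\<^sup>2)"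
definition "al' e t = e * (- (real m * \<kappa> * sin (real m * t)))
  + e\<^sup>2 * (- (2 * real m * \<nu> * sin (real m * t) * cos (real m * t)))"

text \<open>Twice the area of sector minus triangle over the chord.\<close>

definition "twice_cap e t = 2 * al e t + e * (4 / real m * cos (real m * t) * sin (real m * al e t))
  + e\<^sup>2 * (al e t + cos (2 * real m * t) / (2 * real m) * sin (2 * real m * al e t))
  - (1 + e * (2 * cos (real m * t) * cos (real m * al e t))
      + e\<^sup>2 * (1/2 * (cos (2 * real m * t) + cos (2 * real m * al e t)))) * sin (2 * al e t)"

text \<open>The coordinates of the sum of the two end points with respect to the rotating frame
  \<open>dir t\<close>, \<open>dir (t + pi / 2)\<close>, and their derivatives.\<close>

definition "X e t = 2 * (cos (al e t) * (1 + e * (cos (real m * t) * cos (real m * al e t))))"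
definition "X' e t = 2 * (- 1 * (sin (al e t) * al' e t * (1 + e * (cos (real m * t) * cos (real m * al e t))))
  + cos (al e t) * (e * (- (real m * sin (real m * t)) * cos (real m * al e t)
      - cos (real m * t) * (real m * (al' e t * sin (real m * al e t))))))"
definition "Y e t = - 2 * (e * (sin (real m * t) * (sin (real m * al e t) * sin (al e t))))"
definition "Y' e t = - 2 * (e * (real m * cos (real m * t) * (sin (real m * al e t) * sin (al e t))
  + sin (real m * t) * (real m * (al' e t * cos (real m * al e t)) * sin (al e t)
      + sin (real m * al e t) * (cos (al e t) * al' e t))))"

lemma sin_a_pos: "0 < sin a" and cos_a_pos: "0 < cos a"
  using a_pos a_less by (auto intro: sin_gt_zero cos_gt_zero)

lemma \<kappa>_eq: "\<kappa> * (sin a)\<^sup>2 = cm * cos a * sin a - w"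
  using sin_a_pos by (simp add: \<kappa>_def)

lemma \<nu>_eq: "4 * (sin a)\<^sup>2 * \<nu> = - (8 * cm * \<kappa> * (sin a)\<^sup>2 + 4 * sin a * cos a * \<kappa>\<^sup>2
    + 4 * sm * real m * \<kappa> * sin a * cos a + 2 * w * cm - 2 * sin a * cos a)"
  using sin_a_pos by (simp add: \<nu>_def)

lemma \<mu>_eq: "4 * (sin a)\<^sup>2 * \<mu> = 2 * \<eta> + w * cm - sin a * cos a - 2 * sm\<^sup>2 * sin a * cos a"
  using sin_a_pos by (simp add: \<mu>_def)

lemma w_eq: "real m * w = sm"
  using m_pos by (simp add: w_def)

lemma al_derivative: "(al e has_real_derivative al' e t) (at t)"
  unfolding al_def[abs_def] al'_def by (auto intro!: derivative_eq_intros simp: algebra_simps power2_eq_square)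

lemma X_derivative: "(X e has_real_derivative X' e t) (at t)"
  unfolding X_def[abs_def] X'_def by (auto intro!: derivative_eq_intros al_derivative simp: algebra_simps)

lemma Y_derivative: "(Y e has_real_derivative Y' e t) (at t)"
  unfolding Y_def[abs_def] Y'_def by (auto intro!: derivative_eq_intros al_derivative simp: algebra_simps)

lemma continuous_X'_Y':
  "continuous_on S (X e)" "continuous_on S (Y e)" "continuous_on S (X' e)" "continuous_on S (Y' e)"
proof -
  have [continuous_intros]: "continuous_on S (al e)" "continuous_on S (al' e)"
    unfolding al_def[abs_def] al'_def[abs_def] by (intro continuous_intros)+
  show "continuous_on S (X e)" "continuous_on S (Y e)" "continuous_on S (X' e)" "continuous_on S (Y' e)"
    unfolding X_def[abs_def] Y_def[abs_def] X'_def[abs_def] Y'_def[abs_def]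
    by (intro continuous_intros)+
qed

lemma XY_periodic: "X e (2 * pi) = X e 0" "Y e (2 * pi) = Y e 0"
proof -
  have "cos (real m * (2 * pi)) = 1" "sin (real m * (2 * pi)) = 0"
    using cos_npi[of "2 * m"] sin_npi[of "2 * m"] by (simp_all add: algebra_simps)
  then show "X e (2 * pi) = X e 0" "Y e (2 * pi) = Y e 0" by (simp_all add: X_def Y_def al_def)
qed

lemmas jet_C = jet_coeff[OF bdd_fun_cos[of "\<lambda>t. real m * t"]]
lemmas jet_S = jet_coeff[OF bdd_fun_sin[of "\<lambda>t. real m * t"]]
lemmas jet_C2 = jet_coeff[OF bdd_fun_cos[of "\<lambda>t. 2 * real m * t"]]
lemmas jet_const = jet_coeff[OF bdd_fun_const]

lemma jet_al: "jet al (\<lambda>t. a) (\<lambda>t. \<kappa> * cos (real m * t)) (\<lambda>t. \<mu> + \<nu> * (cos (real m * t))\<^sup>2)"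
  by (rule jet_cong[OF jet_add[OF jet_add[OF jet_const[of a] jet_small_mult[OF jet_cmult[OF jet_C, of \<kappa>]]]
        jet_small_mult[OF jet_small_mult[OF jet_add[OF jet_const[of \<mu>] jet_cmult[OF jet_mult[OF jet_C jet_C], of \<nu>]]]]]])
    (simp_all add: al_def power2_eq_square)

lemma jet_al': "jet al' (\<lambda>t. 0) (\<lambda>t. - (real m * \<kappa> * sin (real m * t)))
    (\<lambda>t. - (2 * real m * \<nu> * sin (real m * t) * cos (real m * t)))"
  by (rule jet_cong[OF jet_add[OF jet_small_mult[OF jet_cmult[OF jet_S, of "- (real m * \<kappa>)"]]
        jet_small_mult[OF jet_small_mult[OF jet_cmult[OF jet_mult[OF jet_S jet_C], of "- (2 * real m * \<nu>)"]]]]])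
    (simp_all add: al'_def power2_eq_square)

lemmas jet_sin_al = jet_sin[OF jet_al] and jet_cos_al = jet_cos[OF jet_al]
lemmas jet_m_al = jet_cmult[OF jet_al, of "real m"]
lemmas jet_2_al = jet_cmult[OF jet_al, of 2]
lemmas jet_2m_al = jet_cmult[OF jet_al, of "2 * real m"]
lemmas jet_sin_m_al = jet_sin[OF jet_m_al] and jet_cos_m_al = jet_cos[OF jet_m_al]

text \<open>The second order coefficient of \<open>twice_cap\<close> as a polynomial identity, with \<open>C\<close> for
  \<open>cos (m * t)\<close>.\<close>

lemma twice_cap_order2:
  fixes sa ca s c w' M k n u et C A :: real
  assumes "4 * sa\<^sup>2 * n = - (8 * c * k * sa\<^sup>2 + 4 * sa * ca * k\<^sup>2 + 4 * s * M * k * sa * ca + 2 * w' * c - 2 * sa * ca)"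
    and "4 * sa\<^sup>2 * u = 2 * et + w' * c - sa * ca - 2 * s\<^sup>2 * sa * ca"
  shows "2 * (u + n * C\<^sup>2) + 4 * C * (c * k * C) + A + (2 * C\<^sup>2 - 1) * w' * c
    - (((1 - 2 * sa\<^sup>2) * (2 * (u + n * C\<^sup>2)) - 2 * sa * ca * (2 * k * C)\<^sup>2 / 2)
       + 2 * C * c * ((1 - 2 * sa\<^sup>2) * (2 * k * C))
       + (2 * C * (- s * (M * k * C)) + ((2 * C\<^sup>2 - 1) + (1 - 2 * s\<^sup>2)) / 2) * (2 * sa * ca))
    - (A - sa * ca) = 2 * et"
proof -
  have "2 * (u + n * C\<^sup>2) + 4 * C * (c * k * C) + A + (2 * C\<^sup>2 - 1) * w' * c
    - (((1 - 2 * sa\<^sup>2) * (2 * (u + n * C\<^sup>2)) - 2 * sa * ca * (2 * k * C)\<^sup>2 / 2)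
       + 2 * C * c * ((1 - 2 * sa\<^sup>2) * (2 * k * C))
       + (2 * C * (- s * (M * k * C)) + ((2 * C\<^sup>2 - 1) + (1 - 2 * s\<^sup>2)) / 2) * (2 * sa * ca))
    - (A - sa * ca)
    = 4 * sa\<^sup>2 * u + C\<^sup>2 * (4 * sa\<^sup>2 * n) + C\<^sup>2 * (8 * c * k * sa\<^sup>2 + 4 * sa * ca * k\<^sup>2
        + 4 * s * M * k * sa * ca + 2 * w' * c - 2 * sa * ca)
      - w' * c + sa * ca + 2 * s\<^sup>2 * sa * ca"
    by (simp add: field_simps power2_eq_square)
  also have "\<dots> = 2 * et" unfolding assms by (simp add: algebra_simps)
  finally show ?thesis .
qed

lemma jet_twice_cap:
  "jet (\<lambda>e t. twice_cap e t - (2 * a - sin (2 * a)) * (1 + e\<^sup>2 / 2)) (\<lambda>t. 0) (\<lambda>t. 0) (\<lambda>t. 2 * \<eta>)"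
proof -
  note lin = jet_small_mult[OF jet_mult[OF jet_cmult[OF jet_C, of "4 / real m"] jet_sin_m_al]]
  note quad = jet_small_mult[OF jet_small_mult[OF jet_add[OF jet_al
        jet_mult[OF jet_cmult[OF jet_C2, of "1 / (2 * real m)"] jet_sin[OF jet_2m_al]]]]]
  note rr = jet_add[OF jet_add[OF jet_const[of 1] jet_small_mult[OF jet_mult[OF jet_cmult[OF jet_C, of 2] jet_cos_m_al]]]
        jet_small_mult[OF jet_small_mult[OF jet_cmult[OF jet_add[OF jet_C2 jet_cos[OF jet_2m_al]], of "1/2"]]]]
  note T = jet_cmult[OF jet_add[OF jet_const[of 1] jet_cmult[OF jet_small_mult[OF jet_small], of "1/2"]], of "2 * a - sin (2 * a)"]
  note F = jet_diff[OF jet_diff[OF jet_add[OF jet_add[OF jet_2_al lin] quad] jet_mult[OF rr jet_sin[OF jet_2_al]]] T]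
  have dbl: "sin (2 * real m * a) = 2 * sm * cm" "cos (2 * real m * a) = 1 - 2 * sm\<^sup>2"
    "cos (2 * real m * t) = 2 * (cos (real m * t))\<^sup>2 - 1" for t
    using sin_double[of "real m * a"] cos_double_sin[of "real m * a"] cos_double_cos[of "real m * t"]
    by (simp_all add: sm_def cm_def mult.assoc)
  have m: "m \<noteq> 0" using m_pos by simp
  have cm_sq: "cm\<^sup>2 = 1 - sm\<^sup>2" by (simp add: sm_def cm_def cos_squared_eq)
  have dbl_a: "sin (2 * a) = 2 * sin a * cos a" "cos (2 * a) = 1 - 2 * (sin a)\<^sup>2"
    by (simp_all add: sin_double cos_double_sin)
  have order1: "2 * (\<kappa> * C) + 4 / real m * C * sin (real m * a)
      - (cos (2 * a) * (2 * (\<kappa> * C)) + 2 * C * cos (real m * a) * sin (2 * a)) = 0" for C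
  proof -
    have "2 * (\<kappa> * C) + 4 / real m * C * sin (real m * a)
        - (cos (2 * a) * (2 * (\<kappa> * C)) + 2 * C * cos (real m * a) * sin (2 * a))
      = 4 * C * (\<kappa> * (sin a)\<^sup>2 + w - cm * cos a * sin a)"
      unfolding dbl_a by (simp add: w_def sm_def cm_def algebra_simps)
    then show ?thesis by (simp add: \<kappa>_eq)
  qed
  have order2: "2 * (\<mu> + \<nu> * C\<^sup>2) + 4 / real m * C * (cm * (real m * (\<kappa> * C))) + (a + (2 * C\<^sup>2 - 1) / (2 * real m) * (2 * sm * cm))
    - (cos (2 * a) * (2 * (\<mu> + \<nu> * C\<^sup>2)) - sin (2 * a) * (2 * (\<kappa> * C))\<^sup>2 / 2
       + 2 * C * cm * (cos (2 * a) * (2 * (\<kappa> * C)))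
       + (2 * C * (- sm * (real m * (\<kappa> * C))) + 1 / 2 * ((2 * C\<^sup>2 - 1) + (1 - 2 * sm\<^sup>2))) * sin (2 * a))
    - (2 * a - sin (2 * a)) * (1 / 2) = 2 * \<eta>" for C
  proof -
    have e: "4 / real m * C * (cm * (real m * (\<kappa> * C))) = 4 * C * (cm * \<kappa> * C)"
      "(2 * C\<^sup>2 - 1) / (2 * real m) * (2 * sm * cm) = (2 * C\<^sup>2 - 1) * w * cm"
      using m by (simp_all add: w_def)
    show ?thesis
      unfolding e dbl_a using twice_cap_order2[OF \<nu>_eq \<mu>_eq, of C a]
      by (simp add: field_simps power2_eq_square)
  qed
  show ?thesis
  proof (rule jet_cong[OF F], goal_cases)
    case (1 e t)
    then show ?case by (simp add: twice_cap_def power2_eq_square)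
  next
    case (2 t)
    then show ?case by simp
  next
    case (3 t)
    then show ?case using order1[of "cos (real m * t)"] by simp
  next
    case (4 t)
    then show ?case using order2[of "cos (real m * t)"]
      by (simp add: dbl m cm_sq flip: sm_def cm_def)
  qed
qed

text \<open>Expansions of the coordinates as they come out of the rules for products and sums; only the
  coefficients needed later are simplified.\<close>

lemmas jet_factor = jet_add[OF jet_const[of 1] jet_small_mult[OF jet_mult[OF jet_C jet_cos_m_al]]]
lemmas jet_X_raw = jet_cmult[OF jet_mult[OF jet_cos_al jet_factor], of 2]
lemmas jet_Y_raw = jet_cmult[OF jet_small_mult[OF jet_mult[OF jet_S jet_mult[OF jet_sin_m_al jet_sin_al]]], of "-2"]
lemmas jet_X'_raw = jet_cmult[OF jet_add[OF jet_cmult[OF jet_mult[OF jet_mult[OF jet_sin_al jet_al'] jet_factor], of "-1"]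
  jet_mult[OF jet_cos_al jet_small_mult[OF jet_diff[OF jet_mult[OF jet_cmult[OF jet_S, of "- real m"] jet_cos_m_al]
    jet_mult[OF jet_C jet_cmult[OF jet_mult[OF jet_al' jet_sin_m_al], of "real m"]]]]]], of 2]
lemmas jet_Y'_raw = jet_cmult[OF jet_small_mult[OF jet_add[
    OF jet_mult[OF jet_cmult[OF jet_C, of "real m"] jet_mult[OF jet_sin_m_al jet_sin_al]]
      jet_mult[OF jet_S jet_add[OF jet_mult[OF jet_cmult[OF jet_mult[OF jet_al' jet_cos_m_al], of "real m"] jet_sin_al]
        jet_mult[OF jet_sin_m_al jet_mult[OF jet_cos_al jet_al']]]]]], of "-2"]

text \<open>Coefficients of the expansion of half the first coordinate.\<close>

definition "x1 = cm * cos a - \<kappa> * sin a"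
definition "x20 = - sin a * \<mu>"
definition "x22 = - sin a * \<nu> - cos a * \<kappa>\<^sup>2 / 2 - sin a * \<kappa> * cm - cos a * sm * real m * \<kappa>"

lemma jet_X: "jet X (\<lambda>t. 2 * cos a) (\<lambda>t. 2 * x1 * cos (real m * t))
    (\<lambda>t. 2 * (x20 + x22 * (cos (real m * t))\<^sup>2))"
  by (rule jet_cong[OF jet_X_raw])
    (simp_all add: X_def x1_def x20_def x22_def cm_def sm_def algebra_simps power2_eq_square)

lemma jet_Y: "\<exists>y2. jet Y (\<lambda>t. 0) (\<lambda>t. - 2 * (sm * sin a * sin (real m * t))) y2"
  by (rule exI, rule jet_cong[OF jet_Y_raw]; (rule refl | simp add: Y_def sm_def))

lemma jet_X': "\<exists>x'2. jet X' (\<lambda>t. 0) (\<lambda>t. - 2 * (real m * x1 * sin (real m * t))) x'2"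
  by (rule exI, rule jet_cong[OF jet_X'_raw]; (rule refl | simp add: X'_def x1_def cm_def algebra_simps))

lemma jet_Y': "\<exists>y'1 y'2. jet Y' (\<lambda>t. 0) y'1 y'2"
  by (rule exI, rule exI, rule jet_cong[OF jet_Y'_raw]; (rule refl | simp add: Y'_def))

text \<open>Second order coefficient of twice the areal velocity, after integration by parts.\<close>

definition "I2 t = (4 * x1\<^sup>2 + 8 * cos a * x22) * (cos (real m * t))\<^sup>2 + 8 * cos a * x20
  + (4 * sm\<^sup>2 * (sin a)\<^sup>2 - 8 * sm * sin a * real m * x1) * (sin (real m * t))\<^sup>2"

lemma jet_integrand:
  "jet (\<lambda>e t. (X e t)\<^sup>2 + (Y e t)\<^sup>2 - 2 * Y e t * X' e t)
    (\<lambda>t. 4 * (cos a)\<^sup>2) (\<lambda>t. 8 * cos a * x1 * cos (real m * t)) I2"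
proof -
  obtain y2 x'2 where Y: "jet Y (\<lambda>t. 0) (\<lambda>t. - 2 * (sm * sin a * sin (real m * t))) y2"
    and X': "jet X' (\<lambda>t. 0) (\<lambda>t. - 2 * (real m * x1 * sin (real m * t))) x'2"
    using jet_Y jet_X' by blast
  show ?thesis
    by (rule jet_cong[OF jet_diff[OF jet_add[OF jet_mult[OF jet_X jet_X] jet_mult[OF Y Y]] jet_cmult[OF jet_mult[OF Y X'], of 2]]])
      (simp_all add: I2_def algebra_simps power2_eq_square)
qed

lemma jet_jacobian:
  "\<exists>j1 j2. jet (\<lambda>e t. (X e t)\<^sup>2 + (Y e t)\<^sup>2 + X e t * Y' e t - Y e t * X' e t) (\<lambda>t. 4 * (cos a)\<^sup>2) j1 j2"
proof -
  obtain y2 x'2 y'1 y'2 where Y: "jet Y (\<lambda>t. 0) (\<lambda>t. - 2 * (sm * sin a * sin (real m * t))) y2"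
    and X': "jet X' (\<lambda>t. 0) (\<lambda>t. - 2 * (real m * x1 * sin (real m * t))) x'2"
    and Y': "jet Y' (\<lambda>t. 0) y'1 y'2"
    using jet_Y jet_X' jet_Y' by blast
  show ?thesis
    by (rule exI, rule exI, rule jet_cong[OF jet_diff[OF jet_add[OF jet_add[OF jet_mult[OF jet_X jet_X] jet_mult[OF Y Y]]
        jet_mult[OF jet_X Y']] jet_mult[OF Y X']]]; (rule refl | simp add: power2_eq_square))
qed

lemma has_integral_cos_sin:
  "((\<lambda>t. cos (real m * t)) has_integral 0) {0..2 * pi}"
  "((\<lambda>t. (cos (real m * t))\<^sup>2) has_integral pi) {0..2 * pi}"
  "((\<lambda>t. (sin (real m * t))\<^sup>2) has_integral pi) {0..2 * pi}"
proof -
  have m: "real m \<noteq> 0" using m_pos by simp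
  have z: "sin (real m * (2 * pi)) = 0" "sin (2 * real m * (2 * pi)) = 0"
    using sin_npi[of "2 * m"] sin_npi[of "4 * m"] by (simp_all add: algebra_simps)
  have c1: "((\<lambda>t. cos (real m * t)) has_integral
      sin (real m * (2 * pi)) / real m - sin (real m * 0) / real m) {0..2 * pi}"
    by (rule fundamental_theorem_of_calculus)
      (use m in \<open>auto intro!: derivative_eq_intros simp flip: has_real_derivative_iff_has_vector_derivative\<close>)
  then show "((\<lambda>t. cos (real m * t)) has_integral 0) {0..2 * pi}" by (simp add: z)
  have c2: "((\<lambda>t. cos (2 * real m * t)) has_integral
      sin (2 * real m * (2 * pi)) / (2 * real m) - sin (2 * real m * 0) / (2 * real m)) {0..2 * pi}"
    by (rule fundamental_theorem_of_calculus)
      (use m in \<open>auto intro!: derivative_eq_intros simp flip: has_real_derivative_iff_has_vector_derivative\<close>)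
  then have c2': "((\<lambda>t. cos (2 * real m * t)) has_integral 0) {0..2 * pi}" by (simp only: z) simp
  have one: "((\<lambda>t::real. 1 / 2 :: real) has_integral pi) {0..2 * pi}"
    using has_integral_const_real[of "1 / 2 :: real" 0 "2 * pi"] by simp
  have dbl: "cos (2 * real m * t) = 2 * (cos (real m * t))\<^sup>2 - 1"
    "cos (2 * real m * t) = 1 - 2 * (sin (real m * t))\<^sup>2" for t
    by (simp_all only: mult.assoc cos_double_cos, simp add: cos_squared_eq)
  have e: "(cos (real m * t))\<^sup>2 = 1 / 2 + 1 / 2 * cos (2 * real m * t)"
    "(sin (real m * t))\<^sup>2 = 1 / 2 - 1 / 2 * cos (2 * real m * t)" for t
    using dbl[of t] by linarith+
  show "((\<lambda>t. (cos (real m * t))\<^sup>2) has_integral pi) {0..2 * pi}"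
    unfolding e using has_integral_add[OF one has_integral_mult_right[OF c2', of "1 / 2"]] by simp
  show "((\<lambda>t. (sin (real m * t))\<^sup>2) has_integral pi) {0..2 * pi}"
    unfolding e using has_integral_diff[OF one has_integral_mult_right[OF c2', of "1 / 2"]] by simp
qed

text \<open>The second factor on the left is \<open>1 / (4 * pi)\<close> times the amount by which the integral of
  \<open>I2\<close> exceeds \<open>4 * pi * (cos a)\<^sup>2\<close>. The right-hand side does not involve \<open>\<kappa>\<close>.\<close>

lemma gain_eq:
  "(sin a)\<^sup>2 * (4 * cos a * x20 + x1\<^sup>2 + 2 * cos a * x22 + sm\<^sup>2 * (sin a)\<^sup>2 - 2 * sm * sin a * real m * x1 - (cos a)\<^sup>2)
    = w\<^sup>2 + (cm - w * cos a / sin a)\<^sup>2 - (sin a)\<^sup>2 - 2 * \<eta> * cos a * sin a"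
proof -
  define sa ca where "sa = sin a" and "ca = cos a"
  have sa: "sa \<noteq> 0" using sin_a_pos by (simp add: sa_def)
  note \<kappa>' = \<kappa>_eq[folded sa_def ca_def] and \<nu>' = \<nu>_eq[folded sa_def ca_def] and \<mu>' = \<mu>_eq[folded sa_def ca_def]
  have h1: "sa * x1 = w"
    using \<kappa>' by (simp add: x1_def algebra_simps power2_eq_square flip: sa_def ca_def)
  have "x22 * sa\<^sup>2 = - sa / 4 * (4 * sa\<^sup>2 * \<nu>) - ca * \<kappa>\<^sup>2 / 2 * sa\<^sup>2 - sa * \<kappa> * cm * sa\<^sup>2 - ca * sm * real m * \<kappa> * sa\<^sup>2"
    by (simp add: x22_def algebra_simps flip: sa_def ca_def)
  also have "\<dots> = cm * \<kappa> * sa\<^sup>2 * sa + sa\<^sup>2 * ca * \<kappa>\<^sup>2 / 2 + w * cm * sa / 2 - sa\<^sup>2 * ca / 2"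
    unfolding \<nu>' by (simp add: field_simps power2_eq_square)
  finally have h2: "x22 * sa\<^sup>2 = cm * \<kappa> * sa\<^sup>2 * sa + sa\<^sup>2 * ca * \<kappa>\<^sup>2 / 2 + w * cm * sa / 2 - sa\<^sup>2 * ca / 2" .
  have sc: "sa\<^sup>2 + ca\<^sup>2 = 1" "sm\<^sup>2 + cm\<^sup>2 = 1" by (simp_all add: sa_def ca_def sm_def cm_def)
  have h3: "ca * \<kappa> * sa + cm * sa\<^sup>2 = cm - w * ca / sa"
  proof -
    have "sa * (ca * \<kappa> * sa + cm * sa\<^sup>2) = ca * (\<kappa> * sa\<^sup>2) + cm * sa * sa\<^sup>2"
      by (simp add: algebra_simps power2_eq_square)
    also have "\<dots> = cm * sa * (sa\<^sup>2 + ca\<^sup>2) - w * ca"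
      unfolding \<kappa>' by (simp add: algebra_simps power2_eq_square)
    also have "\<dots> = sa * (cm - w * ca / sa)"
      unfolding sc using sa by (simp add: field_simps)
    finally show ?thesis by (rule mult_left_cancel[OF sa, THEN iffD1])
  qed
  have "sa\<^sup>2 * (4 * ca * x20 + x1\<^sup>2 + 2 * ca * x22 + sm\<^sup>2 * sa\<^sup>2 - 2 * sm * sa * real m * x1 - ca\<^sup>2)
    = - (ca * sa) * (4 * sa\<^sup>2 * \<mu>) + (sa * x1)\<^sup>2 + 2 * ca * (x22 * sa\<^sup>2) + sm\<^sup>2 * sa\<^sup>2 * sa\<^sup>2
      - 2 * sm * sa\<^sup>2 * (real m * (sa * x1)) - ca\<^sup>2 * sa\<^sup>2"
    by (simp add: x20_def algebra_simps power2_eq_square flip: sa_def ca_def)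
  also have "\<dots> = w\<^sup>2 + (ca * \<kappa> * sa + cm * sa\<^sup>2)\<^sup>2 - 2 * \<eta> * ca * sa
      - sa\<^sup>2 * ca\<^sup>2 - cm\<^sup>2 * sa\<^sup>2 * sa\<^sup>2 + sm\<^sup>2 * sa\<^sup>2 * (2 * ca\<^sup>2 + sa\<^sup>2 - 2)"
    unfolding \<mu>' h1 h2 w_eq by (simp add: field_simps power2_eq_square)
  also have "2 * ca\<^sup>2 + sa\<^sup>2 - 2 = - (sa\<^sup>2)" using sc(1) by simp
  also have "w\<^sup>2 + (ca * \<kappa> * sa + cm * sa\<^sup>2)\<^sup>2 - 2 * \<eta> * ca * sa
      - sa\<^sup>2 * ca\<^sup>2 - cm\<^sup>2 * sa\<^sup>2 * sa\<^sup>2 + sm\<^sup>2 * sa\<^sup>2 * - (sa\<^sup>2)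
    = w\<^sup>2 + (ca * \<kappa> * sa + cm * sa\<^sup>2)\<^sup>2 - 2 * \<eta> * ca * sa - sa\<^sup>2 * (ca\<^sup>2 + (sm\<^sup>2 + cm\<^sup>2) * sa\<^sup>2)"
    by (simp add: algebra_simps)
  also have "ca\<^sup>2 + (sm\<^sup>2 + cm\<^sup>2) * sa\<^sup>2 = 1" using sc by simp
  finally show ?thesis unfolding h3 by (simp add: sa_def ca_def algebra_simps)
qed

lemma eventually_expansion:
  assumes \<eta>: "0 < \<eta>" and gain: "2 * \<eta> * cos a * sin a < w\<^sup>2 + (cm - w * cos a / sin a)\<^sup>2 - (sin a)\<^sup>2"
  shows "eventually (\<lambda>e. (\<forall>t. 0 < al e t \<and> al e t < pi / 2) \<and>
    (\<forall>t. (2 * a - sin (2 * a)) * (1 + e\<^sup>2 / 2) \<le> twice_cap e t) \<and>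
    (\<forall>t. 0 < X e t) \<and> (\<forall>t. 0 < (X e t)\<^sup>2 + (Y e t)\<^sup>2 + X e t * Y' e t - Y e t * X' e t) \<and>
    8 * pi * (cos a)\<^sup>2 * (1 + e\<^sup>2 / 2) < integral {0..2 * pi} (\<lambda>t. (X e t)\<^sup>2 + (Y e t)\<^sup>2 - 2 * Y e t * X' e t))
    (at_right 0)"
proof -
  have c1: "eventually (\<lambda>e. \<forall>t. 0 < al e t) (at_right 0)"
    by (rule jet_eventually_pos[OF jet_al a_pos])
  have c2: "eventually (\<lambda>e. \<forall>t. 0 < pi / 2 - al e t) (at_right 0)"
    by (rule jet_eventually_pos[OF jet_diff[OF jet_const[of "pi / 2"] jet_al]]) (use a_less in simp)
  have c3: "eventually (\<lambda>e. \<forall>t. 0 \<le> twice_cap e t - (2 * a - sin (2 * a)) * (1 + e\<^sup>2 / 2)) (at_right 0)"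
    by (rule jet_eventually_nonneg[OF jet_twice_cap]) (use \<eta> in simp)
  have c4: "eventually (\<lambda>e. \<forall>t. 0 < X e t) (at_right 0)"
    by (rule jet_eventually_pos[OF jet_X]) (use cos_a_pos in simp)
  obtain j1 j2 where "jet (\<lambda>e t. (X e t)\<^sup>2 + (Y e t)\<^sup>2 + X e t * Y' e t - Y e t * X' e t) (\<lambda>t. 4 * (cos a)\<^sup>2) j1 j2"
    using jet_jacobian by blast
  then have c5: "eventually (\<lambda>e. \<forall>t. 0 < (X e t)\<^sup>2 + (Y e t)\<^sup>2 + X e t * Y' e t - Y e t * X' e t) (at_right 0)"
    by (rule jet_eventually_pos) (use cos_a_pos in simp)
  define A B D where "A = 4 * x1\<^sup>2 + 8 * cos a * x22" and "B = 8 * cos a * x20"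
    and "D = 4 * sm\<^sup>2 * (sin a)\<^sup>2 - 8 * sm * sin a * real m * x1"
  define G where "G = A * pi + (2 * pi) * B + D * pi"
  have "(\<lambda>t. A * (cos (real m * t))\<^sup>2 + B + D * (sin (real m * t))\<^sup>2) = I2"
    by (simp add: fun_eq_iff I2_def A_def B_def D_def)
  then have I2: "(I2 has_integral G) {0..2 * pi}"
    unfolding G_def
    using has_integral_add[OF has_integral_add[OF has_integral_mult_right[OF has_integral_cos_sin(2), of A]
        has_integral_const_real[of B 0 "2 * pi"]] has_integral_mult_right[OF has_integral_cos_sin(3), of D]]
    by simp
  have "0 < (sin a)\<^sup>2 * (4 * cos a * x20 + x1\<^sup>2 + 2 * cos a * x22 + sm\<^sup>2 * (sin a)\<^sup>2
      - 2 * sm * sin a * real m * x1 - (cos a)\<^sup>2)"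
    unfolding gain_eq using gain by simp
  then have "0 < 4 * cos a * x20 + x1\<^sup>2 + 2 * cos a * x22 + sm\<^sup>2 * (sin a)\<^sup>2
      - 2 * sm * sin a * real m * x1 - (cos a)\<^sup>2"
    using sin_a_pos by (simp add: zero_less_mult_iff)
  then have "0 < 4 * pi * (4 * cos a * x20 + x1\<^sup>2 + 2 * cos a * x22 + sm\<^sup>2 * (sin a)\<^sup>2
      - 2 * sm * sin a * real m * x1 - (cos a)\<^sup>2)" by simp
  then have "4 * pi * (cos a)\<^sup>2 < G" by (simp add: G_def A_def B_def D_def algebra_simps)
  then have c6: "eventually (\<lambda>e. 8 * pi * (cos a)\<^sup>2 + e * (8 * cos a * x1 * 0) + e\<^sup>2 * (4 * pi * (cos a)\<^sup>2)
      < integral {0..2 * pi} (\<lambda>t. (X e t)\<^sup>2 + (Y e t)\<^sup>2 - 2 * Y e t * X' e t)) (at_right 0)"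
  proof (rule jet_eventually_integral[OF jet_integrand _ _ _ I2, rotated -1])
    show "((\<lambda>t::real. 4 * (cos a)\<^sup>2) has_integral 8 * pi * (cos a)\<^sup>2) {0..2 * pi}"
      using has_integral_const_real[of "4 * (cos a)\<^sup>2" 0 "2 * pi"] by (simp add: mult.assoc)
    show "((\<lambda>t. 8 * cos a * x1 * cos (real m * t)) has_integral 8 * cos a * x1 * 0) {0..2 * pi}"
      by (rule has_integral_mult_right[OF has_integral_cos_sin(1)])
  qed (auto intro!: integrable_continuous_real continuous_intros continuous_X'_Y')
  from c1 c2 c3 c4 c5 c6 show ?thesis
  proof eventually_elim
    case (elim e)
    then show ?case by (simp add: algebra_simps)
  qed
qed

end

section \<open>Choice of the frequency and conclusion\<close>

text \<open>For every \<open>b\<close> with \<open>m * a - b\<close> an integer multiple of \<open>pi\<close>, the sine of \<open>m * a\<close> is at most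
  \<open>\<bar>b\<bar>\<close> and the cosine at least \<open>1 - \<bar>b\<bar>\<close> in absolute value. Dirichlet approximation of \<open>2 * a / pi\<close>
  gives an even \<open>m\<close> with \<open>b\<close> as small as required.\<close>

lemma exists_favourable_frequency:
  fixes a :: real
  assumes a: "0 < a" "a < pi / 2"
  obtains m :: nat where "even m" "0 < m"
    "(sin a)\<^sup>2 < (sin (real m * a) / real m)\<^sup>2 + (cos (real m * a) - sin (real m * a) / real m * cos a / sin a)\<^sup>2"
proof -
  have sa: "0 < sin a" "sin a < 1" and ca: "0 < cos a"
    using a sin_gt_zero[of a] cos_gt_zero[of a] sin_monotone_2pi[of a "pi / 2"] by auto
  define c where "c = pi * (1 + cos a / sin a)"
  have c: "0 < c" using sa ca by (simp add: c_def add_pos_pos)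
  obtain N :: nat where "c / (1 - sin a) < real N" using reals_Archimedean2 by blast
  moreover from this have N0: "0 < real N" using sa c divide_pos_pos[of c "1 - sin a"] by linarith
  ultimately have N: "c / real N < 1 - sin a" "0 < N" using sa by (simp_all add: field_simps)
  obtain h k :: int where k: "0 < k" "\<bar>of_int k * (2 * a / pi) - of_int h\<bar> < 1 / real N"
    using Dirichlet_approx[OF N(2)] by metis
  define m where "m = 2 * nat k"
  define b where "b = real m * a - of_int h * pi"
  have m: "even m" "0 < m" "real m = 2 * of_int k" using k(1) by (simp_all add: m_def)
  have "b = pi * (of_int k * (2 * a / pi) - of_int h)" by (simp add: b_def m field_simps)
  then have "\<bar>b\<bar> = pi * \<bar>of_int k * (2 * a / pi) - of_int h\<bar>" by (simp add: abs_mult)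
  also have "\<dots> < pi * (1 / real N)" using k(2) by (intro mult_strict_left_mono) auto
  finally have b: "\<bar>b\<bar> < pi / real N" by simp
  have ma: "real m * a = b + of_int h * pi" by (simp add: b_def)
  have sh: "sin (of_int h * pi) = 0" "\<bar>cos (of_int h * pi)\<bar> = 1"
    using sin_zero_iff_int2[of "of_int h * pi"] sin_zero_abs_cos_one by auto
  have s: "\<bar>sin (real m * a)\<bar> \<le> \<bar>b\<bar>"
    using abs_sin_x_le_abs_x[of b] sh by (simp add: ma sin_add abs_mult)
  have "\<bar>cos (real m * a)\<bar> = \<bar>cos b\<bar>" using sh by (simp add: ma cos_add abs_mult)
  moreover have "1 - \<bar>b\<bar> \<le> \<bar>cos b\<bar>"
  proof -
    have "1 - 2 * (sin (b / 2))\<^sup>2 = cos b" using cos_double_sin[of "b / 2"] by simp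
    moreover have "\<bar>sin (b / 2)\<bar> * \<bar>sin (b / 2)\<bar> \<le> \<bar>b / 2\<bar> * 1"
      using abs_sin_x_le_abs_x[of "b / 2"] by (intro mult_mono) auto
    then have "(sin (b / 2))\<^sup>2 \<le> \<bar>b\<bar> / 2" by (simp add: power2_eq_square flip: abs_mult)
    ultimately show ?thesis by linarith
  qed
  ultimately have cm: "1 - \<bar>b\<bar> \<le> \<bar>cos (real m * a)\<bar>" by simp
  define w where "w = sin (real m * a) / real m"
  have "\<bar>w\<bar> \<le> \<bar>sin (real m * a)\<bar> / 1"
    unfolding w_def abs_divide using m(2) by (intro divide_left_mono) auto
  then have w: "\<bar>w\<bar> \<le> \<bar>b\<bar>" using s by simp
  have "\<bar>w * (cos a / sin a)\<bar> \<le> \<bar>b\<bar> * (cos a / sin a)"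
    unfolding abs_mult using w sa ca by (intro mult_mono) auto
  moreover have "\<bar>b\<bar> * (1 + cos a / sin a) \<le> pi / real N * (1 + cos a / sin a)"
    using b sa ca by (intro mult_right_mono) (auto intro: add_nonneg_nonneg)
  moreover have "pi / real N * (1 + cos a / sin a) = c / real N" by (simp add: c_def)
  moreover have "\<bar>b\<bar> * (1 + cos a / sin a) = \<bar>b\<bar> + \<bar>b\<bar> * (cos a / sin a)"
    by (simp add: distrib_left)
  ultimately have "sin a < \<bar>cos (real m * a)\<bar> - \<bar>w * (cos a / sin a)\<bar>"
    using cm N(1) by linarith
  also have "\<dots> \<le> \<bar>cos (real m * a) - w * (cos a / sin a)\<bar>" by (rule abs_triangle_ineq2)
  finally have "(sin a)\<^sup>2 < (cos (real m * a) - w * (cos a / sin a))\<^sup>2"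
    using sa abs_le_square_iff[of "cos (real m * a) - w * (cos a / sin a)" "sin a"] by (simp add: not_le[symmetric])
  then have "(sin a)\<^sup>2 < w\<^sup>2 + (cos (real m * a) - w * cos a / sin a)\<^sup>2"
    using zero_le_power2[of w] by (simp only: times_divide_eq_right)
  then show ?thesis using that[OF m(1,2)] by (simp add: w_def)
qed

text \<open>The half angle of the chords of the unit disc that cut off caps of area \<open>\<delta> * pi / 2\<close>.\<close>

lemma exists_half_angle:
  fixes \<delta> :: real
  assumes "0 < \<delta>" "\<delta> < 1"
  obtains a where "0 < a" "a < pi / 2" "\<delta> * pi = 2 * a - sin (2 * a)"
proof -
  have "\<exists>a\<ge>0. a \<le> pi / 2 \<and> 2 * a - sin (2 * a) = \<delta> * pi"
    by (rule IVT') (use assms in \<open>auto intro!: continuous_intros\<close>)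
  then obtain a where a: "0 \<le> a" "a \<le> pi / 2" "2 * a - sin (2 * a) = \<delta> * pi" by blast
  have "a \<noteq> 0" using a(3) assms by auto
  moreover have "a \<noteq> pi / 2"
  proof
    assume "a = pi / 2"
    have "\<delta> * pi = 1 * pi" using a(3) unfolding \<open>a = pi / 2\<close> by simp
    then show False using assms by simp
  qed
  ultimately show ?thesis using a that[of a] by simp
qed

text \<open>A perturbed disc together with the expansion parameters of its chords.\<close>

locale wavy_chords = wavy m e + chord_expansion a m \<eta>
  for m :: nat and e a \<eta> :: real
begin

lemma chord_sum:
  "\<rho> (t - \<alpha>) *\<^sub>R dir (t - \<alpha>) + \<rho> (t + \<alpha>) *\<^sub>R dir (t + \<alpha>)
    = (2 * (cos \<alpha> * (1 + e * (cos (real m * t) * cos (real m * \<alpha>))))) *\<^sub>R dir t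
      + (- 2 * (e * (sin (real m * t) * (sin (real m * \<alpha>) * sin \<alpha>)))) *\<^sub>R dir (t + pi / 2)"
  by (simp add: vec2_eq_iff wavy_radius_def right_diff_distrib distrib_left cos_add cos_diff sin_add sin_diff)
    (simp add: algebra_simps)

lemma twice_cap_eq:
  "twice_cap e t = sq_primitive (t + al e t) - sq_primitive (t - al e t)
    - \<rho> (t - al e t) * \<rho> (t + al e t) * sin (2 * al e t)"
proof -
  define \<alpha> where "\<alpha> = al e t"
  have m: "real m \<noteq> 0" using m_pos by simp
  have s1: "sin (real m * (t + \<alpha>)) - sin (real m * (t - \<alpha>)) = 2 * cos (real m * t) * sin (real m * \<alpha>)"
    by (simp add: distrib_left right_diff_distrib sin_add sin_diff)
  have s2: "sin (2 * real m * (t + \<alpha>)) - sin (2 * real m * (t - \<alpha>)) = 2 * cos (2 * real m * t) * sin (2 * real m * \<alpha>)"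
    by (simp add: distrib_left right_diff_distrib sin_add sin_diff)
  have "sq_primitive (t + \<alpha>) - sq_primitive (t - \<alpha>)
    = 2 * \<alpha> + 2 * e / real m * (sin (real m * (t + \<alpha>)) - sin (real m * (t - \<alpha>)))
      + e\<^sup>2 * (\<alpha> + (sin (2 * real m * (t + \<alpha>)) - sin (2 * real m * (t - \<alpha>))) / (4 * real m))"
    by (simp add: sq_primitive_def right_diff_distrib diff_divide_distrib distrib_left add_divide_distrib)
  also have "\<dots> = 2 * \<alpha> + e * (4 / real m * cos (real m * t) * sin (real m * \<alpha>))
      + e\<^sup>2 * (\<alpha> + cos (2 * real m * t) / (2 * real m) * sin (2 * real m * \<alpha>))"
    unfolding s1 s2 using m by (simp add: field_simps)
  finally have P: "sq_primitive (t + \<alpha>) - sq_primitive (t - \<alpha>) = \<dots>" .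
  have dbl: "cos (2 * real m * u) = 2 * (cos (real m * u))\<^sup>2 - 1" for u
    by (simp only: mult.assoc cos_double_cos)
  have q: "cos (real m * (t - \<alpha>)) * cos (real m * (t + \<alpha>)) = 1 / 2 * (cos (2 * real m * t) + cos (2 * real m * \<alpha>))"
  proof -
    have "cos (real m * (t - \<alpha>)) * cos (real m * (t + \<alpha>))
      = (cos (real m * t))\<^sup>2 * (cos (real m * \<alpha>))\<^sup>2 - (sin (real m * t))\<^sup>2 * (sin (real m * \<alpha>))\<^sup>2"
      by (simp add: distrib_left right_diff_distrib cos_add cos_diff algebra_simps power2_eq_square)
    also have "\<dots> = 1 / 2 * (cos (2 * real m * t) + cos (2 * real m * \<alpha>))"
      unfolding dbl sin_squared_eq by (simp add: algebra_simps)
    finally show ?thesis .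
  qed
  have r: "cos (real m * (t - \<alpha>)) + cos (real m * (t + \<alpha>)) = 2 * cos (real m * t) * cos (real m * \<alpha>)"
    by (simp add: distrib_left right_diff_distrib cos_add cos_diff)
  have "\<rho> (t - \<alpha>) * \<rho> (t + \<alpha>) = 1 + e * (cos (real m * (t - \<alpha>)) + cos (real m * (t + \<alpha>)))
      + e\<^sup>2 * (cos (real m * (t - \<alpha>)) * cos (real m * (t + \<alpha>)))"
    by (simp add: wavy_radius_def algebra_simps power2_eq_square)
  then show ?thesis unfolding q r using P by (simp add: twice_cap_def \<alpha>_def)
qed

lemma conv_body_wavy_gt:
  assumes \<delta>: "0 < \<delta>" "\<delta> * pi = 2 * a - sin (2 * a)"
    and al: "\<And>t. 0 < al e t \<and> al e t < pi / 2"
    and F: "\<And>t. (2 * a - sin (2 * a)) * (1 + e\<^sup>2 / 2) \<le> twice_cap e t"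
    and X: "\<And>t. 0 < X e t"
    and J: "\<And>t. 0 < (X e t)\<^sup>2 + (Y e t)\<^sup>2 + X e t * Y' e t - Y e t * X' e t"
    and I: "8 * pi * (cos a)\<^sup>2 * (1 + e\<^sup>2 / 2) < integral {0..2 * pi} (\<lambda>t. (X e t)\<^sup>2 + (Y e t)\<^sup>2 - 2 * Y e t * X' e t)"
  shows "area (conv_body \<delta> (equal_area_disc K)) < area (conv_body \<delta> K)"
proof -
  let ?S = "{s *\<^sub>R (X e t *\<^sub>R dir t + Y e t *\<^sub>R dir (t + pi / 2)) | s t. 0 < s \<and> s < 1 \<and> 0 < t \<and> t < 2 * pi}"
  note S = area_rotating_frame[OF X_derivative Y_derivative continuous_X'_Y'(3,4) X J XY_periodic]
  have sub: "?S \<subseteq> conv_body \<delta> K"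
  proof
    fix z assume "z \<in> ?S"
    then obtain s t where z: "z = s *\<^sub>R (X e t *\<^sub>R dir t + Y e t *\<^sub>R dir (t + pi / 2))" "0 < s" "s < 1" by blast
    have "\<delta> * area K \<le> \<delta> * (pi * (1 + e\<^sup>2 / 2))"
      using area_wavy_disc_le \<delta>(1) by (intro mult_left_mono) auto
    also have "\<dots> = (2 * a - sin (2 * a)) * (1 + e\<^sup>2 / 2)" by (simp flip: \<delta>(2))
    also have "\<dots> \<le> twice_cap e t" by (rule F)
    finally have "s *\<^sub>R (\<rho> (t - al e t) *\<^sub>R dir (t - al e t) + \<rho> (t + al e t) *\<^sub>R dir (t + al e t)) \<in> conv_body \<delta> K"
      unfolding twice_cap_eq using al[of t] z by (intro chord_sum_in_conv_body) auto
    then show "z \<in> conv_body \<delta> K" unfolding chord_sum z X_def Y_def .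
  qed
  have "area (conv_body \<delta> (equal_area_disc K)) \<le> 4 * (cos a)\<^sup>2 * area K"
    by (rule area_conv_body_equal_area_disc_le[OF a_pos a_less \<delta>(2) area_wavy_disc_pos])
  also have "\<dots> \<le> 4 * (cos a)\<^sup>2 * (pi * (1 + e\<^sup>2 / 2))"
    by (intro mult_left_mono area_wavy_disc_le) auto
  also have "\<dots> = 8 * pi * (cos a)\<^sup>2 * (1 + e\<^sup>2 / 2) / 2" by (simp add: algebra_simps)
  also have "\<dots> < area ?S" unfolding S(2) using I by simp
  also have "\<dots> \<le> area (conv_body \<delta> K)"
    using S(1) by (intro measure_mono_fmeasurable sub conv_body_lmeasurable compact_wavy_disc)
      (use \<delta>(1) area_wavy_disc_pos in auto)
  finally show ?thesis .
qed

end

lemma eventually_wavy_disc_beats_disc: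
  assumes \<delta>: "0 < \<delta>" "\<delta> < 1"
  obtains m :: nat where
    "eventually (\<lambda>e. wavy m e \<and>
      area (conv_body \<delta> (equal_area_disc (wavy_disc m e))) < area (conv_body \<delta> (wavy_disc m e))) (at_right 0)"
proof -
  obtain a where a: "0 < a" "a < pi / 2" "\<delta> * pi = 2 * a - sin (2 * a)"
    using exists_half_angle[OF \<delta>] .
  obtain m :: nat where m: "even m" "0 < m" and gain:
    "(sin a)\<^sup>2 < (sin (real m * a) / real m)\<^sup>2 + (cos (real m * a) - sin (real m * a) / real m * cos a / sin a)\<^sup>2"
    using exists_favourable_frequency[OF a(1,2)] .
  define P where "P = (sin (real m * a) / real m)\<^sup>2 + (cos (real m * a) - sin (real m * a) / real m * cos a / sin a)\<^sup>2 - (sin a)\<^sup>2"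
  \<comment> \<open>This margin uses up half of the available gain \<open>P\<close>.\<close>
  define \<eta> where "\<eta> = P / (4 * cos a * sin a)"
  have sc: "0 < sin a" "0 < cos a" using a by (auto intro: sin_gt_zero cos_gt_zero)
  have P: "0 < P" using gain by (simp add: P_def)
  interpret ce: chord_expansion a m \<eta> by unfold_locales (use a m in auto)
  have \<eta>: "0 < \<eta>" using P sc by (simp add: \<eta>_def)
  have "2 * \<eta> * cos a * sin a = P / 2" using sc by (simp add: \<eta>_def)
  then have "2 * \<eta> * cos a * sin a < P" using P by simp
  then have "2 * \<eta> * cos a * sin a < ce.w\<^sup>2 + (ce.cm - ce.w * cos a / sin a)\<^sup>2 - (sin a)\<^sup>2"
    by (simp add: P_def ce.w_def ce.sm_def ce.cm_def)
  note exp = ce.eventually_expansion[OF \<eta> this]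
  have "eventually (\<lambda>e::real. 0 < e \<and> e < 1 / (1 + (real m)\<^sup>2)) (at_right 0)"
    unfolding eventually_at_right_field by (intro exI[of _ "1 / (1 + (real m)\<^sup>2)"]) (auto simp: add_pos_nonneg)
  with exp have "eventually (\<lambda>e. wavy m e \<and>
      area (conv_body \<delta> (equal_area_disc (wavy_disc m e))) < area (conv_body \<delta> (wavy_disc m e))) (at_right 0)"
  proof eventually_elim
    case (elim e)
    have "e * (1 + (real m)\<^sup>2) < 1"
      using elim(2) by (simp add: pos_less_divide_eq add_pos_nonneg)
    then interpret w: wavy m e by unfold_locales (use m elim(2) in auto)
    interpret wc: wavy_chords m e a \<eta> ..
    show ?case using wc.conv_body_wavy_gt[OF \<delta>(1) a(3)] elim(1) w.wavy_axioms by blast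
  qed
  then show ?thesis by (rule that)
qed

theorem theorem1p9:
  fixes \<delta> :: real
  assumes "0 < \<delta>" and "\<delta> < 1"
  shows "(\<exists>K. convex_body K \<and> symmetric_body K \<and>
              area (conv_body \<delta> K) > area (conv_body \<delta> (equal_area_disc K))) \<and>
         (\<forall>U. Cinf_neighborhood circle_one U \<longrightarrow>
            (\<exists>K. convex_body K \<and> symmetric_body K \<and>
                 area (conv_body \<delta> K) > area (conv_body \<delta> (equal_area_disc K)) \<and>
                 0 \<in> interior K \<and> radial_function K \<in> U))"
proof -
  obtain m :: nat where ev: "eventually (\<lambda>e. wavy m e \<and>
      area (conv_body \<delta> (equal_area_disc (wavy_disc m e))) < area (conv_body \<delta> (wavy_disc m e))) (at_right 0)"
    using eventually_wavy_disc_beats_disc[OF assms] .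
  have near: "\<exists>K. convex_body K \<and> symmetric_body K \<and>
      area (conv_body \<delta> K) > area (conv_body \<delta> (equal_area_disc K)) \<and>
      0 \<in> interior K \<and> radial_function K \<in> U" if U: "Cinf_neighborhood circle_one U" for U
  proof -
    obtain V where V: "openin Cinf_topology V" "circle_one \<in> V" "V \<subseteq> U"
      using U unfolding Cinf_neighborhood_def by blast
    obtain e0 where "e0 > 0" and e0: "\<forall>e<e0. wavy m e \<longrightarrow> radial_function (wavy_disc m e) \<in> V"
      using wavy_near_circle_one[OF V(1,2)] by blast
    then have "eventually (\<lambda>e::real. e < e0) (at_right 0)"
      unfolding eventually_at_right_field by blast
    with ev have "eventually (\<lambda>e. e < e0 \<and> wavy m e \<and>
        area (conv_body \<delta> (equal_area_disc (wavy_disc m e))) < area (conv_body \<delta> (wavy_disc m e))) (at_right 0)"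
      by eventually_elim simp
    then obtain e :: real where e: "e < e0" "wavy m e"
      "area (conv_body \<delta> (equal_area_disc (wavy_disc m e))) < area (conv_body \<delta> (wavy_disc m e))"
      using eventually_happens'[OF trivial_limit_at_right_real] by blast
    interpret wavy m e by (rule e(2))
    show ?thesis
      using convex_body_wavy_disc symmetric_body_wavy_disc zero_interior_wavy_disc e e0 V(3) by blast
  qed
  have "Cinf_neighborhood circle_one (topspace Cinf_topology)"
    unfolding Cinf_neighborhood_def using circle_one_in_topspace by blast
  from near[OF this] near show ?thesis by blast
qed

end
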